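(* Let $K$ be an infinite field and $S=K[x_{ij}\mid 1\le j\le n,\ 1\le i\le m_j]$ with the $\mathbb{Z}^n$-grading $\deg x_{ij}=e_j$. Let $\mathcal{F}\subseteq 2^{[n]}$ be a family of subsets of $[n]$ such that $$\text{if } A,B\in\mathcal{F}\text{ and }A\cap B\ne\emptyset,\text{ then } A\cup B\in\mathcal{F}.$$ Let $I\subseteq S$ be a Cartwright-Sturmfels ideal and let $J$ be the ideal of $S$ generated by the vector spaces $I_A$ with $A\in\mathcal{F}$. Then $J$ is Cartwright-Sturmfels. More precisely, for every term order $>$ on $S$ the initial ideal $\operatorname{in}_>(J)$ is generated by the monomial vector spaces $\operatorname{in}_>(I_A)$ with $A\in\mathcal{F}$.
   Context: Notation: $[n]=\{1,\dots,n\}$, $e_j$ is the $j$-th standard basis vector of $\mathbb{Z}^n$. For a $\mathbb{Z}^n$-graded ideal $I$ and $A\subseteq[n]$, $I_A$ denotes the graded component of $I$ in degree $\sum_{j\in A}e_j$. For a vector space $V$ of polynomials, $\operatorname{in}_>(V)$ is the $K$-vector space spanned by the initial monomials of the nonzero elements of $V$. All term orders are assumed to satisfy $x_{1j}>x_{2j}>\cdots>x_{m_jj}$ for all $j$. The group $\mathrm{GL}_{m_1}(K)\times\cdots\times\mathrm{GL}_{m_n}(K)$ acts on $S$ by $\mathbb{Z}^n$-graded automorphisms, the $j$-th factor acting linearly on the span of $x_{1j},\dots,x_{m_jj}$. Borel-fixed ideals are those fixed by the product of the subgroups of upper triangular matrices; a radical monomial ideal $J$ is Borel-fixed if and only if for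 all monomials $x_{ij}w\in J$ one has $x_{kj}w\in J$ for all $k<i$. The $\mathbb{Z}^n$-graded Hilbert series of a finitely generated $\mathbb{Z}^n$-graded module $M=\bigoplus_{a\in\mathbb{N}^n}M_a$ is $\sum_a(\dim_K M_a)Z^a\in\mathbb{Q}[[Z_1,\dots,Z_n]]$. A $\mathbb{Z}^n$-graded ideal $I$ of $S$ is Cartwright-Sturmfels (CS) if there exists a radical Borel-fixed monomial ideal of $S$ with the same $\mathbb{Z}^n$-graded Hilbert series as $I$. Equivalently, the $\mathbb{Z}^n$-graded generic initial ideal of $I$ (the initial ideal $\operatorname{in}_>(gI)$ for $g$ in a suitable non-empty Zariski open subset of the group $\mathrm{GL}_{m_1}(K)\times\cdots\times\mathrm{GL}_{m_n}(K)$) is radical. *)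

theory Defs
  imports
    "HOL-Library.Poly_Mapping"
    "HOL-Algebra.Ideal"
    "Jordan_Normal_Form.Matrix"
begin

section \<open>The polynomial ring\<close>

text \<open>
  The pair \<open>(i, j)\<close> stands for the variable $x_{ij}$, a power product is the map of its
  exponents, and a polynomial maps power products to coefficients; products of polynomials are
  the convolution product of \<^theory>\<open>HOL-Library.Poly_Mapping\<close>. The type has infinitely many
  variables; the ring $S$ is the subring of polynomials in the variables \<open>vars n m\<close>.
\<close>

type_synonym pp = "nat \<times> nat \<Rightarrow>\<^sub>0 nat"
type_synonym 'k mpoly = "pp \<Rightarrow>\<^sub>0 'k"

definition vars :: "nat \<Rightarrow> (nat \<Rightarrow> nat) \<Rightarrow> (nat \<times> nat) set" where
  "vars n m = {(i, j). 1 \<le> j \<and> j \<le> n \<and> 1 \<le> i \<and> i \<le> m j}"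

definition pps :: "nat \<Rightarrow> (nat \<Rightarrow> nat) \<Rightarrow> pp set" where
  "pps n m = {t. Poly_Mapping.keys t \<subseteq> vars n m}"

definition poly_ring :: "nat \<Rightarrow> (nat \<Rightarrow> nat) \<Rightarrow> 'k::field mpoly ring" where
  "poly_ring n m =
    \<lparr>carrier = {f. Poly_Mapping.keys f \<subseteq> pps n m},
     monoid.mult = (*), one = 1, zero = 0, add = (+)\<rparr>"

definition const :: "'k::field \<Rightarrow> 'k mpoly" where
  "const c = Poly_Mapping.single 0 c"

definition var :: "nat \<times> nat \<Rightarrow> 'k::field mpoly" where
  "var v = Poly_Mapping.single (Poly_Mapping.single v 1) 1"

definition monomial :: "pp \<Rightarrow> 'k::field mpoly" where
  "monomial t = Poly_Mapping.single t 1"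

global_interpretation kvec: vector_space "\<lambda>(c::'k::field) (f::'k mpoly). const c * f"
  by unfold_locales
    (simp_all add: const_def algebra_simps single_add mult_single flip: mult.assoc)

lemma zero_in_pps [simp]: "0 \<in> pps n m"
  by (simp add: pps_def)

lemma plus_in_pps: "s \<in> pps n m \<Longrightarrow> t \<in> pps n m \<Longrightarrow> s + t \<in> pps n m"
  using Poly_Mapping.keys_add[of s t] by (auto simp: pps_def)

lemma cring_poly_ring: "cring (poly_ring n m :: 'k::field mpoly ring)"
proof (rule cringI)
  show "abelian_group (poly_ring n m :: 'k mpoly ring)"
  proof (rule abelian_groupI)
    fix f g :: "'k mpoly"
    assume "f \<in> carrier (poly_ring n m)" "g \<in> carrier (poly_ring n m)"
    then show "f \<oplus>\<^bsub>poly_ring n m\<^esub> g \<in> carrier (poly_ring n m)"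
      using Poly_Mapping.keys_add[of f g] by (auto simp: poly_ring_def)
  next
    fix f :: "'k mpoly"
    assume "f \<in> carrier (poly_ring n m)"
    then show "\<exists>g\<in>carrier (poly_ring n m). g \<oplus>\<^bsub>poly_ring n m\<^esub> f = \<zero>\<^bsub>poly_ring n m\<^esub>"
      by (intro bexI[of _ "- f"]) (auto simp: poly_ring_def)
  qed (auto simp: poly_ring_def algebra_simps)
  show "comm_monoid (poly_ring n m :: 'k mpoly ring)"
  proof (rule comm_monoidI)
    fix f g :: "'k mpoly"
    assume "f \<in> carrier (poly_ring n m)" "g \<in> carrier (poly_ring n m)"
    then show "f \<otimes>\<^bsub>poly_ring n m\<^esub> g \<in> carrier (poly_ring n m)"
      using keys_mult[of f g] by (fastforce simp: poly_ring_def intro: plus_in_pps)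
  qed (auto simp: poly_ring_def algebra_simps)
qed (auto simp: poly_ring_def algebra_simps)


section \<open>The multigrading\<close>

text \<open>
  Every homogeneous element of $S$ has a degree in $\mathbb{N}^n$, so only those degrees are
  considered; they are finitely supported functions on the column indices.
\<close>

type_synonym multideg = "nat \<Rightarrow>\<^sub>0 nat"

definition mdeg :: "pp \<Rightarrow> multideg" where
  "mdeg t =
    (\<Sum>(i, j)\<in>Poly_Mapping.keys t. Poly_Mapping.single j (Poly_Mapping.lookup t (i, j)))"

definition hom_part :: "multideg \<Rightarrow> 'k::field mpoly \<Rightarrow> 'k mpoly" where
  "hom_part a f =
    (\<Sum>t\<in>{t \<in> Poly_Mapping.keys f. mdeg t = a}.
       Poly_Mapping.single t (Poly_Mapping.lookup f t))"

definition component :: "'k::field mpoly set \<Rightarrow> multideg \<Rightarrow> 'k mpoly set" where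
  "component I a = {f \<in> I. \<forall>t\<in>Poly_Mapping.keys f. mdeg t = a}"

definition set_component :: "'k::field mpoly set \<Rightarrow> nat set \<Rightarrow> 'k mpoly set" where
  "set_component I A = component I (\<Sum>j\<in>A. Poly_Mapping.single j 1)"

definition graded_ideal :: "nat \<Rightarrow> (nat \<Rightarrow> nat) \<Rightarrow> 'k::field mpoly set \<Rightarrow> bool" where
  "graded_ideal n m I \<longleftrightarrow> ideal I (poly_ring n m) \<and> (\<forall>f\<in>I. \<forall>a. hom_part a f \<in> I)"

text \<open>The series in $\mathbb{Q}[[Z_1,\dots,Z_n]]$ is given by its coefficients; those at degrees
  that are not supported in $\{1,\dots,n\}$ vanish for subsets of $S$.\<close>

definition hilbert_series :: "'k::field mpoly set \<Rightarrow> multideg \<Rightarrow> rat" where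
  "hilbert_series I a = of_nat (kvec.dim (component I a))"


section \<open>Borel-fixed ideals\<close>

definition poly_subst :: "(nat \<times> nat \<Rightarrow> 'k::field mpoly) \<Rightarrow> 'k mpoly \<Rightarrow> 'k mpoly" where
  "poly_subst \<sigma> f =
    (\<Sum>t\<in>Poly_Mapping.keys f. const (Poly_Mapping.lookup f t) *
       (\<Prod>v\<in>Poly_Mapping.keys t. \<sigma> v ^ Poly_Mapping.lookup t v))"

text \<open>The family \<open>g\<close> maps $x_{ij}$ to $\sum_k (g_j)_{ki} x_{kj}$. Matrix entries are indexed
  from 0 in \<^theory>\<open>Jordan_Normal_Form.Matrix\<close>, the variables from 1. For upper triangular
  \<open>g\<close> only the $x_{kj}$ with $k \le i$ occur in the image of $x_{ij}$.\<close>

definition gl_act :: "(nat \<Rightarrow> nat) \<Rightarrow> (nat \<Rightarrow> 'k::field mat) \<Rightarrow> 'k mpoly \<Rightarrow> 'k mpoly" where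
  "gl_act m g =
    poly_subst (\<lambda>(i, j). \<Sum>k = 1..m j. const (g j $$ (k - 1, i - 1)) * var (k, j))"

definition gl_group :: "nat \<Rightarrow> (nat \<Rightarrow> nat) \<Rightarrow> (nat \<Rightarrow> 'k::field mat) set" where
  "gl_group n m = {g. \<forall>j\<in>{1..n}. g j \<in> carrier_mat (m j) (m j) \<and> invertible_mat (g j)}"

definition borel_group :: "nat \<Rightarrow> (nat \<Rightarrow> nat) \<Rightarrow> (nat \<Rightarrow> 'k::field mat) set" where
  "borel_group n m = {g \<in> gl_group n m. \<forall>j\<in>{1..n}. upper_triangular (g j)}"

definition borel_fixed :: "nat \<Rightarrow> (nat \<Rightarrow> nat) \<Rightarrow> 'k::field mpoly set \<Rightarrow> bool" where
  "borel_fixed n m I \<longleftrightarrow> (\<forall>g\<in>borel_group n m. gl_act m g ` I = I)"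


section \<open>Cartwright-Sturmfels ideals\<close>

definition monomial_ideal :: "nat \<Rightarrow> (nat \<Rightarrow> nat) \<Rightarrow> 'k::field mpoly set \<Rightarrow> bool" where
  "monomial_ideal n m I \<longleftrightarrow> (\<exists>T\<subseteq>pps n m. I = Idl\<^bsub>poly_ring n m\<^esub> (monomial ` T))"

definition radical_ideal :: "nat \<Rightarrow> (nat \<Rightarrow> nat) \<Rightarrow> 'k::field mpoly set \<Rightarrow> bool" where
  "radical_ideal n m I \<longleftrightarrow>
    ideal I (poly_ring n m) \<and> {f \<in> carrier (poly_ring n m). \<exists>k. f ^ k \<in> I} = I"

definition cartwright_sturmfels :: "nat \<Rightarrow> (nat \<Rightarrow> nat) \<Rightarrow> 'k::field mpoly set \<Rightarrow> bool" where
  "cartwright_sturmfels n m I \<longleftrightarrow>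
    graded_ideal n m I \<and>
    (\<exists>J :: 'k mpoly set. monomial_ideal n m J \<and> radical_ideal n m J \<and>
       borel_fixed n m J \<and> hilbert_series J = hilbert_series I)"


section \<open>Initial spaces\<close>

text \<open>A term order is a set of pairs, \<open>(s, t) \<in> r\<close> meaning $s \le t$. The last conjunct is the
  standing convention $x_{1j} > \dots > x_{m_j j}$.\<close>

definition term_order :: "nat \<Rightarrow> (nat \<Rightarrow> nat) \<Rightarrow> pp rel \<Rightarrow> bool" where
  "term_order n m r \<longleftrightarrow>
    linear_order_on (pps n m) r \<and>
    (\<forall>t\<in>pps n m. (0, t) \<in> r) \<and>
    (\<forall>s t u. (s, t) \<in> r \<longrightarrow> u \<in> pps n m \<longrightarrow> (s + u, t + u) \<in> r) \<and>
    (\<forall>i k j. (i, j) \<in> vars n m \<longrightarrow> (k, j) \<in> vars n m \<longrightarrow> i < k \<longrightarrow>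
       (Poly_Mapping.single (k, j) 1, Poly_Mapping.single (i, j) 1) \<in> r)"

definition lead_pp :: "pp rel \<Rightarrow> 'k::field mpoly \<Rightarrow> pp" where
  "lead_pp r f = (THE t. t \<in> Poly_Mapping.keys f \<and> (\<forall>s\<in>Poly_Mapping.keys f. (s, t) \<in> r))"

definition initial_space :: "pp rel \<Rightarrow> 'k::field mpoly set \<Rightarrow> 'k mpoly set" where
  "initial_space r V = kvec.span {monomial (lead_pp r f) |f. f \<in> V \<and> f \<noteq> 0}"

end

(*
  The leading power products of an ideal I form a monomial ideal L with the Hilbert function of I.
  If I has the Hilbert function of a radical Borel-fixed ideal B, then every power product in L is
  divisible by one in L of squarefree multidegree with the same column support. For this, L is
  compressed (exchange x_i for x_k with k < i, as lex ideals in two variables) infinitely often; the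
  compressions preserve the Hilbert function, L inherits the divisibility property from their limit
  G by a dimension count, and G is strongly stable. By Dickson's lemma, in large degrees the elements of G that involve
  only the first u_j variables of each column j are counted by a recursion which depends on the
  Hilbert function only. For G and for B these counts therefore agree, which gives
  (prod_j x_{u_j j})^N in G iff it is in B, then G <= B, and then G = B.

  In a fixed degree with column support C only the maximal A in F with A <= C matter, and these are
  pairwise disjoint. The tensor product of the normal form maps modulo I over these blocks kills J
  and fixes every monomial that no leading term of the I_A divides, which yields in(J). Counting
  blockwise, the Hilbert function of J depends on that of I only, so that it can be computed with
  B in place of I.
*)
theory Submission
  imports
    Defs
    "HOL-Library.Countable"
    "HOL-Library.Product_Lexorder"
    "Jordan_Normal_Form.Gauss_Jordan_Elimination"
begin

text \<open>The definition relates \<open>I\<close> and \<open>B\<close> by dimensions alone; no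
  element of one can be traced to the other. Generic coordinates would be the algebraic bridge.
  Compressions are a combinatorial substitute: they act on one multidegree at a time and keep
  cardinalities, so that a property of the limit can be pulled back by counting. A limit is taken
  because the number of effective steps is controlled only degree by degree. Equal Hilbert functions
  do not make strongly stable ideals equal: in one column with three variables,
  \<open>(x^2, xy, y^3)\<close> and \<open>(x^2, xy, xz^2, y^4)\<close> share theirs. Counting in
  large degrees only detects high powers, so one side of the comparison has to be squarefree: it
  contains a product of distinct variables as soon as it contains a power of it. For the initial
  ideal the danger is cancellation between multiples of different components \<open>I_A\<close>.
  Instead of handling syzygies, the proof exhibits a linear map that vanishes on \<open>J\<close> in
  the given degree and under which a forbidden leading term could not cancel.\<close>

abbreviation (input) lookup where "lookup \<equiv> Poly_Mapping.lookup"
abbreviation (input) keys where "keys \<equiv> Poly_Mapping.keys"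
abbreviation (input) single where "single \<equiv> Poly_Mapping.single"

section \<open>Power products\<close>

lemma lookup_mdeg: "lookup (mdeg t) j = (\<Sum>v\<in>keys t. lookup t v when snd v = j)"
  by (auto simp: mdeg_def lookup_sum lookup_single case_prod_beta intro!: sum.cong)

lemma mdeg_add: "mdeg (s + t) = mdeg s + mdeg t"
proof (rule poly_mapping_eqI)
  fix j
  have ext: "lookup (mdeg u) j = (\<Sum>v\<in>keys s \<union> keys t. lookup u v when snd v = j)"
    if "keys u \<subseteq> keys s \<union> keys t" for u
    unfolding lookup_mdeg using that
    by (intro sum.mono_neutral_left) (auto simp: in_keys_iff)
  show "lookup (mdeg (s + t)) j = lookup (mdeg s + mdeg t) j"
    using Poly_Mapping.keys_add[of s t]
    by (simp add: ext lookup_add sum.distrib when_add_distrib)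
qed

lemma mdeg_zero [simp]: "mdeg 0 = 0"
  by (simp add: mdeg_def)

lemma mdeg_single: "mdeg (single v k) = single (snd v) k"
  by (cases v) (simp add: mdeg_def)

lemma mdeg_sum: "mdeg (sum f X) = (\<Sum>x\<in>X. mdeg (f x))"
  by (induction X rule: infinite_finite_induct) (auto simp: mdeg_add)

text \<open>Rows of \<open>vars n m\<close> start at 1, so this is positive on nontrivial power
  products and serves as an induction measure. Moving exponents to smaller rows lowers it, which is
  what makes compression settle in each degree.\<close>

definition weight :: "pp \<Rightarrow> nat" where
  "weight t = (\<Sum>v\<in>keys t. fst v * lookup t v)"

lemma weight_add: "weight (s + t) = weight s + weight t"
proof -
  have ext: "weight u = (\<Sum>v\<in>keys s \<union> keys t. fst v * lookup u v)"
    if "keys u \<subseteq> keys s \<union> keys t" for u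
    unfolding weight_def using that
    by (intro sum.mono_neutral_left) (auto simp: in_keys_iff)
  show ?thesis
    using Poly_Mapping.keys_add[of s t]
    by (simp add: ext lookup_add sum.distrib algebra_simps)
qed

lemma weight_single: "weight (single v k) = fst v * k"
  by (simp add: weight_def)

lemma keys_add_pp: "keys (s + t) = keys s \<union> keys (t :: 'a \<Rightarrow>\<^sub>0 nat)"
  by (auto simp: in_keys_iff lookup_add)

lemma in_pps_iff: "t \<in> pps n m \<longleftrightarrow> keys t \<subseteq> vars n m"
  by (simp add: pps_def)

lemma add_in_pps_iff: "s + t \<in> pps n m \<longleftrightarrow> s \<in> pps n m \<and> t \<in> pps n m"
  by (auto simp: in_pps_iff keys_add_pp)

lemma single_in_pps: "v \<in> vars n m \<Longrightarrow> single v k \<in> pps n m"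
  by (auto simp: in_pps_iff)

lemma lookup_le_mdeg: "lookup t v \<le> lookup (mdeg t) (snd v)"
proof (cases "v \<in> keys t")
  case True
  have "lookup t v = (lookup t v when snd v = snd v)" by simp
  also have "\<dots> \<le> lookup (mdeg t) (snd v)"
    unfolding lookup_mdeg using True by (intro member_le_sum) auto
  finally show ?thesis .
qed (simp add: in_keys_iff)

lemma keys_mdeg: "keys (mdeg t) = snd ` keys t"
proof
  show "keys (mdeg t) \<subseteq> snd ` keys t"
  proof
    fix j assume "j \<in> keys (mdeg t)"
    then have "lookup (mdeg t) j \<noteq> 0" by (simp add: in_keys_iff)
    then obtain v where "v \<in> keys t" "snd v = j"
      unfolding lookup_mdeg by (auto elim!: sum.not_neutral_contains_not_neutral simp: when_def split: if_splits)
    then show "j \<in> snd ` keys t" by auto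
  qed
  show "snd ` keys t \<subseteq> keys (mdeg t)"
  proof (intro image_subsetI)
    fix v assume "v \<in> keys t"
    then show "snd v \<in> keys (mdeg t)"
      using lookup_le_mdeg[of t v] by (simp add: in_keys_iff)
  qed
qed

lemma finite_vars: "finite (vars n m)"
proof (rule finite_subset)
  show "vars n m \<subseteq> (\<Union>j\<in>{1..n}. {1..m j} \<times> {j})" by (auto simp: vars_def)
qed auto

lemma pp_split: "lookup t v > 0 \<Longrightarrow> \<exists>t'. t = single v 1 + (t' :: 'a \<Rightarrow>\<^sub>0 nat)"
  by (rule exI[of _ "t - single v 1"])
     (auto intro!: poly_mapping_eqI simp: lookup_add lookup_minus lookup_single when_def)

lemma pp_splitI: "(\<And>v. lookup s v \<le> lookup t v) \<Longrightarrow> \<exists>u. t = s + (u :: 'a \<Rightarrow>\<^sub>0 nat)"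
  by (rule exI[of _ "t - s"])
     (auto intro!: poly_mapping_eqI simp: lookup_add lookup_minus)

text \<open>Each exponent is bounded by the degree of its column. All counting below takes place in
  these finite pieces.\<close>

lemma finite_degree: "finite {t \<in> pps n m. mdeg t = D}"
proof -
  have "finite (PiE (vars n m) (\<lambda>v. {..lookup D (snd v)}))" (is "finite ?P")
    by (intro finite_PiE finite_vars) auto
  moreover have "inj_on (\<lambda>t. restrict (lookup t) (vars n m)) {t \<in> pps n m. mdeg t = D}"
  proof (rule inj_onI)
    fix s t :: pp
    assume st: "s \<in> {t \<in> pps n m. mdeg t = D}" "t \<in> {t \<in> pps n m. mdeg t = D}"
      and eq: "restrict (lookup s) (vars n m) = restrict (lookup t) (vars n m)"
    show "s = t"
    proof (rule poly_mapping_eqI)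
      fix v
      show "lookup s v = lookup t v"
      proof (cases "v \<in> vars n m")
        case True
        then show ?thesis using fun_cong[OF eq, of v] by simp
      next
        case False
        then have "v \<notin> keys s" "v \<notin> keys t" using st by (auto simp: in_pps_iff)
          then show ?thesis by (simp add: in_keys_iff)
      qed
    qed
  qed
  moreover have "(\<lambda>t. restrict (lookup t) (vars n m)) ` {t \<in> pps n m. mdeg t = D} \<subseteq> ?P"
    using lookup_le_mdeg by auto
  ultimately show ?thesis by (meson finite_imageD finite_subset)
qed


section \<open>Compression\<close>

text \<open>Compression turns the members of \<open>X\<close> on each string of slides into an initial segment,
  which amounts to passing to the lex ideal in two variables with the same Hilbert function.\<close>

definition slide :: "nat \<times> nat \<Rightarrow> nat \<times> nat \<Rightarrow> pp \<Rightarrow> nat \<Rightarrow> pp" where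
  "slide a b w e = Poly_Mapping.update a e (Poly_Mapping.update b (lookup w a + lookup w b - e) w)"

text \<open>The bound on \<open>e\<close> matters: beyond it the truncated subtraction in
  \<open>slide\<close> would change the degree and leave the string.\<close>

definition string_exps :: "nat \<times> nat \<Rightarrow> nat \<times> nat \<Rightarrow> pp set \<Rightarrow> pp \<Rightarrow> nat set" where
  "string_exps a b X w = {e. e \<le> lookup w a + lookup w b \<and> slide a b w e \<in> X}"

definition compress :: "nat \<times> nat \<Rightarrow> nat \<times> nat \<Rightarrow> pp set \<Rightarrow> pp set" where
  "compress a b X = {w. lookup w a < card (string_exps a b X w)}"

definition mon_ideal :: "nat \<Rightarrow> (nat \<Rightarrow> nat) \<Rightarrow> pp set \<Rightarrow> bool" where
  "mon_ideal n m M \<longleftrightarrow> M \<subseteq> pps n m \<and> (\<forall>w\<in>M. \<forall>t\<in>pps n m. w + t \<in> M)"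

definition degp :: "pp set \<Rightarrow> multideg \<Rightarrow> pp set" where
  "degp X D = {w \<in> X. mdeg w = D}"

lemma lookup_slide:
  "lookup (slide a b w e) v =
    (if v = a then e else if v = b then lookup w a + lookup w b - e else lookup w v)"
  by (simp add: slide_def lookup_update)

lemma string_exps_subset: "string_exps a b X w \<subseteq> {..lookup w a + lookup w b}"
  by (auto simp: string_exps_def)

lemma finite_string_exps [simp]: "finite (string_exps a b X w)"
  by (rule finite_subset[OF string_exps_subset]) auto

context
  fixes a b :: "nat \<times> nat"
  assumes ab: "a \<noteq> b"
begin

text \<open>No power products are subtracted here, so additive functions such as \<open>mdeg\<close>
  and \<open>weight\<close> can be applied to both sides.\<close>

lemma slide_add_eq:
  assumes "e \<le> lookup w a + lookup w b"
  shows "slide a b w e + (single a (lookup w a) + single b (lookup w b)) =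
         w + (single a e + single b (lookup w a + lookup w b - e))"
  using ab assms
  by (intro poly_mapping_eqI) (auto simp: lookup_slide lookup_add lookup_single when_def)

lemma slide_slide:
  assumes "e \<le> lookup w a + lookup w b"
  shows "slide a b (slide a b w e) e' = slide a b w e'"
  using ab assms by (intro poly_mapping_eqI) (auto simp: lookup_slide)

lemma slide_self [simp]: "slide a b w (lookup w a) = w"
  using ab by (intro poly_mapping_eqI) (auto simp: lookup_slide)

lemma string_exps_slide:
  assumes "e \<le> lookup w a + lookup w b"
  shows "string_exps a b X (slide a b w e) = string_exps a b X w"
  using ab assms by (auto simp: string_exps_def slide_slide lookup_slide)

lemma string_exps_compress:
  "string_exps a b (compress a b X) w = {..<card (string_exps a b X w)}"
proof -
  \<comment> \<open>The string has only \<open>lookup w a + lookup w b + 1\<close> positions, so an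
    initial segment of this cardinality fits into it.\<close>
  have "card (string_exps a b X w) \<le> lookup w a + lookup w b + 1"
    using card_mono[OF finite_atMost string_exps_subset[of a b X w]] by simp
  moreover have "slide a b w e \<in> compress a b X \<longleftrightarrow> e < card (string_exps a b X w)"
    if "e \<le> lookup w a + lookup w b" for e
    using that by (simp add: compress_def string_exps_slide lookup_slide)
  ultimately show ?thesis by (auto simp: string_exps_def)
qed


lemma mdeg_slide:
  assumes "snd a = snd b" "e \<le> lookup w a + lookup w b"
  shows "mdeg (slide a b w e) = mdeg w"
proof -
  have "mdeg (slide a b w e) + single (snd b) (lookup w a + lookup w b) =
        mdeg w + single (snd b) (lookup w a + lookup w b)"
    using arg_cong[OF slide_add_eq[OF assms(2)], of mdeg] assms
    by (simp add: mdeg_add mdeg_single flip: single_add)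
  then show ?thesis by simp
qed

text \<open>Along a string the weight is affine in the exponent of \<open>a\<close>; comparing total
  weights thus reduces to comparing sums of exponents.\<close>

lemma weight_slide:
  assumes "fst b \<le> fst a"  "e \<le> lookup w a + lookup w b"
  shows "weight (slide a b w e) = weight (slide a b w 0) + (fst a - fst b) * e"
proof -
  let ?s = "lookup w a + lookup w b"
  have *: "weight (slide a b w e') + (fst a * lookup w a + fst b * lookup w b) =
        weight w + (fst a * e' + fst b * (?s - e'))" if "e' \<le> ?s" for e'
    using arg_cong[OF slide_add_eq[OF that], of weight] by (simp add: weight_add weight_single)
  obtain d where d: "fst a = fst b + d" using assms(1) le_Suc_ex by blast
  obtain c where c: "?s = e + c" using assms(2) le_Suc_ex by blast
  show ?thesis using *[of 0] *[OF assms(2)] unfolding c d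
    by (simp add: algebra_simps)
qed

lemma slide_in_pps:
  "w \<in> pps n m \<Longrightarrow> a \<in> vars n m \<Longrightarrow> b \<in> vars n m \<Longrightarrow> slide a b w e \<in> pps n m"
proof -
  have "keys (slide a b w e) \<subseteq> insert a (insert b (keys w))"
    by (auto simp: in_keys_iff lookup_slide split: if_splits)
  then show "w \<in> pps n m \<Longrightarrow> a \<in> vars n m \<Longrightarrow> b \<in> vars n m \<Longrightarrow> slide a b w e \<in> pps n m"
    by (auto simp: in_pps_iff)
qed

lemma compress_subset_pps:
  assumes "X \<subseteq> pps n m" "a \<in> vars n m" "b \<in> vars n m"
  shows "compress a b X \<subseteq> pps n m"
proof
  fix w assume "w \<in> compress a b X"
  then have "0 < card (string_exps a b X w)" by (simp add: compress_def)
  then have "string_exps a b X w \<noteq> {}" unfolding card_gt_0_iff by simp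
  then obtain e where e: "slide a b w e \<in> X" "e \<le> lookup w a + lookup w b"
    by (auto simp: string_exps_def)
  then have "slide a b (slide a b w e) (lookup w a) \<in> pps n m"
    using assms by (intro slide_in_pps[where w = "slide a b w e"]) auto
  then show "w \<in> pps n m" using e by (simp add: slide_slide)
qed

text \<open>This is the growth of ideals in two variables: multiplication by \<open>x_a\<close>
  enlarges a nonempty set of string exponents by at least one, and multiplication by any other
  variable never shrinks it.\<close>

lemma compress_mon_ideal:
  assumes X: "mon_ideal n m X" and a: "a \<in> vars n m" and b: "b \<in> vars n m"
  shows "mon_ideal n m (compress a b X)"
proof -
  have cl: "u + single v 1 \<in> X" if "u \<in> X" "v \<in> vars n m" for u v
    using X that by (auto simp: mon_ideal_def single_in_pps)
  have step: "w + single v 1 \<in> compress a b X"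
    if w: "w \<in> compress a b X" and v: "v \<in> vars n m" for w v
  proof -
    let ?w = "w + single v 1" and ?E = "string_exps a b X w"
    let ?E' = "string_exps a b X ?w"
    have lt: "lookup w a < card ?E" using w by (simp add: compress_def)
    have sub: "?E \<subseteq> ?E'"
    proof
      fix e assume e: "e \<in> ?E"
      \<comment> \<open>A slide has its exponent of \<open>a\<close> prescribed, so an additional
        factor \<open>x_a\<close> of \<open>w\<close> reappears as a factor
        \<open>x_b\<close>.\<close>
      define v' where "v' = (if v = a then b else v)"
      have "slide a b ?w e = slide a b w e + single v' 1"
        using ab e by (intro poly_mapping_eqI)
          (auto simp: lookup_slide lookup_add lookup_single when_def string_exps_def v'_def)
      then show "e \<in> ?E'" using e cl[of "slide a b w e" v'] v b
        by (auto simp: string_exps_def lookup_add v'_def)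
    qed
    show ?thesis
    proof (cases "v = a")
      case True
      \<comment> \<open>Multiplying the slide with the largest exponent by \<open>x_a\<close> yields
        one exponent beyond all inherited ones.\<close>
      let ?M = "Max ?E"
      have ne: "?E \<noteq> {}" using lt by auto
      then have M: "?M \<in> ?E" by (intro Max_in) auto
      have "slide a b ?w (Suc ?M) = slide a b w ?M + single a 1"
        using ab M True by (intro poly_mapping_eqI)
          (auto simp: lookup_slide lookup_add lookup_single when_def string_exps_def)
      then have "Suc ?M \<in> ?E'" using M cl[of "slide a b w ?M" a] a True
        by (auto simp: string_exps_def lookup_add)
      moreover have "Suc ?M \<notin> ?E" by (meson Max_ge Suc_n_not_le_n finite_string_exps)
      ultimately have "card (insert (Suc ?M) ?E) \<le> card ?E'"
        using sub by (intro card_mono) auto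
      with \<open>Suc ?M \<notin> ?E\<close> lt True show ?thesis
        by (simp add: compress_def lookup_add)
    next
      case False
      have "card ?E \<le> card ?E'" using sub by (intro card_mono) auto
      with False lt show ?thesis by (simp add: compress_def lookup_add lookup_single when_def)
    qed
  qed
  have "w + t \<in> compress a b X" if "w \<in> compress a b X" "t \<in> pps n m" for w t
    using that(2,1)
  proof (induction "weight t" arbitrary: t w rule: less_induct)
    case less
    show ?case
    proof (cases "t = 0")
      case False
      then obtain v where v: "v \<in> keys t" by (metis all_not_in_conv keys_eq_empty)
      then obtain t' where t': "t = single v 1 + t'"
        using pp_split[of t v] by (auto simp: in_keys_iff)
      from v less.prems have vv: "v \<in> vars n m" by (auto simp: in_pps_iff)
      then have "weight t' < weight t" by (auto simp: t' weight_add weight_single vars_def)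
      moreover have "t' \<in> pps n m" using less.prems t' add_in_pps_iff by metis
      ultimately have "(w + single v 1) + t' \<in> compress a b X"
        using less step vv by blast
      then show ?thesis by (simp add: t' add.assoc)
    qed (use less in auto)
  qed
  then show ?thesis using X compress_subset_pps[OF _ a b]
    by (auto simp: mon_ideal_def)
qed

text \<open>The slide with exponent 0 at \<open>a\<close> represents its string. With a general
  \<open>h\<close> the same decomposition serves to count and to weigh.\<close>

lemma sum_strings:
  fixes h :: "pp \<Rightarrow> nat"
  assumes fin: "finite Y"
    and cl: "\<And>w e. w \<in> Y \<Longrightarrow> e \<le> lookup w a + lookup w b \<Longrightarrow> slide a b w e \<in> Y"
  shows "sum h (X \<inter> Y) =
    (\<Sum>z\<in>(\<lambda>w. slide a b w 0) ` Y. \<Sum>e\<in>string_exps a b X z. h (slide a b z e))"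
proof -
  let ?p = "\<lambda>w. slide a b w 0"
  have fib: "{w \<in> X \<inter> Y. ?p w = z} = slide a b z ` string_exps a b X z" if z: "z \<in> ?p ` Y" for z
  proof (intro equalityI subsetI)
    fix w assume "w \<in> {w \<in> X \<inter> Y. ?p w = z}"
    then have w: "w \<in> X" "z = ?p w" by auto
    have "lookup w a \<in> string_exps a b X z"
      using w ab by (simp add: string_exps_def slide_slide lookup_slide)
    moreover have "w = slide a b z (lookup w a)" using w by (simp add: slide_slide)
    ultimately show "w \<in> slide a b z ` string_exps a b X z" by blast
  next
    fix w assume "w \<in> slide a b z ` string_exps a b X z"
    then obtain e where e: "w = slide a b z e" "slide a b z e \<in> X" "e \<le> lookup z a + lookup z b"
      by (auto simp: string_exps_def)
    from z obtain y where y: "y \<in> Y" "z = ?p y" by auto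
    have "z \<in> Y" using y cl by simp
    then have "w \<in> Y" using e cl by simp
    moreover have "?p w = z"
      using slide_slide[OF e(3), of 0] slide_slide[of 0 y 0] e(1) y(2) by simp
    ultimately show "w \<in> {w \<in> X \<inter> Y. ?p w = z}" using e by auto
  qed
  have inj: "inj_on (slide a b z) (string_exps a b X z)" for z
    by (rule inj_onI) (metis lookup_slide)
  have "sum h (X \<inter> Y) = (\<Sum>z\<in>?p ` Y. sum h {w \<in> X \<inter> Y. ?p w = z})"
    using fin by (intro sum.group[symmetric]) auto
  also have "\<dots> = (\<Sum>z\<in>?p ` Y. \<Sum>e\<in>string_exps a b X z. h (slide a b z e))"
    by (intro sum.cong refl) (subst fib, assumption, simp add: sum.reindex[OF inj])
  finally show ?thesis .
qed

end

text \<open>Remove the maximum, which is at least \<open>card E - 1\<close>. The equality case will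
  show that a compression without loss of weight changes nothing.\<close>

lemma sum_lessThan_card_le:
  fixes E :: "nat set"
  assumes "finite E"
  shows "\<Sum>{..<card E} \<le> \<Sum>E \<and> (\<Sum>{..<card E} = \<Sum>E \<longrightarrow> E = {..<card E})"
  using assms
proof (induction "card E" arbitrary: E)
  case 0
  then show ?case by simp
next
  case (Suc k)
  define M where "M = Max E"
  have ne: "E \<noteq> {}" using Suc by auto
  have M: "M \<in> E" using ne Suc by (auto simp: M_def)
  have k: "k = card (E - {M})" using M Suc by simp
  have IH: "\<Sum>{..<k} \<le> \<Sum>(E - {M})" "\<Sum>{..<k} = \<Sum>(E - {M}) \<Longrightarrow> E - {M} = {..<k}"
    using Suc.hyps(1)[OF k] Suc.prems k by auto
  have "E \<subseteq> {..M}" using Suc.prems by (auto simp: M_def)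
  from card_mono[OF _ this] have kM: "k \<le> M" using Suc.hyps(2) by simp
  have s: "\<Sum>E = M + \<Sum>(E - {M})" using M Suc.prems by (simp add: sum.remove)
  have l: "\<Sum>{..<Suc k} = k + \<Sum>{..<k}" by (simp add: add.commute)
  show ?case unfolding Suc.hyps(2)[symmetric] s l
  proof (intro conjI impI)
    show "k + \<Sum>{..<k} \<le> M + \<Sum>(E - {M})" using IH kM by linarith
    assume "k + \<Sum>{..<k} = M + \<Sum>(E - {M})"
    then have "k = M" "\<Sum>{..<k} = \<Sum>(E - {M})" using IH kM by linarith+
    then have "E = insert k {..<k}" using IH(2) M insert_Diff by metis
    then show "E = {..<Suc k}" by (simp add: lessThan_Suc)
  qed
qed

lemma degp_eq: "X \<subseteq> pps n m \<Longrightarrow> degp X D = X \<inter> {t \<in> pps n m. mdeg t = D}"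
  by (auto simp: degp_def)

lemma finite_degp: "X \<subseteq> pps n m \<Longrightarrow> finite (degp X D)"
  using finite_degree by (auto simp: degp_eq)

context
  fixes a b :: "nat \<times> nat" and n m
  assumes less: "fst b < fst a" and col: "snd a = snd b"
    and a: "a \<in> vars n m" and b: "b \<in> vars n m"
begin

lemma distinct_pair: "a \<noteq> b"
  using less by auto

lemma sum_degp:
  fixes h :: "pp \<Rightarrow> nat"
  assumes "X \<subseteq> pps n m"
  shows "sum h (degp X D) =
    (\<Sum>z\<in>(\<lambda>w. slide a b w 0) ` {t \<in> pps n m. mdeg t = D}.
       \<Sum>e\<in>string_exps a b X z. h (slide a b z e))"
  unfolding degp_eq[OF assms] using distinct_pair col a b
  by (intro sum_strings) (auto simp: finite_degree slide_in_pps mdeg_slide)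

lemma card_degp_compress:
  assumes "X \<subseteq> pps n m"
  shows "card (degp (compress a b X) D) = card (degp X D)"
  using sum_degp[of "compress a b X" "\<lambda>_. 1" D] sum_degp[of X "\<lambda>_. 1" D] assms
    compress_subset_pps[OF distinct_pair assms a b]
  by (simp add: string_exps_compress[OF distinct_pair])

text \<open>Slides keep the degree. This locality allows an ideal and the subideal generated by one
  of its pieces to be compressed in parallel.\<close>

lemma degp_compress_local:
  assumes "degp X D = degp Y D"
  shows "degp (compress a b X) D = degp (compress a b Y) D"
proof -
  have "string_exps a b X w = string_exps a b Y w" if "mdeg w = D" for w
  proof -
    have "slide a b w e \<in> X \<longleftrightarrow> slide a b w e \<in> Y" if "e \<le> lookup w a + lookup w b" for e
      using assms mdeg_slide[OF distinct_pair col that] \<open>mdeg w = D\<close> by (auto simp: degp_def)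
    then show ?thesis by (auto simp: string_exps_def)
  qed
  then show ?thesis by (auto simp: degp_def compress_def)
qed

text \<open>No string gains weight, and a string that loses none was already an initial segment;
  equal totals force this on every string of the degree.\<close>

lemma weight_compress:
  assumes X: "X \<subseteq> pps n m"
  shows "sum weight (degp (compress a b X) D) \<le> sum weight (degp X D)"
    and "sum weight (degp (compress a b X) D) = sum weight (degp X D) \<Longrightarrow>
      degp (compress a b X) D = degp X D"
proof -
  let ?Z = "(\<lambda>w. slide a b w 0) ` {t \<in> pps n m. mdeg t = D}"
  let ?E = "string_exps a b X" and ?E' = "string_exps a b (compress a b X)"
  let ?d = "fst a - fst b"
  have c: "?E' z = {..<card (?E z)}" for z by (rule string_exps_compress[OF distinct_pair])
  have str: "(\<Sum>e\<in>string_exps a b X' z. weight (slide a b z e)) =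
      card (string_exps a b X' z) * weight (slide a b z 0) + ?d * \<Sum>(string_exps a b X' z)" for X' z
  proof -
    have "(\<Sum>e\<in>string_exps a b X' z. weight (slide a b z e)) =
      (\<Sum>e\<in>string_exps a b X' z. weight (slide a b z 0) + ?d * e)"
      using less by (intro sum.cong refl weight_slide[OF distinct_pair]) (auto simp: string_exps_def)
    then show ?thesis by (simp add: sum.distrib sum_distrib_left)
  qed
  have le: "(\<Sum>e\<in>?E' z. weight (slide a b z e)) \<le> (\<Sum>e\<in>?E z. weight (slide a b z e))" for z
    using sum_lessThan_card_le[of "?E z"] str[of z X] str[of z "compress a b X"]
    by (simp add: c)
  have W: "sum weight (degp X D) = (\<Sum>z\<in>?Z. \<Sum>e\<in>?E z. weight (slide a b z e))"
    by (rule sum_degp[OF X])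
  have W': "sum weight (degp (compress a b X) D) = (\<Sum>z\<in>?Z. \<Sum>e\<in>?E' z. weight (slide a b z e))"
    by (rule sum_degp[OF compress_subset_pps[OF distinct_pair X a b]])
  show "sum weight (degp (compress a b X) D) \<le> sum weight (degp X D)"
    unfolding W W' by (intro sum_mono le)
  assume eq: "sum weight (degp (compress a b X) D) = sum weight (degp X D)"
  have fin: "finite ?Z" using finite_degree by auto
  have "(\<Sum>e\<in>?E' z. weight (slide a b z e)) = (\<Sum>e\<in>?E z. weight (slide a b z e))" if z: "z \<in> ?Z" for z
  proof (rule ccontr)
    assume "\<not> ?thesis"
    with le[of z] have "(\<Sum>e\<in>?E' z. weight (slide a b z e)) < (\<Sum>e\<in>?E z. weight (slide a b z e))"
      by simp
    with le z fin have "sum weight (degp (compress a b X) D) < sum weight (degp X D)"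
      unfolding W W' by (intro sum_strict_mono_ex1) auto
    with eq show False by simp
  qed
  then have "?d * \<Sum>{..<card (?E z)} = ?d * \<Sum>(?E z)" if "z \<in> ?Z" for z
    using that str[of z X] str[of z "compress a b X"] by (auto simp: c)
  then have E: "?E z = {..<card (?E z)}" if "z \<in> ?Z" for z
    using that less sum_lessThan_card_le[of "?E z"] by simp
  have "w \<in> compress a b X \<longleftrightarrow> w \<in> X" if w: "w \<in> pps n m" "mdeg w = D" for w
  proof -
    let ?z = "slide a b w 0"
    have "w \<in> compress a b X \<longleftrightarrow> lookup w a \<in> ?E ?z"
      using E[of ?z] w by (auto simp: compress_def string_exps_slide[OF distinct_pair])
    also have "\<dots> \<longleftrightarrow> w \<in> X"
      using distinct_pair by (simp add: string_exps_def slide_slide[OF distinct_pair] slide_self[OF distinct_pair] lookup_slide)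
    finally show ?thesis .
  qed
  then show "degp (compress a b X) D = degp X D"
    using X compress_subset_pps[OF distinct_pair X a b] by (auto simp: degp_def)
qed

text \<open>Strings of a fixed set are initial segments in the exponent of \<open>a\<close>, so
  lowering that exponent by one stays inside.\<close>

lemma compress_fixed_swap:
  assumes "degp (compress a b X) (mdeg (single a 1 + w)) = degp X (mdeg (single a 1 + w))"
    and "single a 1 + w \<in> X"
  shows "single b 1 + w \<in> X"
proof -
  let ?w = "single a 1 + w" and ?w' = "single b 1 + w"
  have deg: "mdeg ?w' = mdeg ?w" using col by (simp add: mdeg_add mdeg_single)
  have "?w \<in> compress a b X" using assms by (auto simp: degp_def)
  moreover have sl: "slide a b ?w (lookup w a) = ?w'"
    using distinct_pair by (intro poly_mapping_eqI)
      (auto simp: lookup_slide lookup_add lookup_single when_def)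
  moreover have "string_exps a b X ?w' = string_exps a b X ?w"
    using string_exps_slide[OF distinct_pair, of "lookup w a" ?w] sl
    by (simp add: lookup_add)
  ultimately have "?w' \<in> compress a b X"
    using distinct_pair by (simp add: compress_def lookup_add lookup_single when_def)
  then show ?thesis using assms(1) deg by (auto simp: degp_def)
qed

end


section \<open>The limit of iterated compressions\<close>

text \<open>The condition \<open>1 \<le> k\<close> keeps the new variable inside the ring, whose
  rows start at 1.\<close>

definition strongly_stable :: "pp set \<Rightarrow> bool" where
  "strongly_stable G \<longleftrightarrow> (\<forall>w i k j. single (i, j) 1 + w \<in> G \<longrightarrow> 1 \<le> k \<longrightarrow> k < i \<longrightarrow> single (k, j) 1 + w \<in> G)"

text \<open>Inadmissible pairs act as the identity, so that every decoded number is a legitimate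
  step.\<close>

definition cstep :: "nat \<Rightarrow> (nat \<Rightarrow> nat) \<Rightarrow> (nat \<times> nat) \<times> (nat \<times> nat) \<Rightarrow> pp set \<Rightarrow> pp set" where
  "cstep n m p X =
    (if fst p \<in> vars n m \<and> snd p \<in> vars n m \<and> snd (fst p) = snd (snd p) \<and> fst (snd p) < fst (fst p)
     then compress (fst p) (snd p) X else X)"

text \<open>The decoding visits every pair of variables infinitely often.\<close>

primrec stage :: "nat \<Rightarrow> (nat \<Rightarrow> nat) \<Rightarrow> pp set \<Rightarrow> nat \<Rightarrow> pp set" where
  "stage n m X 0 = X"
| "stage n m X (Suc t) = cstep n m (from_nat (fst (prod_decode t))) (stage n m X t)"

text \<open>In each degree this agrees with all late stages, although no single stage has to equal
  it.\<close>

definition climit :: "nat \<Rightarrow> (nat \<Rightarrow> nat) \<Rightarrow> pp set \<Rightarrow> pp set" where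
  "climit n m X = {w. \<exists>t0. \<forall>t\<ge>t0. w \<in> stage n m X t}"

lemma mon_ideal_subset: "mon_ideal n m X \<Longrightarrow> X \<subseteq> pps n m"
  by (simp add: mon_ideal_def)

lemma mon_ideal_add: "mon_ideal n m X \<Longrightarrow> w \<in> X \<Longrightarrow> t \<in> pps n m \<Longrightarrow> w + t \<in> X"
  by (simp add: mon_ideal_def)

lemma cstep_props:
  assumes "mon_ideal n m X"
  shows "mon_ideal n m (cstep n m p X)"
    and "card (degp (cstep n m p X) D) = card (degp X D)"
    and "sum weight (degp (cstep n m p X) D) \<le> sum weight (degp X D)"
    and "sum weight (degp (cstep n m p X) D) = sum weight (degp X D) \<Longrightarrow>
      degp (cstep n m p X) D = degp X D"
proof -
  have ne: "fst p \<noteq> snd p" if "fst (snd p) < fst (fst p)" using that by auto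
  show "mon_ideal n m (cstep n m p X)"
    using assms ne by (auto simp: cstep_def intro: compress_mon_ideal)
  show "card (degp (cstep n m p X) D) = card (degp X D)"
    using card_degp_compress[of "snd p" "fst p" n m X D] mon_ideal_subset[OF assms] by (simp add: cstep_def)
  show "sum weight (degp (cstep n m p X) D) \<le> sum weight (degp X D)"
    using weight_compress(1)[of "snd p" "fst p" n m X D] mon_ideal_subset[OF assms] by (simp add: cstep_def)
  show "degp (cstep n m p X) D = degp X D"
    if "sum weight (degp (cstep n m p X) D) = sum weight (degp X D)"
    using that weight_compress(2)[of "snd p" "fst p" n m X D] mon_ideal_subset[OF assms]
    unfolding cstep_def by (cases "fst p \<in> vars n m \<and> snd p \<in> vars n m \<and> snd (fst p) = snd (snd p) \<and>
      fst (snd p) < fst (fst p)") auto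
qed

lemma stage_mon_ideal: "mon_ideal n m X \<Longrightarrow> mon_ideal n m (stage n m X t)"
  by (induction t) (auto intro: cstep_props)

lemma card_stage: "mon_ideal n m X \<Longrightarrow> card (degp (stage n m X t) D) = card (degp X D)"
  by (induction t) (simp_all add: cstep_props(2)[OF stage_mon_ideal])

lemma stage_local:
  assumes "degp X D = degp Y D"
  shows "degp (stage n m X t) D = degp (stage n m Y t) D"
proof (induction t)
  case (Suc t)
  have "degp (cstep n m p X') D = degp (cstep n m p Y') D" if "degp X' D = degp Y' D" for p X' Y'
    using that degp_compress_local[of "snd p" "fst p" n m X' D Y'] by (simp add: cstep_def)
  from this[OF Suc] show ?case by simp
qed (use assms in simp)

text \<open>The total weight of a degree piece is a natural number that never increases; once it has
  reached its minimum, no step alters the piece.\<close>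

lemma stage_eventually_const:
  assumes "mon_ideal n m X"
  shows "\<exists>t0. \<forall>t\<ge>t0. degp (stage n m X t) D = degp (stage n m X t0) D"
proof -
  let ?f = "\<lambda>t. sum weight (degp (stage n m X t) D)"
  obtain t0 where t0: "\<And>t. ?f t0 \<le> ?f t"
    using ex_has_least_nat[of "\<lambda>_. True" 0 ?f] by auto
  have "degp (stage n m X t) D = degp (stage n m X t0) D" if "t \<ge> t0" for t
    using that
  proof (induction t rule: dec_induct)
    case (step t)
    have "?f (Suc t) \<le> ?f t"
      using cstep_props(3)[OF stage_mon_ideal[OF assms]] by simp
    moreover have "?f t = ?f t0" using step by simp
    ultimately have "?f (Suc t) = ?f t" using t0[of "Suc t"] by simp
    then have "degp (stage n m X (Suc t)) D = degp (stage n m X t) D"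
      using cstep_props(4)[OF stage_mon_ideal[OF assms]] by simp
    then show ?case using step by simp
  qed simp
  then show ?thesis by blast
qed

lemma degp_climit:
  assumes "mon_ideal n m X"
  shows "\<exists>t0. \<forall>t\<ge>t0. degp (stage n m X t) D = degp (climit n m X) D"
proof -
  obtain t0 where t0: "\<And>t. t \<ge> t0 \<Longrightarrow> degp (stage n m X t) D = degp (stage n m X t0) D"
    using stage_eventually_const[OF assms] by blast
  have "w \<in> climit n m X \<longleftrightarrow> w \<in> stage n m X t" if "mdeg w = D" "t \<ge> t0" for w t
  proof
    assume "w \<in> climit n m X"
    then obtain t1 where t1: "\<And>t. t \<ge> t1 \<Longrightarrow> w \<in> stage n m X t" by (auto simp: climit_def)
    have "w \<in> degp (stage n m X (max t0 t1)) D" using t1 that by (simp add: degp_def)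
    then show "w \<in> stage n m X t" using t0[of t] t0[of "max t0 t1"] that by (auto simp: degp_def)
  next
    assume "w \<in> stage n m X t"
    then have "w \<in> degp (stage n m X t0) D" using t0[of t] that by (auto simp: degp_def)
    then show "w \<in> climit n m X" using t0 by (auto simp: climit_def degp_def intro!: exI[of _ t0])
  qed
  then show ?thesis by (intro exI[of _ t0]) (auto simp: degp_def)
qed

lemma climit_mon_ideal:
  assumes "mon_ideal n m X"
  shows "mon_ideal n m (climit n m X)"
  using stage_mon_ideal[OF assms] unfolding mon_ideal_def climit_def by blast

lemma card_climit:
  assumes "mon_ideal n m X"
  shows "card (degp (climit n m X) D) = card (degp X D)"
  using degp_climit[OF assms, of D] card_stage[OF assms] by (metis le_refl)

lemma climit_strongly_stable:
  assumes X: "mon_ideal n m X"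
  shows "strongly_stable (climit n m X)"
  unfolding strongly_stable_def
proof (intro allI impI)
  fix w :: pp and i k j :: nat
  let ?x = "single (i, j) 1 + w"
  assume x: "?x \<in> climit n m X" and k: "1 \<le> k" "k < i"
  define p where "p = ((i, j), (k, j))"
  obtain t0 where t0: "\<And>t. t \<ge> t0 \<Longrightarrow> degp (stage n m X t) (mdeg ?x) = degp (climit n m X) (mdeg ?x)"
    using degp_climit[OF X] by blast
  \<comment> \<open>A visit to the pair \<open>p\<close> after the degree of \<open>?x\<close> has
    settled: \<open>prod_encode\<close> is at least its second argument.\<close>
  define t where "t = prod_encode (to_nat p, t0)"
  have t: "t \<ge> t0" by (simp add: t_def le_prod_encode_2)
  have v: "(i, j) \<in> vars n m" "(k, j) \<in> vars n m"
    using x k mon_ideal_subset[OF climit_mon_ideal[OF X]]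
    by (auto simp: in_pps_iff keys_add_pp vars_def)
  have st: "stage n m X (Suc t) = compress (i, j) (k, j) (stage n m X t)"
    using v k by (simp add: t_def cstep_def p_def)
  have "?x \<in> stage n m X t" using x t0[OF t] by (auto simp: degp_def)
  moreover have "degp (stage n m X (Suc t)) (mdeg ?x) = degp (stage n m X t) (mdeg ?x)"
    using t0[of t] t0[of "Suc t"] t by simp
  ultimately have "single (k, j) 1 + w \<in> stage n m X t"
    unfolding st by (intro compress_fixed_swap[where n = n and m = m, OF _ _ v]) (use k in simp_all)
  moreover have "mdeg (single (k, j) 1 + w) = mdeg ?x" by (simp add: mdeg_add mdeg_single)
  ultimately show "single (k, j) 1 + w \<in> climit n m X"
    using t0[OF t] by (auto simp: degp_def)
qed

section \<open>Generation in squarefree multidegrees, pulled back from the limit\<close>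

definition sqdeg :: "nat set \<Rightarrow> multideg" where
  "sqdeg A = (\<Sum>j\<in>A. single j 1)"

text \<open>For monomial ideals this says that all minimal generators have degree at most (1,...,1):
  a divisor of squarefree degree can be multiplied by one variable of \<open>w\<close> from each
  missing column until its column support is that of \<open>w\<close>.\<close>

definition multilinear_generated :: "pp set \<Rightarrow> bool" where
  "multilinear_generated M \<longleftrightarrow>
    (\<forall>w\<in>M. \<exists>t\<in>M. \<exists>z. w = t + z \<and> mdeg t = sqdeg (keys (mdeg w)))"

definition pp_gen :: "nat \<Rightarrow> (nat \<Rightarrow> nat) \<Rightarrow> pp set \<Rightarrow> pp set" where
  "pp_gen n m T = {t + z |t z. t \<in> T \<and> z \<in> pps n m}"

lemma pp_gen_mon_ideal:
  assumes "T \<subseteq> pps n m"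
  shows "mon_ideal n m (pp_gen n m T)"
  unfolding mon_ideal_def
proof (intro conjI ballI)
  show "pp_gen n m T \<subseteq> pps n m" using assms by (auto simp: pp_gen_def plus_in_pps)
next
  fix w y assume "w \<in> pp_gen n m T" and y: "y \<in> pps n m"
  then obtain t z where t: "w = t + z" "t \<in> T" "z \<in> pps n m" by (auto simp: pp_gen_def)
  then have "w + y = t + (z + y)" "z + y \<in> pps n m" using y by (simp_all add: add.assoc plus_in_pps)
  with t(2) show "w + y \<in> pp_gen n m T" unfolding pp_gen_def by blast
qed

lemma pp_gen_superset: "T \<subseteq> pp_gen n m T"
proof
  fix t assume "t \<in> T"
  then have "t = t + 0 \<and> t \<in> T \<and> 0 \<in> pps n m" by simp
  then show "t \<in> pp_gen n m T" unfolding pp_gen_def by blast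
qed

lemma pp_gen_least: "mon_ideal n m M \<Longrightarrow> T \<subseteq> M \<Longrightarrow> pp_gen n m T \<subseteq> M"
  by (auto simp: pp_gen_def mon_ideal_def)

text \<open>The ideal \<open>?N\<close> generated by the piece of \<open>M\<close> in degree
  \<open>?S\<close> shares this piece with \<open>M\<close>, hence by locality also at every stage.
  The hypothesis fills the limit in degree \<open>?D\<close> with multiples of the piece in degree
  \<open>?S\<close>, so a late stage of \<open>?N\<close> is at least as large there as
  \<open>M\<close>. Compressions keep cardinalities, and \<open>?N\<close> and \<open>M\<close>
  agree in degree \<open>?D\<close>.\<close>

lemma multilinear_generated_climit:
  assumes M: "mon_ideal n m M" and lim: "multilinear_generated (climit n m M)"
  shows "multilinear_generated M"
  unfolding multilinear_generated_def
proof
  fix w assume w: "w \<in> M"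
  let ?D = "mdeg w" and ?S = "sqdeg (keys (mdeg w))"
  let ?N = "pp_gen n m (degp M ?S)"
  have NM: "?N \<subseteq> M" by (rule pp_gen_least[OF M]) (auto simp: degp_def)
  have N: "mon_ideal n m ?N"
    by (rule pp_gen_mon_ideal) (use mon_ideal_subset[OF M] in \<open>auto simp: degp_def\<close>)
  have "degp ?N ?S = degp M ?S"
    using NM pp_gen_superset[of "degp M ?S" n m] by (auto simp: degp_def)
  then have S: "degp (stage n m ?N t) ?S = degp (stage n m M t) ?S" for t by (rule stage_local)
  obtain t1 where t1: "\<And>t. t \<ge> t1 \<Longrightarrow> degp (stage n m M t) ?D = degp (climit n m M) ?D"
    using degp_climit[OF M] by blast
  obtain t2 where t2: "\<And>t. t \<ge> t2 \<Longrightarrow> degp (stage n m M t) ?S = degp (climit n m M) ?S"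
    using degp_climit[OF M] by blast
  define t where "t = max t1 t2"
  have sub: "degp (climit n m M) ?D \<subseteq> degp (stage n m ?N t) ?D"
  proof
    fix x assume x: "x \<in> degp (climit n m M) ?D"
    then obtain y z where y: "y \<in> climit n m M" "x = y + z" "mdeg y = ?S"
      using lim unfolding multilinear_generated_def by (fastforce simp: degp_def)
    then have "y \<in> stage n m ?N t" using S t2[of t] by (auto simp: degp_def t_def)
    moreover have "z \<in> pps n m"
      using x y mon_ideal_subset[OF climit_mon_ideal[OF M]] by (auto simp: degp_def add_in_pps_iff)
    ultimately have "x \<in> stage n m ?N t"
      using y mon_ideal_add[OF stage_mon_ideal[OF N]] by simp
    then show "x \<in> degp (stage n m ?N t) ?D" using x by (simp add: degp_def)
  qed
  have "card (degp M ?D) \<le> card (degp ?N ?D)"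
    using card_mono[OF finite_degp[OF mon_ideal_subset[OF stage_mon_ideal[OF N]]] sub]
    by (simp add: card_climit[OF M] card_stage[OF N])
  then have "degp ?N ?D = degp M ?D"
    using NM by (intro card_seteq finite_degp[OF mon_ideal_subset[OF M]]) (auto simp: degp_def)
  then have "w \<in> ?N" using w by (auto simp: degp_def)
  then show "\<exists>t\<in>M. \<exists>z. w = t + z \<and> mdeg t = ?S"
    by (auto simp: pp_gen_def degp_def)
qed


section \<open>Dickson's lemma\<close>

lemma nat_mono_subseq:
  fixes f :: "nat \<Rightarrow> nat"
  shows "\<exists>r::nat \<Rightarrow> nat. strict_mono r \<and> mono (\<lambda>i. f (r i))"
proof -
  obtain r where r: "strict_mono r" "monoseq (\<lambda>i. f (r i))"
    using seq_monosub[of f] by blast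
  show ?thesis
  proof (cases "incseq (\<lambda>i. f (r i))")
    case False
    with r have dec: "decseq (\<lambda>i. f (r i))" by (auto simp: monoseq_iff)
    \<comment> \<open>A decreasing sequence of naturals is constant once its minimum is
      attained.\<close>
    obtain k where k: "\<And>i. f (r k) \<le> f (r i)"
      using ex_has_least_nat[of "\<lambda>_. True" 0 "\<lambda>i. f (r i)"] by auto
    have "f (r (i + k)) = f (r k)" for i
      using decseqD[OF dec, of k "i + k"] k[of "i + k"] by simp
    moreover have "strict_mono (\<lambda>i. r (i + k))" using r by (auto simp: strict_mono_def)
    ultimately show ?thesis by (intro exI[of _ "\<lambda>i. r (i + k)"]) (auto simp: mono_def)
  qed (use r in auto)
qed

lemma mono_subseq_on:
  fixes f :: "nat \<Rightarrow> 'v \<Rightarrow> nat"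
  assumes "finite V"
  shows "\<exists>r::nat \<Rightarrow> nat. strict_mono r \<and> (\<forall>v\<in>V. mono (\<lambda>i. f (r i) v))"
  using assms
proof (induction V)
  case empty
  show ?case by (intro exI[of _ id]) (auto simp: strict_mono_def)
next
  case (insert v V)
  then obtain r :: "nat \<Rightarrow> nat" where r: "strict_mono r" "\<And>v. v \<in> V \<Longrightarrow> mono (\<lambda>i. f (r i) v)" by blast
  obtain s :: "nat \<Rightarrow> nat" where s: "strict_mono s" "mono (\<lambda>i. f (r (s i)) v)"
    using nat_mono_subseq[of "\<lambda>i. f (r i) v"] by auto
  have "mono (\<lambda>i. f (r (s i)) v')" if "v' \<in> V" for v'
    using r(2)[OF that] s(1) by (auto simp: mono_def strict_mono_less_eq)
  with s r(1) show ?case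
    using strict_mono_o[OF r(1) s(1)] by (intro exI[of _ "r \<circ> s"]) (simp add: comp_def)
qed

lemma weight_pos:
  assumes "t \<in> pps n m" "t \<noteq> 0"
  shows "0 < weight t"
proof -
  from assms obtain v where v: "v \<in> keys t" by (metis all_not_in_conv keys_eq_empty)
  then obtain t' where "t = single v 1 + t'"
    using pp_split[of t v] by (auto simp: in_keys_iff)
  then show ?thesis using v assms by (auto simp: weight_add weight_single vars_def in_pps_iff)
qed

text \<open>The elements minimal under divisibility form an antichain, but an infinite set of power
  products contains a sequence that increases in every exponent.\<close>

lemma dickson:
  assumes X: "X \<subseteq> pps n m"
  shows "\<exists>Y\<subseteq>X. finite Y \<and> (\<forall>x\<in>X. \<exists>y\<in>Y. \<exists>z. x = y + z)"
proof -
  define Y where "Y = {y \<in> X. \<forall>x\<in>X. (\<exists>z. y = x + z) \<longrightarrow> x = y}"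
  have "finite Y"
  proof (rule ccontr)
    assume "infinite Y"
    then obtain f :: "nat \<Rightarrow> pp" where f: "inj f" "range f \<subseteq> Y"
      using infinite_countable_subset by blast
    obtain r :: "nat \<Rightarrow> nat" where r: "strict_mono r" "\<And>v. v \<in> vars n m \<Longrightarrow> mono (\<lambda>i. lookup (f (r i)) v)"
      using mono_subseq_on[OF finite_vars, where f = "\<lambda>i. lookup (f i)"] by blast
    have mem: "f i \<in> Y" for i using f by auto
    have "lookup (f (r 0)) v \<le> lookup (f (r 1)) v" for v
    proof (cases "v \<in> vars n m")
      case True
      then show ?thesis using r(2) by (simp add: mono_def)
    next
      case False
      moreover have "f (r 0) \<in> pps n m" using mem[of "r 0"] X by (auto simp: Y_def)
      ultimately have "v \<notin> keys (f (r 0))" by (auto simp: in_pps_iff)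
      then show ?thesis by (simp add: in_keys_iff)
    qed
    then have "f (r 0) = f (r 1)"
      using pp_splitI[of "f (r 0)" "f (r 1)"] mem[of "r 0"] mem[of "r 1"] by (auto simp: Y_def)
    then show False using f(1) r(1) by (metis injD strict_mono_eq zero_neq_one)
  qed
  moreover have "\<exists>y\<in>Y. \<exists>z. x = y + z" if "x \<in> X" for x
    using that
  proof (induction "weight x" arbitrary: x rule: less_induct)
    case less
    show ?case
    proof (cases "x \<in> Y")
      case True
      then show ?thesis by (intro bexI[of _ x] exI[of _ 0]) auto
    next
      case False
      then obtain y z where y: "y \<in> X" "x = y + z" "y \<noteq> x" using less.prems by (auto simp: Y_def)
      then have "z \<noteq> 0" "z \<in> pps n m" using less.prems X by (auto simp: add_in_pps_iff)
      then have "weight y < weight x" using y weight_pos by (auto simp: weight_add)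
      from less.hyps[OF this y(1)] obtain y' z' where "y' \<in> Y" "y = y' + z'" by blast
      then show ?thesis using y by (auto simp: add.assoc)
    qed
  qed
  ultimately show ?thesis by (intro exI[of _ Y]) (auto simp: Y_def)
qed


section \<open>Strongly stable ideals are determined by their Hilbert function\<close>

text \<open>In degrees beyond those of the generators, the last variable occurring in a column can
  be cancelled. Write \<open>x_{ij} w = y z\<close> with a generator \<open>y\<close>: the degree
  forces a variable of column \<open>j\<close> into \<open>z\<close>, and strong stability trades it
  against \<open>x_{ij}\<close> in \<open>y\<close>.\<close>

lemma strongly_stable_saturated:
  assumes G: "mon_ideal n m G" and st: "strongly_stable G"
  shows "\<exists>N. \<forall>i j w. single (i, j) 1 + w \<in> G \<longrightarrow> (\<forall>v\<in>keys w. snd v = j \<longrightarrow> fst v \<le> i) \<longrightarrow>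
    N \<le> lookup (mdeg w) j \<longrightarrow> w \<in> G"
proof -
  obtain Y where Y: "Y \<subseteq> G" "finite Y" "\<And>x. x \<in> G \<Longrightarrow> \<exists>y\<in>Y. \<exists>z. x = y + z"
    using dickson[OF mon_ideal_subset[OF G]] by blast
  \<comment> \<open>A crude common bound for the column degrees of all generators.\<close>
  define N where "N = (\<Sum>y\<in>Y. \<Sum>j\<in>keys (mdeg y). lookup (mdeg y) j)"
  have N: "lookup (mdeg y) j \<le> N" if "y \<in> Y" for y j
  proof -
    have "lookup (mdeg y) j \<le> (\<Sum>j\<in>keys (mdeg y). lookup (mdeg y) j)"
      by (cases "j \<in> keys (mdeg y)") (auto simp: in_keys_iff intro!: member_le_sum)
    also have "\<dots> \<le> N" unfolding N_def
      using that Y(2) by (intro member_le_sum[of y Y "\<lambda>y. \<Sum>j\<in>keys (mdeg y). lookup (mdeg y) j"]) auto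
    finally show ?thesis .
  qed
  have "w \<in> G" if x: "single (i, j) 1 + w \<in> G"
    and below: "\<And>v. v \<in> keys w \<Longrightarrow> snd v = j \<Longrightarrow> fst v \<le> i"
    and deg: "N \<le> lookup (mdeg w) j" for i j w
  proof -
    from Y(3)[OF x] obtain y z where yz: "y \<in> Y" "single (i, j) 1 + w = y + z" by blast
    then have yG: "y \<in> G" using Y by auto
    have zp: "z \<in> pps n m" using x yz mon_ideal_subset[OF G] by (auto simp: add_in_pps_iff)
    have "lookup (mdeg y) j + lookup (mdeg z) j = 1 + lookup (mdeg w) j"
      using arg_cong[OF yz(2), of "\<lambda>x. lookup (mdeg x) j"]
      by (simp add: mdeg_add mdeg_single lookup_add)
    with N[OF yz(1), of j] deg have "j \<in> keys (mdeg z)" by (simp add: in_keys_iff)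
    then obtain i' where i': "(i', j) \<in> keys z" by (auto simp: keys_mdeg)
    then have "(i', j) \<in> keys (single (i, j) 1 + w)" using yz(2) by (simp add: keys_add_pp)
    then have "i' \<le> i" using below by (auto simp: keys_add_pp)
    show "w \<in> G"
    proof (cases "lookup z (i, j) = 0")
      case False
      then obtain z' where z': "z = single (i, j) 1 + z'" using pp_split[of z "(i, j)"] by auto
      then have "single (i, j) 1 + w = single (i, j) 1 + (y + z')" using yz(2) by (simp add: ac_simps)
      then have "w = y + z'" by (simp only: add_left_cancel)
      then show ?thesis using z' zp yG G by (auto simp: add_in_pps_iff intro: mon_ideal_add)
    next
      case True
      \<comment> \<open>Now \<open>x_{ij}\<close> divides \<open>y\<close> and the smaller-row
        variable \<open>x_{i'j}\<close> divides \<open>z\<close>. Replacing the former by the latter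
        inside \<open>y\<close> and removing the latter from \<open>z\<close> leaves exactly
        \<open>w\<close>.\<close>
      have lt: "i' < i" using \<open>i' \<le> i\<close> i' True by (cases "i' = i") (auto simp: in_keys_iff)
      have "lookup y (i, j) + lookup z (i, j) = Suc (lookup w (i, j))"
        using arg_cong[OF yz(2), of "\<lambda>x. lookup x (i, j)"] by (simp add: lookup_add)
      then have "lookup y (i, j) > 0" using True by simp
      then obtain y' where y': "y = single (i, j) 1 + y'" using pp_split[of y "(i, j)"] by auto
      obtain z' where z': "z = single (i', j) 1 + z'"
        using i' pp_split[of z "(i', j)"] by (auto simp: in_keys_iff)
      have "1 \<le> i'" using i' zp by (auto simp: in_pps_iff vars_def)
      then have "single (i', j) 1 + y' \<in> G" using st lt yG y' by (simp add: strongly_stable_def)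
      moreover have "z' \<in> pps n m" using zp z' by (simp add: add_in_pps_iff)
      ultimately have "(single (i', j) 1 + y') + z' \<in> G" using G mon_ideal_add by blast
      moreover have "single (i, j) 1 + w = single (i, j) 1 + ((single (i', j) 1 + y') + z')"
        using yz(2) by (simp add: y' z' ac_simps)
      then have "w = (single (i', j) 1 + y') + z'" by (simp only: add_left_cancel)
      ultimately show ?thesis by simp
    qed
  qed
  then show ?thesis by blast
qed

section \<open>Counting the members in the first variables of each column\<close>

definition below :: "(nat \<Rightarrow> nat) \<Rightarrow> pp set" where
  "below u = {w. \<forall>v\<in>keys w. fst v \<le> u (snd v)}"

lemma card_below_step:
  assumes G: "mon_ideal n m G"
    and sat: "\<forall>w. single (u j, j) 1 + w \<in> G \<longrightarrow> (\<forall>v\<in>keys w. snd v = j \<longrightarrow> fst v \<le> u j) \<longrightarrow>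
      N \<le> lookup (mdeg w) j \<longrightarrow> w \<in> G"
    and D: "N \<le> lookup D j" and v: "(u j, j) \<in> vars n m"
  shows "card (degp (G \<inter> below u) (D + single j 1)) =
    card (degp (G \<inter> below (u(j := u j - 1))) (D + single j 1)) + card (degp (G \<inter> below u) D)"
proof -
  let ?x = "single (u j, j) (1::nat)"
  let ?A = "degp (G \<inter> below (u(j := u j - 1))) (D + single j 1)"
  let ?B = "(+) ?x ` degp (G \<inter> below u) D"
  have uj: "1 \<le> u j" using v by (simp add: vars_def)
  have fin: "finite (degp (G \<inter> below u') D')" for u' D'
    using finite_degp[of "G \<inter> below u'" n m D'] mon_ideal_subset[OF G] by auto
  have "degp (G \<inter> below u) (D + single j 1) = ?A \<union> ?B"
  proof (intro equalityI subsetI)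
    fix w assume w: "w \<in> degp (G \<inter> below u) (D + single j 1)"
    show "w \<in> ?A \<union> ?B"
    proof (cases "(u j, j) \<in> keys w")
      case True
      then obtain w' where w': "w = ?x + w'" using pp_split[of w "(u j, j)"] by (auto simp: in_keys_iff)
      then have "mdeg w' + single j 1 = D + single j 1"
        using w by (simp add: degp_def mdeg_add mdeg_single add.commute)
      then have d: "mdeg w' = D" by (simp only: add_right_cancel)
      have b: "w' \<in> below u" using w w' by (auto simp: degp_def below_def keys_add_pp)
      have "?x + w' \<in> G" using w w' by (simp add: degp_def)
      moreover have "N \<le> lookup (mdeg w') j" using D d by simp
      moreover have "\<forall>v\<in>keys w'. snd v = j \<longrightarrow> fst v \<le> u j" using b by (auto simp: below_def)
      ultimately have "w' \<in> G" using sat by blast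
      then show ?thesis using w' d b by (auto simp: degp_def)
    next
      case False
      have "fst v \<le> (u(j := u j - 1)) (snd v)" if "v \<in> keys w" for v
      proof (cases "snd v = j")
        case True
        then have "fst v \<noteq> u j" using that False by (cases v) auto
        moreover have "fst v \<le> u j" using w that True by (auto simp: degp_def below_def)
        ultimately show ?thesis using True by simp
      qed (use w that in \<open>auto simp: degp_def below_def\<close>)
      then show ?thesis using w by (auto simp: degp_def below_def)
    qed
  next
    fix w assume "w \<in> ?A \<union> ?B"
    then show "w \<in> degp (G \<inter> below u) (D + single j 1)"
    proof
      assume w: "w \<in> ?A"
      have "fst v \<le> u (snd v)" if "v \<in> keys w" for v
        using w that uj by (fastforce simp: degp_def below_def split: if_splits)
      then show ?thesis using w by (auto simp: degp_def below_def)
    next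
      assume "w \<in> ?B"
      then obtain w' where w': "w' \<in> degp (G \<inter> below u) D" "w = ?x + w'" by auto
      then have "w' + ?x \<in> G" using G v by (intro mon_ideal_add) (auto simp: degp_def single_in_pps)
      then show ?thesis using w'
        by (auto simp: degp_def below_def keys_add_pp mdeg_add mdeg_single add.commute)
    qed
  qed
  moreover have "?A \<inter> ?B = {}"
    using uj by (auto simp: degp_def below_def keys_add_pp)
  ultimately show ?thesis
    using fin by (simp add: card_Un_disjoint card_image)
qed

text \<open>The induction descends from \<open>u = m\<close>, where the counts are the Hilbert
  function: the recursion for a larger bound is solved for the smaller one. Outside \<open>C\<close>
  the bound is never lowered, since the degree need not be large there.\<close>

lemma card_below_eq:
  assumes G: "mon_ideal n m G" "strongly_stable G" and H: "mon_ideal n m H" "strongly_stable H"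
    and eq: "\<And>D. card (degp G D) = card (degp H D)"
    and C: "C \<subseteq> {1..n}" and u: "\<And>j. u j \<le> m j" "\<And>j. j \<notin> C \<Longrightarrow> u j = m j"
  shows "\<exists>N. \<forall>D. (\<forall>j\<in>C. N \<le> lookup D j) \<longrightarrow>
    card (degp (G \<inter> below u) D) = card (degp (H \<inter> below u) D)"
  using u
proof (induction "\<Sum>j\<in>C. m j - u j" arbitrary: u)
  case 0
  have fin: "finite C" using C finite_subset by blast
  have "u j = m j" for j
    using 0 fin by (cases "j \<in> C") (auto simp: le_antisym)
  then have "u = m" by auto
  moreover have "X \<inter> below m = X" if "mon_ideal n m X" for X
    using mon_ideal_subset[OF that] unfolding below_def pps_def vars_def by fastforce
  ultimately show ?case using G H eq by simp
next
  case (Suc k)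
  have fin: "finite C" using C finite_subset by blast
  have "\<exists>j\<in>C. m j - u j \<noteq> 0"
  proof (rule ccontr)
    assume "\<not> ?thesis"
    then have "(\<Sum>j\<in>C. m j - u j) = 0" by (intro sum.neutral) auto
    then show False using Suc.hyps(2) by simp
  qed
  then obtain j where j: "j \<in> C" "u j < m j" by auto
  define u' where "u' = u(j := Suc (u j))"
  have uu': "u'(j := u' j - Suc 0) = u" by (auto simp: u'_def)
  have "(\<Sum>j\<in>C. m j - u j) = Suc (\<Sum>j\<in>C. m j - u' j)"
    using j fin by (simp add: sum.remove[of C j] u'_def)
  then have "k = (\<Sum>j\<in>C. m j - u' j)" using Suc.hyps(2) by simp
  moreover have "u' j' \<le> m j'" for j' using j Suc.prems by (simp add: u'_def)
  moreover have "u' j' = m j'" if "j' \<notin> C" for j' using that j Suc.prems by (auto simp: u'_def)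
  ultimately obtain N where N: "\<And>D. (\<And>j. j \<in> C \<Longrightarrow> N \<le> lookup D j) \<Longrightarrow>
      card (degp (G \<inter> below u') D) = card (degp (H \<inter> below u') D)"
    using Suc.hyps(1)[of u'] by blast
  obtain N1 where N1: "\<forall>i j w. single (i, j) 1 + w \<in> G \<longrightarrow> (\<forall>v\<in>keys w. snd v = j \<longrightarrow> fst v \<le> i) \<longrightarrow>
    N1 \<le> lookup (mdeg w) j \<longrightarrow> w \<in> G" using strongly_stable_saturated[OF G] by blast
  obtain N2 where N2: "\<forall>i j w. single (i, j) 1 + w \<in> H \<longrightarrow> (\<forall>v\<in>keys w. snd v = j \<longrightarrow> fst v \<le> i) \<longrightarrow>
    N2 \<le> lookup (mdeg w) j \<longrightarrow> w \<in> H" using strongly_stable_saturated[OF H] by blast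
  have v: "(u' j, j) \<in> vars n m" using j C by (auto simp: u'_def vars_def)
  \<comment> \<open>One more than the three thresholds, because the recursion is applied in degree
    \<open>D'\<close>, which is one lower in column \<open>j\<close>.\<close>
  define N' where "N' = Suc (max N (max N1 N2))"
  have "card (degp (G \<inter> below u) D) = card (degp (H \<inter> below u) D)"
    if D: "\<And>j. j \<in> C \<Longrightarrow> N' \<le> lookup D j" for D
  proof -
    have "lookup D j > 0" using D[OF j(1)] by (simp add: N'_def)
    then obtain D' where D': "D = single j 1 + D'" using pp_split[of D j] by auto
    have ge: "max N (max N1 N2) \<le> lookup D' j'" if "j' \<in> C" for j'
      using D[OF that] by (auto simp: D' N'_def lookup_add lookup_single when_def split: if_splits)
    have "card (degp (G \<inter> below u') (D' + single j 1)) =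
      card (degp (G \<inter> below u) (D' + single j 1)) + card (degp (G \<inter> below u') D')"
      using card_below_step[where G = G and u = u' and j = j and D = D' and N = N1, OF G(1) _ _ v]
        ge[OF j(1)] spec[OF spec[OF N1, of "u' j"], of j] by (simp add: uu')
    moreover have "card (degp (H \<inter> below u') (D' + single j 1)) =
      card (degp (H \<inter> below u) (D' + single j 1)) + card (degp (H \<inter> below u') D')"
      using card_below_step[where G = H and u = u' and j = j and D = D' and N = N2, OF H(1) _ _ v]
        ge[OF j(1)] spec[OF spec[OF N2, of "u' j"], of j] by (simp add: uu')
    moreover have "card (degp (G \<inter> below u') D') = card (degp (H \<inter> below u') D')"
      using ge by (intro N) auto
    moreover have "card (degp (G \<inter> below u') (D' + single j 1)) = card (degp (H \<inter> below u') (D' + single j 1))"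
      using ge by (intro N) (auto simp: lookup_add trans_le_add1)
    ultimately show ?thesis by (simp add: D' add.commute)
  qed
  then show ?case by blast
qed

text \<open>Variables are exchanged one at a time; \<open>y\<close> collects those that have already
  been exchanged.\<close>

lemma strongly_stable_lower:
  assumes st: "strongly_stable G" and z: "z \<in> pps n m"
    and deg: "mdeg z = mdeg w" and w: "w + y \<in> G"
    and le: "\<And>i i' j. (i, j) \<in> keys z \<Longrightarrow> (i', j) \<in> keys w \<Longrightarrow> i \<le> i'"
  shows "z + y \<in> G"
  using z deg w le
proof (induction "weight z" arbitrary: z w y rule: less_induct)
  case less
  show ?case
  proof (cases "z = 0")
    case True
    then have "keys (mdeg w) = {}" using less.prems(2) by simp
    then have "w = 0" unfolding keys_mdeg by simp
    then show ?thesis using True less.prems(3) by simp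
  next
    case False
    then obtain i j where ij: "(i, j) \<in> keys z" by (metis all_not_in_conv keys_eq_empty surj_pair)
    then obtain z' where z': "z = single (i, j) 1 + z'"
      using pp_split[of z "(i, j)"] by (auto simp: in_keys_iff)
    have "j \<in> keys (mdeg w)" using ij unfolding less.prems(2)[symmetric] keys_mdeg by force
    then obtain i' where i': "(i', j) \<in> keys w" by (auto simp: keys_mdeg)
    then obtain w' where w': "w = single (i', j) 1 + w'"
      using pp_split[of w "(i', j)"] by (auto simp: in_keys_iff)
    have "i \<le> i'" using less.prems(4) ij i' by blast
    have i1: "1 \<le> i" using less.prems(1) ij by (auto simp: in_pps_iff vars_def)
    have "single (i', j) 1 + (w' + y) \<in> G" using less.prems(3) w' by (simp add: add.assoc)
    then have "single (i, j) 1 + (w' + y) \<in> G"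
      using st \<open>i \<le> i'\<close> i1 by (cases "i = i'") (auto simp: strongly_stable_def)
    then have "w' + (single (i, j) 1 + y) \<in> G" by (simp add: ac_simps)
    moreover have "weight z' < weight z" using i1 by (simp add: z' weight_add weight_single)
    moreover have "z' \<in> pps n m" using less.prems(1) z' by (simp add: add_in_pps_iff)
    moreover have "mdeg z' = mdeg w'" using less.prems(2) by (simp add: z' w' mdeg_add mdeg_single)
    moreover have "a \<le> a'" if "(a, b) \<in> keys z'" "(a', b) \<in> keys w'" for a a' b
      using that less.prems(4) by (auto simp: z' w' keys_add_pp)
    ultimately have "z' + (single (i, j) 1 + y) \<in> G" using less.hyps by blast
    then show ?thesis by (simp add: z' ac_simps)
  qed
qed

section \<open>Comparison with a squarefree strongly stable ideal\<close>

definition min_index :: "pp \<Rightarrow> nat \<Rightarrow> nat" where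
  "min_index w j = Min {i. (i, j) \<in> keys w}"

text \<open>Useful for degrees \<open>D\<close> supported on the columns of \<open>w\<close> only:
  elsewhere \<open>min_index\<close> is the minimum of an empty set.\<close>

definition min_pp :: "pp \<Rightarrow> multideg \<Rightarrow> pp" where
  "min_pp w D = (\<Sum>j\<in>keys D. single (min_index w j, j) (lookup D j))"

lemma min_index:
  assumes "j \<in> keys (mdeg w)"
  shows "(min_index w j, j) \<in> keys w" "\<And>i. (i, j) \<in> keys w \<Longrightarrow> min_index w j \<le> i"
proof -
  have fin: "finite {i. (i, j) \<in> keys w}"
    by (rule finite_subset[of _ "fst ` keys w"]) force+
  moreover have "{i. (i, j) \<in> keys w} \<noteq> {}" using assms by (auto simp: keys_mdeg)
  ultimately show "(min_index w j, j) \<in> keys w" "\<And>i. (i, j) \<in> keys w \<Longrightarrow> min_index w j \<le> i"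
    using Min_in[of "{i. (i, j) \<in> keys w}"] by (auto simp: min_index_def)
qed

lemma lookup_min_pp:
  "lookup (min_pp w D) v = (if fst v = min_index w (snd v) then lookup D (snd v) else 0)"
proof -
  have "lookup (min_pp w D) v =
    (\<Sum>j\<in>keys D. if j = snd v then (lookup D j when fst v = min_index w j) else 0)"
    unfolding min_pp_def lookup_sum by (cases v, intro sum.cong) (auto simp: lookup_single when_def)
  then show ?thesis by (cases v) (auto simp: when_def in_keys_iff)
qed

lemma mdeg_min_pp: "mdeg (min_pp w D) = D"
proof -
  have "mdeg (min_pp w D) = (\<Sum>j\<in>keys D. single j (lookup D j))"
    by (simp add: min_pp_def mdeg_sum mdeg_single)
  also have "\<dots> = D"
    by (intro poly_mapping_eqI) (auto simp: lookup_sum lookup_single when_def in_keys_iff)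
  finally show ?thesis .
qed

lemma min_pp_in_pps:
  assumes "w \<in> pps n m" "keys D \<subseteq> keys (mdeg w)"
  shows "min_pp w D \<in> pps n m"
  unfolding in_pps_iff
proof
  fix v assume "v \<in> keys (min_pp w D)"
  then have "v = (min_index w (snd v), snd v)" "snd v \<in> keys D"
    by (cases v, auto simp: in_keys_iff lookup_min_pp split: if_splits)
  then show "v \<in> vars n m"
    using assms min_index(1)[of "snd v" w] by (auto simp: in_pps_iff)
qed

lemma lookup_sqdeg: "finite A \<Longrightarrow> lookup (sqdeg A) j = (if j \<in> A then 1 else 0)"
  by (simp add: sqdeg_def lookup_sum lookup_single when_def)

lemma keys_sqdeg: "finite A \<Longrightarrow> keys (sqdeg A) = A"
  by (auto simp: in_keys_iff lookup_sqdeg split: if_splits)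

lemma min_pp_sqdeg_dvd: "\<exists>z. w = min_pp w (sqdeg (keys (mdeg w))) + z"
proof (rule pp_splitI)
  fix v
  show "lookup (min_pp w (sqdeg (keys (mdeg w)))) v \<le> lookup w v"
    using min_index(1)[of "snd v" w]
    by (cases v) (auto simp: lookup_min_pp lookup_sqdeg in_keys_iff)
qed

definition squarefree_closed :: "pp set \<Rightarrow> bool" where
  "squarefree_closed H \<longleftrightarrow> (\<forall>w\<in>H. (\<Sum>v\<in>keys w. single v 1) \<in> H)"

lemma min_pp_sqdeg_in:
  assumes "squarefree_closed H" "min_pp w D \<in> H"
  shows "min_pp w (sqdeg (keys D)) \<in> H"
proof -
  have "(\<Sum>v\<in>keys (min_pp w D). single v 1) = min_pp w (sqdeg (keys D))"
    by (intro poly_mapping_eqI)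
      (auto simp: lookup_sum lookup_single when_def lookup_min_pp lookup_sqdeg in_keys_iff)
  with assms show ?thesis by (metis squarefree_closed_def)
qed

lemma min_pp_in_stable:
  assumes "mon_ideal n m G" "strongly_stable G" "w \<in> G"
  shows "min_pp w (mdeg w) \<in> G"
proof -
  have "min_pp w (mdeg w) + 0 \<in> G"
  proof (rule strongly_stable_lower[where w = w, OF assms(2)])
    show "min_pp w (mdeg w) \<in> pps n m"
      using assms mon_ideal_subset by (intro min_pp_in_pps) auto
    show "w + 0 \<in> G" using assms by simp
    fix i i' j assume "(i, j) \<in> keys (min_pp w (mdeg w))" "(i', j) \<in> keys w"
    then show "i \<le> i'"
      using min_index(2)[of j w i'] by (auto simp: in_keys_iff lookup_min_pp split: if_splits)
  qed (simp add: mdeg_min_pp)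
  then show ?thesis by simp
qed

text \<open>Strong stability leads from \<open>w\<close> to the power product of the same degree in
  the first variable of each of its columns; the radical of the latter divides
  \<open>w\<close>.\<close>

lemma strongly_stable_multilinear:
  assumes "mon_ideal n m H" "strongly_stable H" "squarefree_closed H"
  shows "multilinear_generated H"
  unfolding multilinear_generated_def
  using min_pp_sqdeg_in[OF assms(3) min_pp_in_stable[OF assms(1,2)]] min_pp_sqdeg_dvd mdeg_min_pp
  by metis

text \<open>In a large degree \<open>D\<close>, \<open>G\<close> contains every power product in the
  rows up to those of \<open>min_pp w D\<close>. Equal counts leave \<open>H\<close> no choice but
  to contain them too, and squarefreeness then strips off the exponents and with them the large
  degree.\<close>

lemma stable_subset_squarefree:
  assumes G: "mon_ideal n m G" "strongly_stable G" and H: "mon_ideal n m H" "strongly_stable H"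
    and sf: "squarefree_closed H" and eq: "\<And>D. card (degp G D) = card (degp H D)"
  shows "G \<subseteq> H"
proof
  fix w assume w: "w \<in> G"
  let ?C = "keys (mdeg w)"
  have wp: "w \<in> pps n m" using w G mon_ideal_subset by blast
  have C: "?C \<subseteq> {1..n}" using wp by (auto simp: keys_mdeg in_pps_iff vars_def)
  \<comment> \<open>The columns outside the support of \<open>w\<close> keep the full bound, as the
    equality of counts demands; \<open>D\<close> vanishes there.\<close>
  define u where "u j = (if j \<in> ?C then min_index w j else m j)" for j
  have u: "u j \<le> m j" for j
    using min_index(1)[of j w] wp by (auto simp: u_def in_pps_iff vars_def)
  obtain N where N: "\<And>D. (\<And>j. j \<in> ?C \<Longrightarrow> N \<le> lookup D j) \<Longrightarrow>
      card (degp (G \<inter> below u) D) = card (degp (H \<inter> below u) D)"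
    using card_below_eq[OF G H eq C u] unfolding u_def by simp blast
  define E where "E = (\<Sum>j\<in>?C. single j N)"
  have E: "lookup E j = (if j \<in> ?C then N else 0)" for j
    by (simp add: E_def lookup_sum lookup_single when_def)
  \<comment> \<open>Large enough in the columns of \<open>w\<close> for the counts to agree, and
    with the same support.\<close>
  define D where "D = mdeg w + E"
  have D: "keys D = ?C" "\<And>j. j \<in> ?C \<Longrightarrow> N \<le> lookup D j"
    by (auto simp: D_def keys_add_pp lookup_add E in_keys_iff split: if_splits)
  let ?X = "min_pp w D"
  have Xp: "?X \<in> pps n m" using wp D by (intro min_pp_in_pps) auto
  have Ep: "min_pp w E \<in> pps n m" using wp by (intro min_pp_in_pps) (auto simp: E in_keys_iff split: if_splits)
  have XG: "?X \<in> G"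
  proof -
    have "min_pp w (mdeg w) + min_pp w E \<in> G"
      using min_pp_in_stable[OF G w] Ep G mon_ideal_add by blast
    moreover have "min_pp w (mdeg w) + min_pp w E = ?X"
      by (intro poly_mapping_eqI) (auto simp: lookup_add lookup_min_pp D_def)
    ultimately show ?thesis by simp
  qed
  have all: "z \<in> G" if z: "z \<in> pps n m" "z \<in> below u" "mdeg z = D" for z
  proof -
    have "z + 0 \<in> G"
    proof (rule strongly_stable_lower[OF G(2) z(1)])
      show "mdeg z = mdeg ?X" using z by (simp add: mdeg_min_pp)
      show "?X + 0 \<in> G" using XG by simp
      fix i i' j assume ij: "(i, j) \<in> keys z" "(i', j) \<in> keys ?X"
      have "j \<in> ?C" using ij(1) z(3) D(1) by (metis keys_mdeg image_eqI snd_conv)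
      moreover have "i \<le> u j" using ij(1) z(2) by (auto simp: below_def)
      moreover have "i' = min_index w j"
        using ij(2) by (auto simp: in_keys_iff lookup_min_pp split: if_splits)
      ultimately show "i \<le> i'" by (simp add: u_def)
    qed
    then show ?thesis by simp
  qed
  have "degp (H \<inter> below u) D = degp (G \<inter> below u) D"
  proof (rule card_seteq)
    show "finite (degp (G \<inter> below u) D)"
      using finite_degp[of "G \<inter> below u" n m] mon_ideal_subset[OF G(1)] by auto
    show "degp (H \<inter> below u) D \<subseteq> degp (G \<inter> below u) D"
      using all mon_ideal_subset[OF H(1)] by (auto simp: degp_def)
    show "card (degp (G \<inter> below u) D) \<le> card (degp (H \<inter> below u) D)"
      using N[of D] D(2) by simp
  qed
  moreover have "?X \<in> below u"
    unfolding below_def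
  proof (intro CollectI ballI)
    fix v assume "v \<in> keys ?X"
    then have "fst v = min_index w (snd v)" "snd v \<in> keys D"
      by (auto simp: in_keys_iff lookup_min_pp split: if_splits)
    then show "fst v \<le> u (snd v)" using D(1) by (simp add: u_def)
  qed
  then have "?X \<in> degp (G \<inter> below u) D" using XG by (simp add: degp_def mdeg_min_pp)
  ultimately have "?X \<in> degp (H \<inter> below u) D" by blast
  then have "?X \<in> H" by (simp add: degp_def)
  then have "min_pp w (sqdeg ?C) \<in> H" using min_pp_sqdeg_in[OF sf] D(1) by metis
  moreover obtain z where z: "w = min_pp w (sqdeg ?C) + z" using min_pp_sqdeg_dvd by blast
  moreover have "z \<in> pps n m" using wp z by (metis add_in_pps_iff)
  ultimately show "w \<in> H" using H(1) mon_ideal_add by metis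
qed

text \<open>Equal counts turn the inclusion of the limit in \<open>H\<close> into an equality, so
  the limit inherits squarefree generation from \<open>H\<close> and hands it back to
  \<open>M\<close>.\<close>

theorem multilinear_generatedI:
  assumes M: "mon_ideal n m M" and H: "mon_ideal n m H" "strongly_stable H" "squarefree_closed H"
    and eq: "\<And>D. card (degp M D) = card (degp H D)"
  shows "multilinear_generated M"
proof -
  let ?G = "climit n m M"
  have G: "mon_ideal n m ?G" "strongly_stable ?G"
    using M by (auto intro: climit_mon_ideal climit_strongly_stable)
  have eq': "card (degp ?G D) = card (degp H D)" for D using M eq by (simp add: card_climit)
  have sub: "?G \<subseteq> H" using stable_subset_squarefree[OF G H eq'] .
  have "degp ?G D = degp H D" for D
    using sub eq' by (intro card_subset_eq finite_degp[OF mon_ideal_subset[OF H(1)]])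
      (auto simp: degp_def)
  then have "?G = H" by (auto simp: degp_def set_eq_iff)
  then have "multilinear_generated ?G" using strongly_stable_multilinear[OF H] by simp
  then show ?thesis using multilinear_generated_climit[OF M] by blast
qed


section \<open>Polynomials\<close>

lemma mem_carrier: "f \<in> carrier (poly_ring n m) \<longleftrightarrow> keys f \<subseteq> pps n m"
  by (simp add: poly_ring_def)

lemma poly_sum_single: "f = (\<Sum>t\<in>keys f. single t (lookup f t))"
  by (intro poly_mapping_eqI) (auto simp: lookup_sum lookup_single when_def in_keys_iff)

lemma lookup_single_mult:
  "lookup (single z c * f) w = (\<Sum>t\<in>keys f. c * lookup f t when z + t = w)" for f :: "'k::field mpoly"
proof -
  have "single z c * f = (\<Sum>t\<in>keys f. single (z + t) (c * lookup f t))"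
    by (subst poly_sum_single[of f]) (simp add: sum_distrib_left mult_single)
  then show ?thesis by (simp add: lookup_sum lookup_single)
qed

lemma lookup_const_mult [simp]: "lookup (const c * f) t = c * lookup f t"
proof -
  have "lookup (const c * f) t = (\<Sum>s\<in>keys f. if s = t then c * lookup f s else 0)"
    by (simp add: const_def lookup_single_mult when_def)
  then show ?thesis by (auto simp: in_keys_iff)
qed

lemma lookup_monomial_mult [simp]: "lookup (monomial z * f) (z + t) = lookup f t"
proof -
  have "lookup (monomial z * f) (z + t) = (\<Sum>s\<in>keys f. if s = t then lookup f s else 0)"
    by (simp add: monomial_def lookup_single_mult when_def)
  then show ?thesis by (auto simp: in_keys_iff)
qed

lemma keys_monomial_mult: "keys (monomial z * f) = (+) z ` keys f"
proof
  show "keys (monomial z * f) \<subseteq> (+) z ` keys f"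
    using keys_mult[of "monomial z" f] by (auto simp: monomial_def)
  show "(+) z ` keys f \<subseteq> keys (monomial z * f)"
    by (auto simp: in_keys_iff)
qed

lemma keys_const_mult_subset: "keys (const c * f) \<subseteq> keys f"
  by (auto simp: in_keys_iff)

lemma const_mult_single: "const c * single t d = single t (c * d)"
  by (simp add: const_def mult_single)

lemma single_eq_const_monomial: "single t c = const c * monomial t"
  by (simp add: monomial_def const_mult_single)

lemma const_one [simp]: "const 1 = 1"
  by (simp add: const_def)

lemma const_zero [simp]: "const 0 = 0"
  by (simp add: const_def)

lemma const_in_carrier: "const c \<in> carrier (poly_ring n m)"
  by (simp add: mem_carrier const_def)

lemma monomial_in_carrier: "monomial t \<in> carrier (poly_ring n m) \<longleftrightarrow> t \<in> pps n m"
  by (simp add: mem_carrier monomial_def)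

lemma keys_plus_subset: "keys f \<subseteq> X \<Longrightarrow> keys g \<subseteq> X \<Longrightarrow> keys (f + g) \<subseteq> X"
  using Poly_Mapping.keys_add[of f g] by blast

lemma keys_sum_subset: "(\<And>i. i \<in> A \<Longrightarrow> keys (f i) \<subseteq> X) \<Longrightarrow> keys (sum f A) \<subseteq> X"
  using Poly_Mapping.keys_sum[of f A] by blast

lemma keys_mult_subset:
  "keys f \<subseteq> X \<Longrightarrow> keys g \<subseteq> Y \<Longrightarrow> keys (f * g) \<subseteq> {s + t |s t. s \<in> X \<and> t \<in> Y}"
  using keys_mult[of f g] by blast

lemma poly_ring_simps:
  "monoid.mult (poly_ring n m) = (*)" "one (poly_ring n m) = 1" "zero (poly_ring n m) = 0"
  "add (poly_ring n m) = (+)"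
  by (simp_all add: poly_ring_def)

lemma ideal_iff:
  fixes I :: "'k::field mpoly set"
  shows "ideal I (poly_ring n m) \<longleftrightarrow> I \<subseteq> carrier (poly_ring n m) \<and> 0 \<in> I \<and>
    (\<forall>f\<in>I. \<forall>g\<in>I. f + g \<in> I) \<and> (\<forall>f\<in>I. \<forall>s\<in>carrier (poly_ring n m). s * f \<in> I)"
proof
  assume "ideal I (poly_ring n m)"
  then interpret ideal I "poly_ring n m" .
  show "I \<subseteq> carrier (poly_ring n m) \<and> 0 \<in> I \<and>
    (\<forall>f\<in>I. \<forall>g\<in>I. f + g \<in> I) \<and> (\<forall>f\<in>I. \<forall>s\<in>carrier (poly_ring n m). s * f \<in> I)"
    using a_subset additive_subgroup.zero_closed[OF is_additive_subgroup]
      additive_subgroup.a_closed[OF is_additive_subgroup] I_l_closed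
    by (auto simp: poly_ring_simps)
next
  assume I: "I \<subseteq> carrier (poly_ring n m) \<and> 0 \<in> I \<and>
    (\<forall>f\<in>I. \<forall>g\<in>I. f + g \<in> I) \<and> (\<forall>f\<in>I. \<forall>s\<in>carrier (poly_ring n m). s * f \<in> I)"
  interpret cring "poly_ring n m :: 'k mpoly ring" by (rule cring_poly_ring)
  show "ideal I (poly_ring n m)"
  proof (rule idealI)
    show "ring (poly_ring n m :: 'k mpoly ring)" by (rule ring_axioms)
    show "subgroup I (add_monoid (poly_ring n m))"
    proof (rule group.subgroupI[OF a_group])
      fix f assume f: "f \<in> I"
      \<comment> \<open>Additive inverses come from absorbing the constant -1.\<close>
      have "const (-1) * f \<in> I" using I f const_in_carrier by blast
      moreover have "const (-1) * f + f = 0"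
        by (intro poly_mapping_eqI) (simp add: lookup_add)
      moreover have "f \<in> carrier (poly_ring n m)" "const (-1) * f \<in> carrier (poly_ring n m)"
        using I f calculation by blast+
      ultimately have "\<ominus>\<^bsub>poly_ring n m\<^esub> f \<in> I"
        using minus_equality[of "const (-1) * f" f] by (simp add: poly_ring_simps)
      then show "inv\<^bsub>add_monoid (poly_ring n m)\<^esub> f \<in> I" by (simp add: a_inv_def)
    qed (use I in \<open>auto simp: poly_ring_simps\<close>)
  qed (use I in \<open>auto simp: poly_ring_simps mult.commute\<close>)
qed

lemma idealD:
  fixes I :: "'k::field mpoly set"
  assumes "ideal I (poly_ring n m)"
  shows "f \<in> I \<Longrightarrow> keys f \<subseteq> pps n m" "0 \<in> I" "f \<in> I \<Longrightarrow> g \<in> I \<Longrightarrow> f + g \<in> I"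
    "f \<in> I \<Longrightarrow> s \<in> carrier (poly_ring n m) \<Longrightarrow> s * f \<in> I" "f \<in> I \<Longrightarrow> const c * f \<in> I"
    "f \<in> I \<Longrightarrow> t \<in> pps n m \<Longrightarrow> monomial t * f \<in> I"
  using assms unfolding ideal_iff
  by (auto simp: mem_carrier[symmetric] const_in_carrier monomial_in_carrier)

lemma ideal_subspace:
  fixes I :: "'k::field mpoly set"
  shows "ideal I (poly_ring n m) \<Longrightarrow> kvec.subspace I"
  using idealD[of I n m] by (auto simp: kvec.subspace_def)

lemma ideal_sum:
  fixes I :: "'k::field mpoly set"
  shows "ideal I (poly_ring n m) \<Longrightarrow> (\<And>i. i \<in> A \<Longrightarrow> f i \<in> I) \<Longrightarrow> sum f A \<in> I"
  using kvec.subspace_sum[OF ideal_subspace] .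

lemma ideal_diff:
  fixes I :: "'k::field mpoly set"
  shows "ideal I (poly_ring n m) \<Longrightarrow> f \<in> I \<Longrightarrow> g \<in> I \<Longrightarrow> f - g \<in> I"
  using kvec.subspace_diff[OF ideal_subspace] .

section \<open>Monomial ideals as spans of power products\<close>

definition kspan :: "pp set \<Rightarrow> 'k::field mpoly set" where
  "kspan Q = {f. keys f \<subseteq> Q}"

lemma span_monomials: "kvec.span (monomial ` Q) = kspan Q"
proof
  have "kvec.subspace (kspan Q)"
    unfolding kvec.subspace_def kspan_def mem_Collect_eq
    using keys_plus_subset[of _ Q] subset_trans[OF keys_const_mult_subset] by simp blast
  then show "kvec.span (monomial ` Q) \<subseteq> kspan Q"
    by (intro kvec.span_minimal) (auto simp: kspan_def monomial_def)
  show "kspan Q \<subseteq> kvec.span (monomial ` Q)"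
  proof
    fix f assume f: "f \<in> kspan Q"
    have "(\<Sum>t\<in>keys f. const (lookup f t) * monomial t) \<in> kvec.span (monomial ` Q)"
      using f by (intro kvec.span_sum kvec.span_scale kvec.span_base) (auto simp: kspan_def)
    then show "f \<in> kvec.span (monomial ` Q)"
      by (simp add: poly_sum_single[symmetric] flip: single_eq_const_monomial)
  qed
qed

lemma kspan_ideal:
  assumes "mon_ideal n m Q"
  shows "ideal (kspan Q :: 'k::field mpoly set) (poly_ring n m)"
  unfolding ideal_iff
proof (intro conjI ballI)
  show "kspan Q \<subseteq> carrier (poly_ring n m)"
    using mon_ideal_subset[OF assms] by (auto simp: kspan_def mem_carrier)
  fix f g :: "'k mpoly" assume "f \<in> kspan Q" "g \<in> kspan Q"
  then show "f + g \<in> kspan Q" using keys_plus_subset[of f Q g] by (simp add: kspan_def)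
next
  fix f s :: "'k mpoly" assume f: "f \<in> kspan Q" and s: "s \<in> carrier (poly_ring n m)"
  have "keys (s * f) \<subseteq> {a + b |a b. a \<in> pps n m \<and> b \<in> Q}"
    using f s by (intro keys_mult_subset) (auto simp: kspan_def mem_carrier)
  also have "\<dots> \<subseteq> Q" using mon_ideal_add[OF assms] by clarify (metis add.commute)
  finally show "s * f \<in> kspan Q" by (simp add: kspan_def)
qed (simp add: kspan_def)

lemma ring_poly_ring: "ring (poly_ring n m :: 'k::field mpoly ring)"
  using cring_poly_ring by (rule cring.axioms(1))

lemma genideal_poly_ideal:
  "X \<subseteq> carrier (poly_ring n m) \<Longrightarrow> ideal (Idl\<^bsub>poly_ring n m\<^esub> X) (poly_ring n m :: 'k::field mpoly ring)"
  using ring.genideal_ideal[OF ring_poly_ring] .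

lemma genideal_superset:
  "X \<subseteq> carrier (poly_ring n m) \<Longrightarrow> X \<subseteq> Idl\<^bsub>poly_ring n m\<^esub> (X :: 'k::field mpoly set)"
  using ring.genideal_self[OF ring_poly_ring] .

lemma genideal_least:
  "ideal I (poly_ring n m) \<Longrightarrow> X \<subseteq> I \<Longrightarrow> Idl\<^bsub>poly_ring n m\<^esub> X \<subseteq> (I :: 'k::field mpoly set)"
  using ring.genideal_minimal[OF ring_poly_ring] .

text \<open>The sandwich covers generation by monomials as well as by whole spans of monomials, as
  in the statement on initial ideals.\<close>

lemma genideal_between:
  fixes X :: "'k::field mpoly set"
  assumes T: "T \<subseteq> pps n m" and "monomial ` T \<subseteq> X" "X \<subseteq> kspan (pp_gen n m T)"
  shows "Idl\<^bsub>poly_ring n m\<^esub> X = kspan (pp_gen n m T)"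
proof
  have id: "ideal (kspan (pp_gen n m T) :: 'k mpoly set) (poly_ring n m)"
    by (intro kspan_ideal pp_gen_mon_ideal T)
  then have X: "X \<subseteq> carrier (poly_ring n m)" using assms(3) unfolding ideal_iff by blast
  show "Idl\<^bsub>poly_ring n m\<^esub> X \<subseteq> kspan (pp_gen n m T)" by (rule genideal_least[OF id assms(3)])
  note J = genideal_poly_ideal[OF X]
  show "kspan (pp_gen n m T) \<subseteq> Idl\<^bsub>poly_ring n m\<^esub> X"
    unfolding span_monomials[symmetric]
  proof (intro kvec.span_minimal ideal_subspace[OF J] image_subsetI)
    fix w assume "w \<in> pp_gen n m T"
    then obtain t z where w: "w = t + z" "t \<in> T" "z \<in> pps n m" by (auto simp: pp_gen_def)
    then have "monomial z * monomial t \<in> Idl\<^bsub>poly_ring n m\<^esub> X"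
      using genideal_superset[OF X] assms(2) by (intro idealD(6)[OF J]) auto
    then show "monomial w \<in> Idl\<^bsub>poly_ring n m\<^esub> X"
      by (simp add: w(1) monomial_def mult_single add.commute)
  qed
qed

lemma genideal_monomials:
  "T \<subseteq> pps n m \<Longrightarrow> Idl\<^bsub>poly_ring n m\<^esub> (monomial ` T :: 'k::field mpoly set) = kspan (pp_gen n m T)"
  using pp_gen_superset[of T n m]
  by (intro genideal_between) (auto simp: kspan_def monomial_def)

lemma genideal_kspans:
  assumes "\<And>A. A \<in> F \<Longrightarrow> Q A \<subseteq> pps n m"
  shows "Idl\<^bsub>poly_ring n m\<^esub> (\<Union>A\<in>F. kspan (Q A) :: 'k::field mpoly set) = kspan (pp_gen n m (\<Union>A\<in>F. Q A))"
proof (intro genideal_between)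
  show "(\<Union>A\<in>F. kspan (Q A)) \<subseteq> kspan (pp_gen n m (\<Union>A\<in>F. Q A))"
    using pp_gen_superset[of "\<Union>A\<in>F. Q A" n m] by (fastforce simp: kspan_def)
qed (use assms in \<open>auto simp: kspan_def monomial_def\<close>)

lemma pp_gen_self: "mon_ideal n m M \<Longrightarrow> pp_gen n m M = M"
  by (simp add: pp_gen_least pp_gen_superset subset_antisym)

lemma monomial_ideal_iff:
  "monomial_ideal n m (B :: 'k::field mpoly set) \<longleftrightarrow> (\<exists>M. mon_ideal n m M \<and> B = kspan M)"
proof
  assume "monomial_ideal n m B"
  then show "\<exists>M. mon_ideal n m M \<and> B = kspan M"
    using genideal_monomials pp_gen_mon_ideal unfolding monomial_ideal_def by metis
next
  assume "\<exists>M. mon_ideal n m M \<and> B = kspan M"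
  then obtain M where M: "mon_ideal n m M" "B = kspan M" by blast
  then show "monomial_ideal n m B"
    using genideal_monomials[of M n m] pp_gen_self[OF M(1)] mon_ideal_subset[OF M(1)]
    unfolding monomial_ideal_def by metis
qed

section \<open>Homogeneous parts\<close>

lemma lookup_hom_part: "lookup (hom_part a f) t = (lookup f t when mdeg t = a)"
  by (auto simp: hom_part_def lookup_sum lookup_single when_def in_keys_iff intro!: sum.neutral split: if_splits)

lemma keys_hom_part: "keys (hom_part a f) = {t \<in> keys f. mdeg t = a}"
  by (auto simp: in_keys_iff lookup_hom_part when_def split: if_splits)

lemma hom_part_add: "hom_part a (f + g) = hom_part a f + hom_part a g"
  by (intro poly_mapping_eqI) (simp add: lookup_hom_part lookup_add when_def)

lemma hom_part_scale: "hom_part a (const c * f) = const c * hom_part a f"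
  by (intro poly_mapping_eqI) (simp add: lookup_hom_part when_def)

lemma hom_part_zero [simp]: "hom_part a 0 = 0"
  by (simp add: hom_part_def)

lemma hom_part_homogeneous:
  assumes "\<And>t. t \<in> keys f \<Longrightarrow> mdeg t = b"
  shows "hom_part a f = (if a = b then f else 0)"
  by (intro poly_mapping_eqI) (use assms in \<open>auto simp: lookup_hom_part when_def in_keys_iff\<close>)

text \<open>As images under \<open>hom_part\<close>, components can be passed through any
  substitution that commutes with it.\<close>

lemma component_eq: "graded_ideal n m I \<Longrightarrow> component I a = hom_part a ` I"
proof (intro equalityI subsetI)
  fix f assume "f \<in> component I a"
  then have "f \<in> I" "hom_part a f = f" using hom_part_homogeneous[of f a a] by (auto simp: component_def)
  then show "f \<in> hom_part a ` I" by (metis imageI)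
qed (auto simp: component_def graded_ideal_def keys_hom_part)

lemma kspan_graded: "mon_ideal n m M \<Longrightarrow> graded_ideal n m (kspan M)"
  unfolding graded_ideal_def by (intro conjI kspan_ideal) (auto simp: kspan_def keys_hom_part)


section \<open>Leading power products\<close>

definition leads :: "pp rel \<Rightarrow> 'k::field mpoly set \<Rightarrow> pp set" where
  "leads r V = {lead_pp r f |f. f \<in> V \<and> f \<noteq> 0}"

context
  fixes n m r
  assumes ord: "term_order n m r"
begin

lemma ord_refl: "t \<in> pps n m \<Longrightarrow> (t, t) \<in> r"
  using ord by (auto simp: term_order_def linear_order_on_def partial_order_on_def preorder_on_def refl_on_def)

lemma ord_trans: "(s, t) \<in> r \<Longrightarrow> (t, u) \<in> r \<Longrightarrow> (s, u) \<in> r"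
  using ord unfolding term_order_def linear_order_on_def partial_order_on_def preorder_on_def
  by (meson transD)

lemma ord_antisym: "(s, t) \<in> r \<Longrightarrow> (t, s) \<in> r \<Longrightarrow> s = t"
  using ord unfolding term_order_def linear_order_on_def partial_order_on_def
  by (meson antisymD)

lemma ord_total: "s \<in> pps n m \<Longrightarrow> t \<in> pps n m \<Longrightarrow> (s, t) \<in> r \<or> (t, s) \<in> r"
  using ord ord_refl unfolding term_order_def linear_order_on_def total_on_def by metis

lemma ord_add: "(s, t) \<in> r \<Longrightarrow> u \<in> pps n m \<Longrightarrow> (s + u, t + u) \<in> r"
  using ord unfolding term_order_def by blast

lemma ord_max_exists:
  assumes "finite X" "X \<noteq> {}" "X \<subseteq> pps n m"
  shows "\<exists>t\<in>X. \<forall>s\<in>X. (s, t) \<in> r"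
  using assms
proof (induction X rule: finite_ne_induct)
  case (singleton x)
  then show ?case using ord_refl by auto
next
  case (insert x X)
  then obtain t where t: "t \<in> X" "\<forall>s\<in>X. (s, t) \<in> r" by auto
  consider "(x, t) \<in> r" | "(t, x) \<in> r" using ord_total[of x t] insert t by auto
  then show ?case
  proof cases
    case 1
    then show ?thesis using t by (intro bexI[of _ t]) auto
  next
    case 2
    then show ?thesis using t ord_trans ord_refl insert.prems by (intro bexI[of _ x]) auto
  qed
qed

lemma lead_eqI:
  assumes "t \<in> keys f" "\<And>s. s \<in> keys f \<Longrightarrow> (s, t) \<in> r"
  shows "lead_pp r f = t"
  unfolding lead_pp_def using assms ord_antisym by (intro the_equality) auto

lemma lead_props:
  assumes "f \<noteq> 0" "keys f \<subseteq> pps n m"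
  shows "lead_pp r f \<in> keys f" "\<And>s. s \<in> keys f \<Longrightarrow> (s, lead_pp r f) \<in> r"
proof -
  obtain t where t: "t \<in> keys f" "\<And>s. s \<in> keys f \<Longrightarrow> (s, t) \<in> r"
    using ord_max_exists[of "keys f"] assms by auto
  then show "lead_pp r f \<in> keys f" "\<And>s. s \<in> keys f \<Longrightarrow> (s, lead_pp r f) \<in> r"
    using lead_eqI[OF t] by auto
qed

lemma lead_monomial_mult:
  assumes "f \<noteq> 0" "keys f \<subseteq> pps n m" "z \<in> pps n m"
  shows "lead_pp r (monomial z * f) = z + lead_pp r f"
proof (rule lead_eqI)
  show "z + lead_pp r f \<in> keys (monomial z * f)"
    using lead_props[OF assms(1,2)] by (simp add: keys_monomial_mult)
  fix s assume "s \<in> keys (monomial z * f)"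
  then obtain u where "u \<in> keys f" "s = z + u" by (auto simp: keys_monomial_mult)
  then show "(s, z + lead_pp r f) \<in> r"
    using ord_add[OF lead_props(2)[OF assms(1,2)] assms(3), of u] by (simp add: add.commute)
qed

lemma monomial_nonzero: "monomial t \<noteq> (0 :: 'k::field mpoly)"
  by (metis lookup_single_eq lookup_zero monomial_def zero_neq_one)

lemma monomial_mult_nonzero: "f \<noteq> 0 \<Longrightarrow> monomial z * f \<noteq> 0"
  using keys_monomial_mult[of z f] by (metis image_is_empty keys_eq_empty)

lemma leads_mon_ideal:
  assumes "ideal I (poly_ring n m)"
  shows "mon_ideal n m (leads r I)"
  unfolding mon_ideal_def
proof (intro conjI ballI subsetI)
  fix w assume "w \<in> leads r I"
  then obtain f where "f \<in> I" "f \<noteq> 0" "w = lead_pp r f" by (auto simp: leads_def)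
  then show "w \<in> pps n m" using lead_props(1)[of f] idealD(1)[OF assms] by auto
next
  fix w t assume w: "w \<in> leads r I" and t: "t \<in> pps n m"
  then obtain f where f: "f \<in> I" "f \<noteq> 0" "w = lead_pp r f" by (auto simp: leads_def)
  have "lead_pp r (monomial t * f) = w + t"
    using lead_monomial_mult[OF f(2) idealD(1)[OF assms f(1)] t] f(3) by (simp add: add.commute)
  moreover have "monomial t * f \<in> I" by (rule idealD(6)[OF assms f(1) t])
  ultimately show "w + t \<in> leads r I"
    using monomial_mult_nonzero[OF f(2), of t] unfolding leads_def mem_Collect_eq by metis
qed

lemma leads_kspan:
  assumes "Q \<subseteq> pps n m"
  shows "leads r (kspan Q :: 'k::field mpoly set) = Q"
proof
  show "leads r (kspan Q :: 'k mpoly set) \<subseteq> Q"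
  proof
    fix t assume "t \<in> leads r (kspan Q :: 'k mpoly set)"
    then obtain f :: "'k mpoly" where f: "keys f \<subseteq> Q" "f \<noteq> 0" "t = lead_pp r f"
      by (auto simp: leads_def kspan_def)
    then have "t \<in> keys f" using lead_props(1)[of f] assms by auto
    then show "t \<in> Q" using f by auto
  qed
  show "Q \<subseteq> leads r (kspan Q :: 'k mpoly set)"
  proof
    fix t assume t: "t \<in> Q"
    have "lead_pp r (monomial t :: 'k mpoly) = t"
      using t assms by (intro lead_eqI) (auto simp: monomial_def ord_refl)
    moreover have "(monomial t :: 'k mpoly) \<in> kspan Q" "(monomial t :: 'k mpoly) \<noteq> 0"
      using t by (auto simp: kspan_def monomial_def monomial_nonzero[unfolded monomial_def])
    ultimately show "t \<in> leads r (kspan Q :: 'k mpoly set)" unfolding leads_def mem_Collect_eq by metis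
  qed
qed

text \<open>The homogeneous part of \<open>f\<close> in the degree of its leading term has the same
  leading term.\<close>

lemma leads_component:
  assumes I: "graded_ideal n m I"
  shows "leads r (component I D) = degp (leads r I) D"
proof (intro equalityI subsetI)
  have id: "ideal I (poly_ring n m)" using I by (simp add: graded_ideal_def)
  {
    fix t assume "t \<in> leads r (component I D)"
    then obtain f where f: "f \<in> I" "f \<noteq> 0" "t = lead_pp r f" "\<forall>s\<in>keys f. mdeg s = D"
      by (auto simp: leads_def component_def)
    then show "t \<in> degp (leads r I) D"
      using lead_props(1)[OF f(2) idealD(1)[OF id f(1)]] by (auto simp: degp_def leads_def)
  next
    fix t assume "t \<in> degp (leads r I) D"
    then obtain f where f: "f \<in> I" "f \<noteq> 0" "t = lead_pp r f" "mdeg t = D"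
      by (auto simp: leads_def degp_def)
    note l = lead_props[OF f(2) idealD(1)[OF id f(1)]]
    have "t \<in> keys (hom_part D f)" using l(1) f by (simp add: keys_hom_part)
    moreover from this have "lead_pp r (hom_part D f) = t"
      using l(2) f(3) by (intro lead_eqI) (auto simp: keys_hom_part)
    moreover have "hom_part D f \<in> component I D" using f I component_eq by blast
    ultimately show "t \<in> leads r (component I D)" unfolding leads_def mem_Collect_eq by force
  }
qed

text \<open>One vector of \<open>V\<close> for each leading power product gives a basis: the
  triangular shape yields independence, and reduction inside the finite set \<open>X\<close> yields
  spanning.\<close>

lemma dim_eq_card_leads:
  fixes V :: "'k::field mpoly set"
  assumes V: "kvec.subspace V" and X: "finite X" "X \<subseteq> pps n m" and keysV: "\<And>f. f \<in> V \<Longrightarrow> keys f \<subseteq> X"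
  shows "kvec.dim V = card (leads r V)"
proof -
  have "\<exists>f. f \<in> V \<and> f \<noteq> 0 \<and> lead_pp r f = t" if "t \<in> leads r V" for t
    using that by (auto simp: leads_def)
  then obtain b where b: "\<And>t. t \<in> leads r V \<Longrightarrow> b t \<in> V \<and> b t \<noteq> 0 \<and> lead_pp r (b t) = t" by metis
  have kV: "keys f \<subseteq> pps n m" if "f \<in> V" for f using keysV[OF that] X by blast
  have bp: "t \<in> keys (b t)" "\<And>s. s \<in> keys (b t) \<Longrightarrow> (s, t) \<in> r" if "t \<in> leads r V" for t
    using lead_props[of "b t"] b[OF that] kV by auto
  have sub: "leads r V \<subseteq> X" using bp b keysV by blast
  have fin: "finite (leads r V)" using sub X finite_subset by blast
  have ind: "kvec.independent (b ` T)" if "T \<subseteq> leads r V" for T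
    using that finite_subset[OF that fin]
  proof (induction "card T" arbitrary: T)
    case 0
    then show ?case using kvec.independent_empty by simp
  next
    case (Suc k)
    then have "T \<noteq> {}" by auto
    then obtain t where t: "t \<in> T" "\<forall>s\<in>T. (s, t) \<in> r"
      using ord_max_exists[of T] Suc.prems sub X by blast
    have tl: "t \<in> leads r V" using t Suc.prems by auto
    \<comment> \<open>The coefficient at the largest leading term \<open>t\<close> vanishes on all
      chosen vectors except \<open>b t\<close>.\<close>
    have sp: "kvec.span (b ` (T - {t})) \<subseteq> {g. lookup g t = 0}"
    proof (rule kvec.span_minimal)
      show "b ` (T - {t}) \<subseteq> {g. lookup g t = 0}"
      proof (intro image_subsetI CollectI)
        fix s assume s: "s \<in> T - {t}"
        show "lookup (b s) t = 0"
        proof (rule ccontr)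
          assume "lookup (b s) t \<noteq> 0"
          then have "(t, s) \<in> r" using bp(2)[of s t] s Suc.prems by (auto simp: in_keys_iff)
          then show False using t(2) s ord_antisym by blast
        qed
      qed
      show "kvec.subspace {g. lookup g t = 0}"
        by (auto simp: kvec.subspace_def lookup_add)
    qed
    have "b t \<notin> kvec.span (b ` (T - {t}))" using sp bp(1)[OF tl] by (auto simp: in_keys_iff)
    moreover have "kvec.independent (b ` (T - {t}))"
      using Suc t by (intro Suc.hyps(1)) auto
    ultimately have "kvec.independent (insert (b t) (b ` (T - {t})))"
      by (rule kvec.independent_insertI)
    moreover have "insert (b t) (b ` (T - {t})) = b ` T" using t by blast
    ultimately show ?case by simp
  qed
  have "f \<in> kvec.span (b ` leads r V)" if "f \<in> V" for f
    using that
  proof (induction "card {s \<in> X. (s, lead_pp r f) \<in> r}" arbitrary: f rule: less_induct)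
    case less
    show ?case
    proof (cases "f = 0")
      case True
      then show ?thesis by (simp add: kvec.span_zero)
    next
      case False
      let ?t = "lead_pp r f"
      note l = lead_props[OF False kV[OF less.prems]]
      have tl: "?t \<in> leads r V" using False less.prems by (auto simp: leads_def)
      define c where "c = lookup f ?t / lookup (b ?t) ?t"
      define g where "g = f - const c * b ?t"
      have gV: "g \<in> V" unfolding g_def
        using b[OF tl] less.prems V by (intro kvec.subspace_diff kvec.subspace_scale) auto
      have gt: "lookup g ?t = 0" using bp(1)[OF tl] by (simp add: g_def c_def lookup_minus in_keys_iff)
      have gk: "(s, ?t) \<in> r \<and> s \<noteq> ?t" if "s \<in> keys g" for s
      proof -
        have "s \<in> keys f \<or> s \<in> keys (b ?t)"
          using that by (auto simp: g_def in_keys_iff lookup_minus)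
        then show ?thesis using l(2) bp(2)[OF tl] gt that by (auto simp: in_keys_iff)
      qed
      have "g \<in> kvec.span (b ` leads r V)"
      proof (cases "g = 0")
        case True
        then show ?thesis by (simp add: kvec.span_zero)
      next
        case g0: False
        let ?s = "lead_pp r g"
        have s: "(?s, ?t) \<in> r" "?s \<noteq> ?t" using gk lead_props(1)[OF g0 kV[OF gV]] by auto
        have "{u \<in> X. (u, ?s) \<in> r} \<subset> {u \<in> X. (u, ?t) \<in> r}"
        proof (rule psubsetI)
          show "{u \<in> X. (u, ?s) \<in> r} \<subseteq> {u \<in> X. (u, ?t) \<in> r}" using s ord_trans by blast
          have "?t \<in> {u \<in> X. (u, ?t) \<in> r}" using l keysV[OF less.prems] by auto
          moreover have "?t \<notin> {u \<in> X. (u, ?s) \<in> r}" using s ord_antisym by auto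
          ultimately show "{u \<in> X. (u, ?s) \<in> r} \<noteq> {u \<in> X. (u, ?t) \<in> r}" by blast
        qed
        then have "card {u \<in> X. (u, ?s) \<in> r} < card {u \<in> X. (u, ?t) \<in> r}"
          using X by (intro psubset_card_mono) auto
        then show ?thesis using less.hyps gV by blast
      qed
      moreover have "const c * b ?t \<in> kvec.span (b ` leads r V)"
        using tl by (intro kvec.span_scale kvec.span_base) auto
      ultimately have "g + const c * b ?t \<in> kvec.span (b ` leads r V)" by (rule kvec.span_add)
      then show ?thesis by (simp add: g_def)
    qed
  qed
  moreover have "card (b ` leads r V) = card (leads r V)"
    using b by (intro card_image inj_onI) metis
  ultimately show ?thesis
    using ind[of "leads r V"] b by (intro kvec.dim_unique[where B = "b ` leads r V"]) auto
qed

lemma hilbert_series_leads: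
  fixes I :: "'k::field mpoly set"
  assumes I: "graded_ideal n m I"
  shows "hilbert_series I D = of_nat (card (degp (leads r I) D))"
proof -
  have id: "ideal I (poly_ring n m)" using I by (simp add: graded_ideal_def)
  have "kvec.subspace (component I D)"
    using keys_plus_subset keys_const_mult_subset idealD[OF id]
    by (auto simp: kvec.subspace_def component_def in_keys_iff lookup_add)
  then have "kvec.dim (component I D) = card (leads r (component I D))"
    using idealD(1)[OF id]
    by (intro dim_eq_card_leads[OF _ finite_degree[of n m D]]) (auto simp: component_def)
  then show ?thesis by (simp add: hilbert_series_def leads_component[OF I])
qed

lemma initial_space_leads: "initial_space r V = kspan (leads r (V :: 'k::field mpoly set))"
proof -
  have "{monomial (lead_pp r f) :: 'k mpoly |f. f \<in> V \<and> f \<noteq> 0} = monomial ` leads r V" by (auto simp: leads_def)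
  then show ?thesis unfolding initial_space_def by (simp only: span_monomials)
qed

end

text \<open>The order on finitely supported maps is lexicographic: the smallest differing index
  decides. Since pairs are ordered by row first, a smaller row gives a larger variable, and 0 is
  least because exponents are naturals.\<close>

lemma term_order_exists: "\<exists>r. term_order n m r"
proof
  let ?r = "{(s, t). s \<in> pps n m \<and> t \<in> pps n m \<and> s \<le> t}"
  have "0 \<le> (t :: pp)" for t
  proof (rule ccontr)
    assume "\<not> 0 \<le> t"
    then have "t < 0" by simp
    then show False by transfer (auto simp: less_fun_def)
  qed
  moreover have "single (k, j) (1::nat) \<le> single (i, j) 1" if "i < k" for i k j :: nat
  proof -
    have "less_fun (\<lambda>x. (1::nat) when (k, j) = x) (\<lambda>x. 1 when (i, j) = x)"
      using that unfolding less_fun_def by (intro exI[of _ "(i, j)"]) (auto simp: when_def)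
    then have "single (k, j) (1::nat) < single (i, j) 1" by transfer (simp add: when_def eq_commute)
    then show ?thesis by simp
  qed
  ultimately show "term_order n m ?r"
    unfolding term_order_def linear_order_on_def partial_order_on_def preorder_on_def
    by (auto simp: refl_on_def trans_def antisym_def total_on_def plus_in_pps add_right_mono single_in_pps)
qed


section \<open>Linear extensions and substitutions\<close>

text \<open>Serves for substitutions, where \<open>\<phi>\<close> is multiplicative, and for normal
  form maps, where it usually is not.\<close>

definition linext :: "(pp \<Rightarrow> 'k::field mpoly) \<Rightarrow> 'k mpoly \<Rightarrow> 'k mpoly" where
  "linext \<phi> f = (\<Sum>t\<in>keys f. const (lookup f t) * \<phi> t)"

lemma linext_superset:
  "finite X \<Longrightarrow> keys f \<subseteq> X \<Longrightarrow> linext \<phi> f = (\<Sum>t\<in>X. const (lookup f t) * \<phi> t)"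
  unfolding linext_def by (rule sum.mono_neutral_left) (auto simp: in_keys_iff)

lemma const_add: "const (c + d) = const c + const d"
  by (simp add: const_def single_add)

lemma linext_add: "linext \<phi> (f + g) = linext \<phi> f + linext \<phi> g"
  using Poly_Mapping.keys_add[of f g]
  by (simp add: linext_superset[of "keys f \<union> keys g"] lookup_add const_add distrib_right sum.distrib)

lemma linext_scale: "linext \<phi> (const c * f) = const c * linext \<phi> f"
  using linext_superset[of "keys f" "const c * f" \<phi>] keys_const_mult_subset[of c f]
  by (simp add: linext_def kvec.scale_sum_right)

lemma linext_zero [simp]: "linext \<phi> 0 = 0"
  by (simp add: linext_def)

lemma linext_sum: "linext \<phi> (sum f A) = (\<Sum>i\<in>A. linext \<phi> (f i))"
  by (induction A rule: infinite_finite_induct) (auto simp: linext_add)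

lemma linext_single: "linext \<phi> (single t c) = const c * \<phi> t"
  by (subst linext_superset[of "{t}"]) auto

lemma linext_monomial: "linext \<phi> (monomial t) = \<phi> t"
  by (simp add: monomial_def linext_single)

lemma linext_monomial_mult: "linext \<phi> (monomial z * f) = linext (\<lambda>t. \<phi> (z + t)) f"
  by (simp add: linext_def keys_monomial_mult sum.reindex)

lemma linext_mult_right: "linext (\<lambda>t. \<phi> t * p) f = linext \<phi> f * p"
  by (simp add: linext_def sum_distrib_right mult.assoc)

lemma linext_cong: "(\<And>t. t \<in> keys f \<Longrightarrow> \<phi> t = \<psi> t) \<Longrightarrow> linext \<phi> f = linext \<psi> f"
  by (simp add: linext_def)

lemma linext_mult:
  assumes "\<And>s t. \<phi> (s + t) = \<phi> s * \<phi> t"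
  shows "linext \<phi> (f * g) = linext \<phi> f * linext \<phi> g"
proof -
  have "linext \<phi> (f * g) = linext \<phi> (\<Sum>s\<in>keys f. const (lookup f s) * (monomial s * g))"
    by (subst poly_sum_single[of f])
      (simp add: sum_distrib_right single_eq_const_monomial mult.assoc)
  also have "\<dots> = (\<Sum>s\<in>keys f. const (lookup f s) * linext (\<lambda>t. \<phi> s * \<phi> t) g)"
    by (simp add: linext_sum linext_scale linext_monomial_mult assms)
  also have "\<dots> = linext \<phi> f * linext \<phi> g"
    unfolding linext_def sum_product by (simp add: sum_distrib_left ac_simps)
  finally show ?thesis .
qed

section \<open>Substitutions as multiplicative linear extensions\<close>

definition evalm :: "(nat \<times> nat \<Rightarrow> 'k::field mpoly) \<Rightarrow> pp \<Rightarrow> 'k mpoly" where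
  "evalm \<sigma> t = (\<Prod>v\<in>keys t. \<sigma> v ^ lookup t v)"

lemma poly_subst_linext: "poly_subst \<sigma> = linext (evalm \<sigma>)"
  by (simp add: fun_eq_iff poly_subst_def linext_def evalm_def)

lemma evalm_add: "evalm \<sigma> (s + t) = evalm \<sigma> s * evalm \<sigma> t"
proof -
  have ext: "evalm \<sigma> u = (\<Prod>v\<in>keys s \<union> keys t. \<sigma> v ^ lookup u v)" if "keys u \<subseteq> keys s \<union> keys t" for u
    unfolding evalm_def using that by (intro prod.mono_neutral_left) (auto simp: in_keys_iff)
  show ?thesis using Poly_Mapping.keys_add[of s t]
    by (simp add: ext lookup_add power_add prod.distrib)
qed

lemma evalm_zero [simp]: "evalm \<sigma> 0 = 1"
  by (simp add: evalm_def)

lemma evalm_single: "evalm \<sigma> (single v 1) = \<sigma> v"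
  by (simp add: evalm_def)

lemma poly_subst_const: "poly_subst \<sigma> (const c) = const c"
  unfolding poly_subst_linext const_def linext_single by (simp add: const_def)

lemma poly_subst_var: "poly_subst \<sigma> (var v) = \<sigma> v"
  unfolding poly_subst_linext var_def linext_single evalm_single by simp

lemma poly_subst_add: "poly_subst \<sigma> (f + g) = poly_subst \<sigma> f + poly_subst \<sigma> g"
  by (simp add: poly_subst_linext linext_add)

lemma poly_subst_mult: "poly_subst \<sigma> (f * g) = poly_subst \<sigma> f * poly_subst \<sigma> g"
  by (simp add: poly_subst_linext linext_mult evalm_add)

lemma poly_subst_sum: "poly_subst \<sigma> (sum f A) = (\<Sum>i\<in>A. poly_subst \<sigma> (f i))"
  by (simp add: poly_subst_linext linext_sum)

lemma pp_induct_single [case_names zero step]: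
  assumes "P (0 :: pp)" "\<And>v t. P t \<Longrightarrow> P (single v 1 + t)"
  shows "P t"
proof (induction "\<Sum>v\<in>keys t. lookup t v" arbitrary: t)
  case 0
  then have "t = 0" by (intro poly_mapping_eqI) (auto simp: in_keys_iff)
  then show ?case using assms by simp
next
  case (Suc k)
  have "\<exists>v. v \<in> keys t"
  proof (rule ccontr)
    assume "\<not> ?thesis"
    then have "keys t = {}" by blast
    then show False using Suc.hyps(2) by simp
  qed
  then obtain v where v: "v \<in> keys t" by blast
  then obtain t' where t': "t = single v 1 + t'" using pp_split[of t v] by (auto simp: in_keys_iff)
  have "(\<Sum>v\<in>keys t. lookup t v) = (\<Sum>u\<in>keys t. if u = v then 1 else 0) + (\<Sum>v\<in>keys t. lookup t' v)"
    by (simp add: t' lookup_add lookup_single when_def sum.distrib eq_commute)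
  also have "(\<Sum>v\<in>keys t. lookup t' v) = (\<Sum>v\<in>keys t'. lookup t' v)"
    by (intro sum.mono_neutral_right) (auto simp: t' keys_add_pp in_keys_iff)
  finally have "k = (\<Sum>v\<in>keys t'. lookup t' v)" using Suc.hyps(2) v by simp
  then show ?case using Suc.hyps(1) assms(2) t' by blast
qed

text \<open>This makes the substitution homogeneous for the multigrading; every element of the
  product of general linear groups acts in this way.\<close>

definition col_subst :: "nat \<Rightarrow> (nat \<Rightarrow> nat) \<Rightarrow> (nat \<times> nat \<Rightarrow> 'k::field mpoly) \<Rightarrow> bool" where
  "col_subst n m \<sigma> \<longleftrightarrow> (\<forall>v\<in>vars n m. keys (\<sigma> v) \<subseteq> {t \<in> pps n m. mdeg t = single (snd v) 1})"

lemma keys_evalm: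
  assumes "col_subst n m \<sigma>" "t \<in> pps n m"
  shows "keys (evalm \<sigma> t) \<subseteq> {s \<in> pps n m. mdeg s = mdeg t}"
  using assms(2)
proof (induction t rule: pp_induct_single)
  case (step v t)
  then have v: "v \<in> vars n m" "t \<in> pps n m" unfolding add_in_pps_iff by (auto simp: in_pps_iff)
  then have "keys (\<sigma> v * evalm \<sigma> t) \<subseteq> {a + b |a b. a \<in> {t \<in> pps n m. mdeg t = single (snd v) 1} \<and>
      b \<in> {s \<in> pps n m. mdeg s = mdeg t}}"
    using step.IH assms(1) by (intro keys_mult_subset) (auto simp: col_subst_def)
  then show ?case unfolding evalm_add evalm_single by (auto simp: mdeg_add mdeg_single plus_in_pps)
qed auto

lemma hom_part_sum: "hom_part a (sum f A) = (\<Sum>i\<in>A. hom_part a (f i))"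
  by (induction A rule: infinite_finite_induct) (auto simp: hom_part_add)

lemma poly_subst_hom_part:
  assumes \<sigma>: "col_subst n m \<sigma>" and f: "keys f \<subseteq> pps n m"
  shows "hom_part a (poly_subst \<sigma> f) = poly_subst \<sigma> (hom_part a f)"
proof -
  have "hom_part a (poly_subst \<sigma> f) = (\<Sum>t\<in>keys f. const (lookup f t) * hom_part a (evalm \<sigma> t))"
    unfolding poly_subst_linext linext_def by (simp add: hom_part_sum hom_part_scale)
  also have "\<dots> = (\<Sum>t\<in>keys f. const (lookup (hom_part a f) t) * evalm \<sigma> t)"
  proof (intro sum.cong refl)
    fix t assume "t \<in> keys f"
    then have "hom_part a (evalm \<sigma> t) = (if a = mdeg t then evalm \<sigma> t else 0)"
      using keys_evalm[OF \<sigma>, of t] f by (intro hom_part_homogeneous) auto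
    then show "const (lookup f t) * hom_part a (evalm \<sigma> t) = const (lookup (hom_part a f) t) * evalm \<sigma> t"
      by (auto simp: lookup_hom_part when_def)
  qed
  also have "\<dots> = poly_subst \<sigma> (hom_part a f)"
    unfolding poly_subst_linext by (rule linext_superset[symmetric]) (auto simp: keys_hom_part)
  finally show ?thesis .
qed

lemma poly_subst_in_carrier:
  assumes "col_subst n m \<sigma>" "keys f \<subseteq> pps n m"
  shows "keys (poly_subst \<sigma> f) \<subseteq> pps n m"
  unfolding poly_subst_linext linext_def
  using keys_evalm[OF assms(1)] assms(2) keys_const_mult_subset
  by (intro keys_sum_subset) blast

lemma monomial_add: "monomial (s + t) = monomial s * monomial t"
  by (simp add: monomial_def mult_single)

lemma monomial_single_eq_var: "monomial (single v 1) = var v"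
  by (simp add: monomial_def var_def)

text \<open>Surjectivity makes the image of an ideal an ideal; it is enough to reach the
  variables.\<close>

lemma poly_subst_surj:
  fixes \<sigma> :: "nat \<times> nat \<Rightarrow> 'k::field mpoly"
  assumes "\<And>v. v \<in> vars n m \<Longrightarrow> \<exists>f. keys f \<subseteq> pps n m \<and> poly_subst \<sigma> f = var v"
    and f: "keys f \<subseteq> pps n m"
  shows "\<exists>h. keys h \<subseteq> pps n m \<and> poly_subst \<sigma> h = f"
proof -
  have mon: "\<exists>h. keys h \<subseteq> pps n m \<and> poly_subst \<sigma> h = monomial t" if "t \<in> pps n m" for t
    using that
  proof (induction t rule: pp_induct_single)
    case zero
    show ?case
      by (intro exI[of _ "const 1"])
        (simp add: poly_subst_const[of \<sigma> 1, simplified] monomial_def)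
  next
    case (step v t)
    then have v: "v \<in> vars n m" "t \<in> pps n m" unfolding add_in_pps_iff by (auto simp: in_pps_iff)
    then obtain h1 h2 where h: "keys h1 \<subseteq> pps n m" "poly_subst \<sigma> h1 = var v"
      "keys h2 \<subseteq> pps n m" "poly_subst \<sigma> h2 = monomial t"
      using step.IH assms(1) by blast
    have "keys (h1 * h2) \<subseteq> {a + b |a b. a \<in> pps n m \<and> b \<in> pps n m}"
      using h by (intro keys_mult_subset)
    also have "\<dots> \<subseteq> pps n m" by (auto simp: plus_in_pps)
    finally have "keys (h1 * h2) \<subseteq> pps n m" .
    moreover have "poly_subst \<sigma> (h1 * h2) = monomial (single v 1 + t)"
      using h by (simp only: poly_subst_mult monomial_add monomial_single_eq_var)
    ultimately show ?case by blast
  qed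
  have "\<forall>t\<in>keys f. \<exists>h. keys h \<subseteq> pps n m \<and> poly_subst \<sigma> h = monomial t" using mon f by blast
  then obtain h where h: "\<And>t. t \<in> keys f \<Longrightarrow> keys (h t) \<subseteq> pps n m \<and> poly_subst \<sigma> (h t) = monomial t"
    by metis
  let ?h = "\<Sum>t\<in>keys f. const (lookup f t) * h t"
  have "keys ?h \<subseteq> pps n m"
    using h keys_const_mult_subset by (intro keys_sum_subset) blast
  moreover have "poly_subst \<sigma> ?h = (\<Sum>t\<in>keys f. const (lookup f t) * monomial t)"
    unfolding poly_subst_sum poly_subst_mult poly_subst_const using h by (intro sum.cong) auto
  then have "poly_subst \<sigma> ?h = f"
    by (simp add: poly_sum_single[symmetric] flip: single_eq_const_monomial)
  ultimately show ?thesis by blast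
qed


section \<open>Borel-fixed and radical ideals\<close>

definition gl_sub :: "(nat \<Rightarrow> nat) \<Rightarrow> (nat \<Rightarrow> 'k::field mat) \<Rightarrow> nat \<times> nat \<Rightarrow> 'k mpoly" where
  "gl_sub m g = (\<lambda>(i, j). \<Sum>k = 1..m j. const (g j $$ (k - 1, i - 1)) * var (k, j))"

lemma gl_act_subst: "gl_act m g = poly_subst (gl_sub m g)"
  by (simp add: gl_act_def gl_sub_def)

lemma keys_var: "keys (var v :: 'k::field mpoly) = {single v 1}"
  by (simp add: var_def)

lemma gl_sub_col: "col_subst n m (gl_sub m g)"
  unfolding col_subst_def
proof
  fix v assume v: "v \<in> vars n m"
  obtain i j where ij: "v = (i, j)" by (cases v)
  show "keys (gl_sub m g v) \<subseteq> {t \<in> pps n m. mdeg t = single (snd v) 1}"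
    unfolding ij gl_sub_def prod.case
  proof (intro keys_sum_subset subset_trans[OF keys_const_mult_subset])
    fix k assume "k \<in> {1..m j}"
    then have "(k, j) \<in> vars n m" using v ij by (auto simp: vars_def)
    then show "keys (var (k, j) :: 'a mpoly) \<subseteq> {t \<in> pps n m. mdeg t = single (snd (i, j)) 1}"
      by (simp add: keys_var mdeg_single[of "(k, j)" 1, simplified] single_in_pps)
  qed
qed

text \<open>The coefficients of a preimage of \<open>x_{ij}\<close> form the \<open>i\<close>-th
  column of the inverse matrix of \<open>g j\<close>.\<close>

lemma gl_sub_surj:
  fixes g :: "nat \<Rightarrow> 'k::field mat"
  assumes g: "g \<in> gl_group n m" and v: "v \<in> vars n m"
  shows "\<exists>f. keys f \<subseteq> pps n m \<and> poly_subst (gl_sub m g) f = var v"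
proof -
  obtain i j where ij: "v = (i, j)" "1 \<le> i" "i \<le> m j" "j \<in> {1..n}"
    using v by (cases v) (auto simp: vars_def)
  have gj: "g j \<in> carrier_mat (m j) (m j)" and "invertible_mat (g j)"
    using g ij(4) by (auto simp: gl_group_def)
  then obtain h where h: "g j * h = 1\<^sub>m (dim_row (g j))" "h * g j = 1\<^sub>m (dim_row h)"
    by (auto simp: invertible_mat_def inverts_mat_def)
  have dims: "dim_row h = m j" "dim_col h = m j"
    using arg_cong[OF h(1), of dim_col] arg_cong[OF h(2), of dim_col] gj by auto
  let ?f = "\<Sum>k = 1..m j. const (h $$ (k - 1, i - 1)) * var (k, j) :: 'k mpoly"
  \<comment> \<open>The candidate is a variable substituted by means of \<open>h\<close>, which
    settles its support.\<close>
  have "?f = gl_sub m (g(j := h)) v" by (simp add: gl_sub_def ij(1))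
  then have "keys ?f \<subseteq> pps n m"
    using gl_sub_col[of n m "g(j := h)"] v unfolding col_subst_def by auto
  moreover have "poly_subst (gl_sub m g) ?f = var v"
  proof -
    have "poly_subst (gl_sub m g) ?f =
      (\<Sum>k = 1..m j. const (h $$ (k - 1, i - 1)) * (\<Sum>l = 1..m j. const (g j $$ (l - 1, k - 1)) * var (l, j)))"
      unfolding poly_subst_sum poly_subst_mult poly_subst_const poly_subst_var by (simp add: gl_sub_def)
    also have "\<dots> = (\<Sum>l = 1..m j. (\<Sum>k = 1..m j. const (g j $$ (l - 1, k - 1) * h $$ (k - 1, i - 1))) * var (l, j))"
      unfolding sum_distrib_left sum_distrib_right
      by (subst sum.swap) (simp add: mult.commute[of "_ :: 'k"])
    also have "\<dots> = (\<Sum>l = 1..m j. (if l = i then 1 else 0) * var (l, j))"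
    proof (intro sum.cong refl arg_cong2[where f = "(*)"])
      fix l assume l: "l \<in> {1..m j}"
      have csum: "(\<Sum>k\<in>A. const (c k)) = const (\<Sum>k\<in>A. c k :: 'k)" for A :: "nat set" and c
        by (induction A rule: infinite_finite_induct) (auto simp: const_add)
      have "(\<Sum>k = 1..m j. g j $$ (l - 1, k - 1) * h $$ (k - 1, i - 1)) =
          (\<Sum>k<m j. g j $$ (l - 1, k) * h $$ (k, i - 1))"
        by (rule sum.reindex_bij_witness[of _ Suc "\<lambda>k. k - 1"]) auto
      also have "\<dots> = (g j * h) $$ (l - 1, i - 1)"
      proof -
        have "l - 1 < m j" "i - 1 < m j" using l ij by auto
        then show ?thesis
          using carrier_matD[OF gj] dims by (simp add: scalar_prod_def lessThan_atLeast0)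
      qed
      also have "\<dots> = (if l = i then 1 else 0)" using l ij gj h(1) by auto
      finally show "(\<Sum>k = 1..m j. const (g j $$ (l - 1, k - 1) * h $$ (k - 1, i - 1))) = (if l = i then 1 else (0 :: 'k mpoly))"
        by (simp add: csum)
    qed
    also have "\<dots> = var v"
    proof -
      have "(\<Sum>l = 1..m j. (if l = i then 1 else 0) * var (l, j)) = (\<Sum>l = 1..m j. if l = i then var (l, j) else (0 :: 'k mpoly))"
        by (intro sum.cong) auto
      then show ?thesis using ij by simp
    qed
    finally show ?thesis .
  qed
  ultimately show ?thesis by blast
qed

lemma vimage_ideal:
  assumes "col_subst n m \<sigma>" and I: "ideal (I :: 'k::field mpoly set) (poly_ring n m)"
  shows "ideal {f \<in> carrier (poly_ring n m). poly_subst \<sigma> f \<in> I} (poly_ring n m)"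
proof -
  interpret cring "poly_ring n m :: 'k mpoly ring" by (rule cring_poly_ring)
  have cl: "f + g \<in> carrier (poly_ring n m)" "f * g \<in> carrier (poly_ring n m)"
    if "f \<in> carrier (poly_ring n m)" "g \<in> carrier (poly_ring n m)" for f g :: "'k mpoly"
    using that a_closed[of f g] m_closed[of f g] by (simp_all add: poly_ring_simps)
  have sc: "poly_subst \<sigma> s \<in> carrier (poly_ring n m)" if "s \<in> carrier (poly_ring n m)" for s
    using that poly_subst_in_carrier[OF assms(1)] by (simp add: mem_carrier)
  show ?thesis
    unfolding ideal_iff
    using cl sc idealD[OF I]
    by (auto simp: poly_subst_add poly_subst_mult mem_carrier poly_subst_const[of \<sigma> 0, simplified])
qed

lemma image_ideal:
  fixes I :: "'k::field mpoly set"
  assumes "col_subst n m \<sigma>" and I: "ideal I (poly_ring n m)"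
    and surj: "\<And>f. keys f \<subseteq> pps n m \<Longrightarrow> \<exists>h. keys h \<subseteq> pps n m \<and> poly_subst \<sigma> h = f"
  shows "ideal (poly_subst \<sigma> ` I) (poly_ring n m)"
  unfolding ideal_iff
proof (intro conjI ballI)
  show "poly_subst \<sigma> ` I \<subseteq> carrier (poly_ring n m)"
    using poly_subst_in_carrier[OF assms(1)] idealD(1)[OF I] by (auto simp: mem_carrier)
  show "0 \<in> poly_subst \<sigma> ` I"
    using idealD(2)[OF I] poly_subst_const[of \<sigma> 0] by (metis const_zero imageI)
  show "f + g \<in> poly_subst \<sigma> ` I" if "f \<in> poly_subst \<sigma> ` I" "g \<in> poly_subst \<sigma> ` I" for f g
    using that idealD(3)[OF I] by (auto simp flip: poly_subst_add)
  show "s * f \<in> poly_subst \<sigma> ` I" if f: "f \<in> poly_subst \<sigma> ` I" and s: "s \<in> carrier (poly_ring n m)" for f s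
  proof -
    obtain h where "h \<in> carrier (poly_ring n m)" "poly_subst \<sigma> h = s"
      using surj s by (auto simp: mem_carrier)
    then show ?thesis using f idealD(4)[OF I] by (auto simp flip: poly_subst_mult)
  qed
qed

text \<open>A group element commutes with taking homogeneous parts, hence maps each component of
  \<open>B\<close> onto itself. Both the preimage and the image of the generated ideal are ideals
  containing the generators, which gives the two inclusions.\<close>

lemma borel_fixed_genideal:
  fixes B :: "'k::field mpoly set"
  assumes B: "graded_ideal n m B" and fixed: "borel_fixed n m B"
    and X: "X = (\<Union>A\<in>F. set_component B A)"
  shows "borel_fixed n m (Idl\<^bsub>poly_ring n m\<^esub> X)"
  unfolding borel_fixed_def
proof
  fix g :: "nat \<Rightarrow> 'k mat" assume g: "g \<in> borel_group n m"
  let ?\<sigma> = "gl_sub m g" and ?J = "Idl\<^bsub>poly_ring n m\<^esub> X"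
  have id: "ideal B (poly_ring n m)" using B by (simp add: graded_ideal_def)
  have Xc: "X \<subseteq> carrier (poly_ring n m)"
    using idealD(1)[OF id] by (auto simp: X set_component_def component_def mem_carrier)
  note J = genideal_poly_ideal[OF Xc]
  have gB: "poly_subst ?\<sigma> ` B = B" using fixed g by (auto simp: borel_fixed_def gl_act_subst)
  have gl: "g \<in> gl_group n m" using g by (simp add: borel_group_def)
  have surj: "\<exists>h. keys h \<subseteq> pps n m \<and> poly_subst ?\<sigma> h = f" if "keys f \<subseteq> pps n m" for f
    using gl_sub_surj[OF gl] that by (rule poly_subst_surj)
  have comp: "poly_subst ?\<sigma> ` component B a = component B a" for a
  proof -
    have "poly_subst ?\<sigma> ` hom_part a ` B = hom_part a ` poly_subst ?\<sigma> ` B"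
      unfolding image_image
      using poly_subst_hom_part[OF gl_sub_col idealD(1)[OF id], symmetric] by (intro image_cong) auto
    then show ?thesis by (simp add: gB component_eq[OF B])
  qed
  have gX: "poly_subst ?\<sigma> ` X = X" by (simp add: X image_UN set_component_def comp)
  show "gl_act m g ` ?J = ?J"
    unfolding gl_act_subst
  proof
    have "?J \<subseteq> {f \<in> carrier (poly_ring n m). poly_subst ?\<sigma> f \<in> ?J}"
      using gX genideal_superset[OF Xc] Xc
      by (intro genideal_least vimage_ideal[OF gl_sub_col J]) auto
    then show "poly_subst ?\<sigma> ` ?J \<subseteq> ?J" by auto
    show "?J \<subseteq> poly_subst ?\<sigma> ` ?J"
      using gX genideal_superset[OF Xc]
      by (intro genideal_least image_ideal[OF gl_sub_col J surj]) auto
  qed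
qed

definition rad_pp :: "pp \<Rightarrow> pp" where
  "rad_pp w = (\<Sum>v\<in>keys w. single v 1)"

lemma lookup_rad_pp: "lookup (rad_pp w) v = (if v \<in> keys w then 1 else 0)"
  by (simp add: rad_pp_def lookup_sum lookup_single when_def)

lemma keys_rad_pp [simp]: "keys (rad_pp w) = keys w"
  by (auto simp: in_keys_iff[of _ "rad_pp w"] lookup_rad_pp split: if_splits)

lemma monomial_power: "\<exists>u. monomial s ^ k = (monomial u :: 'k::field mpoly) \<and> (\<forall>v. lookup u v = k * lookup s v)"
proof (induction k)
  case 0
  show ?case by (intro exI[of _ 0]) (simp add: monomial_def)
next
  case (Suc k)
  then obtain u where "monomial s ^ k = (monomial u :: 'k mpoly)" "\<And>v. lookup u v = k * lookup s v" by blast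
  then show ?case by (intro exI[of _ "s + u"]) (simp add: monomial_add lookup_add)
qed

lemma monomial_in_kspan: "monomial t \<in> (kspan M :: 'k::field mpoly set) \<longleftrightarrow> t \<in> M"
  by (simp add: kspan_def monomial_def)

lemma squarefree_closed_radical:
  assumes M: "mon_ideal n m M" and rad: "radical_ideal n m (kspan M :: 'k::field mpoly set)"
  shows "squarefree_closed M"
  unfolding squarefree_closed_def
proof
  fix w assume w: "w \<in> M"
  \<comment> \<open>Any number dominating all exponents of \<open>w\<close> makes this power of its
    radical a multiple of \<open>w\<close>; their sum does.\<close>
  let ?k = "\<Sum>v\<in>keys w. lookup w v"
  have wp: "w \<in> pps n m" using w mon_ideal_subset[OF M] by blast
  then have rp: "rad_pp w \<in> pps n m" by (simp add: in_pps_iff)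
  obtain u where u: "monomial (rad_pp w) ^ ?k = (monomial u :: 'k mpoly)"
    "\<And>v. lookup u v = ?k * lookup (rad_pp w) v"
    using monomial_power by blast
  have "lookup w v \<le> lookup u v" for v
    by (cases "v \<in> keys w") (auto simp: u(2) lookup_rad_pp in_keys_iff intro!: member_le_sum)
  then obtain z where z: "u = w + z" using pp_splitI by blast
  have "u \<in> pps n m" unfolding in_pps_iff
    using rp u(2) by (auto simp: in_pps_iff in_keys_iff lookup_rad_pp split: if_splits)
  then have "u \<in> M" using w mon_ideal_add[OF M] z by (auto simp: add_in_pps_iff)
  then have "monomial (rad_pp w) ^ ?k \<in> (kspan M :: 'k mpoly set)"
    by (simp add: u(1) monomial_in_kspan)
  then have "(monomial (rad_pp w) :: 'k mpoly) \<in> {f \<in> carrier (poly_ring n m). \<exists>k. f ^ k \<in> kspan M}"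
    using rp by (simp only: mem_Collect_eq monomial_in_carrier) blast
  then have "(monomial (rad_pp w) :: 'k mpoly) \<in> kspan M"
    using rad by (simp only: radical_ideal_def)
  then show "(\<Sum>v\<in>keys w. single v 1) \<in> M" by (simp add: monomial_in_kspan rad_pp_def)
qed

text \<open>In the radical of the given power product \<open>x_{ij}\<close> occurs to the first
  power only, so a transvection adding \<open>x_{kj}\<close> to \<open>x_{ij}\<close> produces just
  two terms, both with coefficient 1. A higher power would bring in binomial coefficients, which can
  vanish in positive characteristic.\<close>

lemma strongly_stable_borel:
  assumes M: "mon_ideal n m M" and sf: "squarefree_closed M"
    and fixed: "borel_fixed n m (kspan M :: 'k::field mpoly set)"
  shows "strongly_stable M"
  unfolding strongly_stable_def
proof (intro allI impI)
  fix w :: pp and i k j :: nat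
  let ?x = "single (i, j) 1 + w"
  assume x: "?x \<in> M" and k: "1 \<le> k" "k < i"
  have xp: "?x \<in> pps n m" using x mon_ideal_subset[OF M] by blast
  then have v: "(i, j) \<in> vars n m" "(k, j) \<in> vars n m" and wp: "w \<in> pps n m"
    using k by (auto simp: in_pps_iff keys_add_pp vars_def)
  let ?s = "rad_pp ?x"
  have s: "?s \<in> M" using sf x by (simp add: squarefree_closed_def rad_pp_def)
  obtain s' where s': "?s = single (i, j) 1 + s'"
    using pp_split[of ?s "(i, j)"] by (auto simp: lookup_rad_pp keys_add_pp)
  have ls': "lookup s' v = (if v \<in> keys w \<and> v \<noteq> (i, j) then 1 else 0)" for v
    using arg_cong[OF s', of "\<lambda>t. lookup t v"]
    by (auto simp: lookup_rad_pp lookup_add lookup_single when_def keys_add_pp split: if_splits)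
  have "lookup s' v \<le> lookup w v" for v by (auto simp: ls' in_keys_iff)
  then obtain w' where w': "w = s' + w'" using pp_splitI by blast
  then have sp: "s' \<in> pps n m" "w' \<in> pps n m" using wp by (auto simp: add_in_pps_iff)
  (* x_{ij} is mapped to x_{ij} + x_{kj}, every other variable to itself *)
  define g :: "nat \<Rightarrow> 'k mat" where
    "g = (\<lambda>j'. if j' = j then addrow_mat (m j) 1 (k - 1) (i - 1) else 1\<^sub>m (m j'))"
  have lt: "k - 1 < i - 1" "i - 1 < m j" "k - 1 < m j" using k v by (auto simp: vars_def)
  have "invertible_mat (g j')" for j'
  proof (cases "j' = j")
    case True
    have "inverts_mat (g j) (addrow_mat (m j) (-1) (k - 1) (i - 1))"
      "inverts_mat (addrow_mat (m j) (-1) (k - 1) (i - 1)) (g j)"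
      using addrow_mat_inv[of "k - 1" "m j" "i - 1" 1] addrow_mat_inv[of "k - 1" "m j" "i - 1" "-1"] lt
      by (simp_all add: inverts_mat_def g_def)
    then show ?thesis using True unfolding invertible_mat_def by (auto simp: g_def)
  next
    case False
    then show ?thesis unfolding invertible_mat_def inverts_mat_def
      by (auto simp: g_def intro!: exI[of _ "1\<^sub>m (m j')"])
  qed
  moreover have "g j' \<in> carrier_mat (m j') (m j')" for j' by (simp add: g_def)
  moreover have "upper_triangular (g j')" for j' using lt by (auto simp: g_def)
  ultimately have "g \<in> borel_group n m" by (auto simp: borel_group_def gl_group_def)
  then have im: "poly_subst (gl_sub m g) f \<in> kspan M" if "f \<in> kspan M" for f
    using fixed that unfolding borel_fixed_def gl_act_subst by blast
  have gl1: "gl_sub m g u = var u" if "u \<in> vars n m" "u \<noteq> (i, j)" for u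
  proof -
    obtain a b where u: "u = (a, b)" by (cases u)
    have ab: "1 \<le> a" "a \<le> m b" using that u by (auto simp: vars_def)
    have "gl_sub m g u = (\<Sum>l = 1..m b. if l = a then var (l, b) else 0)"
      unfolding u gl_sub_def prod.case
    proof (intro sum.cong refl)
      fix l assume l: "l \<in> {1..m b}"
      have "g b $$ (l - 1, a - 1) = (if l = a then 1 else 0)"
      proof -
        have "l - 1 = a - 1 \<longleftrightarrow> l = a" using l ab by auto
        moreover have "a - 1 \<noteq> i - 1" if "b = j"
          using that ab \<open>u \<noteq> (i, j)\<close> u k by auto
        ultimately show ?thesis using l ab by (auto simp: g_def)
      qed
      then show "const (g b $$ (l - 1, a - 1)) * var (l, b) = (if l = a then var (l, b) else 0)" by simp
    qed
    then show ?thesis using ab u by simp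
  qed
  have gl2: "gl_sub m g (i, j) = var (i, j) + var (k, j)"
  proof -
    have "gl_sub m g (i, j) = (\<Sum>l = 1..m j. (if l = i then var (l, j) else 0) + (if l = k then var (l, j) else 0))"
      unfolding gl_sub_def prod.case
    proof (intro sum.cong refl)
      fix l assume l: "l \<in> {1..m j}"
      have "l - 1 = i - 1 \<longleftrightarrow> l = i" "k - 1 = l - 1 \<longleftrightarrow> l = k" using l k by auto
      then show "const (g j $$ (l - 1, i - 1)) * var (l, j) =
          (if l = i then var (l, j) else 0) + (if l = k then var (l, j) else 0)"
        using l lt k by (auto simp: g_def)
    qed
    then show ?thesis using lt k by (simp add: sum.distrib)
  qed
  have "poly_subst (gl_sub m g) (monomial ?s) = (var (i, j) + var (k, j)) * evalm (gl_sub m g) s'"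
    unfolding poly_subst_linext linext_monomial s' evalm_add evalm_single gl2 ..
  also have "evalm (gl_sub m g) s' = evalm var s'"
    unfolding evalm_def
  proof (intro prod.cong refl)
    fix u assume "u \<in> keys s'"
    then have "u \<in> vars n m" "u \<noteq> (i, j)" using sp by (auto simp: in_pps_iff in_keys_iff ls')
    then show "gl_sub m g u ^ lookup s' u = var u ^ lookup s' u" by (simp add: gl1)
  qed
  also have "evalm var s' = (monomial s' :: 'k mpoly)"
    by (induction s' rule: pp_induct_single)
      (simp_all only: evalm_zero evalm_add evalm_single monomial_add monomial_single_eq_var, simp add: monomial_def)
  finally have "(var (i, j) + var (k, j)) * monomial s' \<in> (kspan M :: 'k mpoly set)"
    using im[of "monomial ?s"] s by (simp add: monomial_in_kspan)
  moreover have "(var (i, j) + var (k, j)) * monomial s' =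
      monomial (single (i, j) 1 + s') + (monomial (single (k, j) 1 + s') :: 'k mpoly)"
    by (simp only: distrib_right monomial_add monomial_single_eq_var)
  moreover have "single (k, j) 1 + s' \<noteq> single (i, j) 1 + s'" using k by (auto dest: arg_cong[of _ _ keys])
  then have "single (k, j) 1 + s' \<in> keys (monomial (single (i, j) 1 + s') + (monomial (single (k, j) 1 + s') :: 'k mpoly))"
    by (auto simp: in_keys_iff lookup_add monomial_def lookup_single when_def)
  ultimately have "single (k, j) 1 + s' \<in> M" by (auto simp: kspan_def)
  then have "(single (k, j) 1 + s') + w' \<in> M" using sp mon_ideal_add[OF M] by blast
  then show "single (k, j) 1 + w \<in> M" by (simp add: w' add.assoc)
qed

section \<open>Leading terms of powers, and radicality of squarefree monomial ideals\<close>

lemma lead_mult: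
  fixes f g :: "'k::field mpoly"
  assumes ord: "term_order n m r" and f: "f \<noteq> 0" "keys f \<subseteq> pps n m" and g: "g \<noteq> 0" "keys g \<subseteq> pps n m"
  shows "lookup (f * g) (lead_pp r f + lead_pp r g) = lookup f (lead_pp r f) * lookup g (lead_pp r g)"
proof -
  let ?a = "lead_pp r f" and ?b = "lead_pp r g"
  note lf = lead_props[OF ord f] and lg = lead_props[OF ord g]
  have *: "s = ?a" "t = ?b" if "s \<in> keys f" "t \<in> keys g" "s + t = ?a + ?b" for s t
  proof -
    have "(s + t, ?a + t) \<in> r" "(t + ?a, ?b + ?a) \<in> r"
      using ord_add[OF ord lf(2)[OF that(1)], of t] ord_add[OF ord lg(2)[OF that(2)], of ?a]
        that(2) lf(1) f(2) g(2) by blast+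
    then have "?a + t = ?a + ?b"
      using that(3) ord_antisym[OF ord] by (simp add: add.commute)
    then show "t = ?b" by simp
    then show "s = ?a" using that(3) by simp
  qed
  have "f * g = (\<Sum>s\<in>keys f. single s (lookup f s) * g)"
    by (subst poly_sum_single[of f]) (simp add: sum_distrib_right)
  then have "lookup (f * g) (?a + ?b) =
      (\<Sum>s\<in>keys f. \<Sum>t\<in>keys g. lookup f s * lookup g t when s + t = ?a + ?b)"
    by (simp add: lookup_sum lookup_single_mult)
  also have "\<dots> = (\<Sum>s\<in>keys f. \<Sum>t\<in>keys g. if t = ?b then (if s = ?a then lookup f s * lookup g t else 0) else 0)"
    using * by (intro sum.cong refl) (auto simp: when_def)
  also have "\<dots> = lookup f ?a * lookup g ?b"
    using lf(1) lg(1) by simp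
  finally show ?thesis .
qed

lemma keys_power_subset: "keys f \<subseteq> pps n m \<Longrightarrow> keys (f ^ k :: 'k::field mpoly) \<subseteq> pps n m"
proof (induction k)
  case (Suc k)
  then have "keys (f * f ^ k) \<subseteq> {a + b |a b. a \<in> pps n m \<and> b \<in> pps n m}"
    by (intro keys_mult_subset)
  also have "\<dots> \<subseteq> pps n m" by (auto simp: plus_in_pps)
  finally show ?case by simp
qed simp

text \<open>Leading terms multiply without cancellation. The exponents are given pointwise because
  this is how divisibility is tested later.\<close>

lemma power_lead_in_keys:
  fixes f :: "'k::field mpoly"
  assumes ord: "term_order n m r" and f: "f \<noteq> 0" "keys f \<subseteq> pps n m"
  shows "\<exists>u\<in>keys (f ^ k). \<forall>v. lookup u v = k * lookup (lead_pp r f) v"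
proof -
  let ?a = "lead_pp r f"
  have "f ^ k \<noteq> 0 \<and> (\<forall>v. lookup (lead_pp r (f ^ k)) v = k * lookup ?a v)"
  proof (induction k)
    case 0
    have "lead_pp r (1 :: 'k mpoly) = 0" by (rule lead_eqI[OF ord]) (auto intro: ord_refl[OF ord])
    then show ?case by simp
  next
    case (Suc k)
    note p = keys_power_subset[OF f(2), of k]
    let ?b = "lead_pp r (f ^ k)"
    have "?a + ?b \<in> keys (f * f ^ k)"
      using lead_mult[OF ord f _ p] Suc lead_props(1)[OF ord f] lead_props(1)[OF ord _ p]
      by (simp add: in_keys_iff)
    moreover have "(s, ?a + ?b) \<in> r" if s: "s \<in> keys (f * f ^ k)" for s
    proof -
      obtain a b where ab: "a \<in> keys f" "b \<in> keys (f ^ k)" "s = a + b"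
        using s keys_mult[of f "f ^ k"] by blast
      have "(a + b, ?a + b) \<in> r" "(b + ?a, ?b + ?a) \<in> r"
        using ord_add[OF ord lead_props(2)[OF ord f ab(1)], of b]
          ord_add[OF ord lead_props(2)[OF ord _ p ab(2)], of ?a]
          lead_props(1)[OF ord f] ab(2) Suc f p by blast+
      then show ?thesis using ord_trans[OF ord] ab(3) by (simp add: add.commute)
    qed
    ultimately have "lead_pp r (f * f ^ k) = ?a + ?b" by (intro lead_eqI[OF ord])
    moreover have "f * f ^ k \<noteq> 0" using \<open>?a + ?b \<in> keys (f * f ^ k)\<close> by auto
    ultimately show ?case using Suc by (simp add: lookup_add)
  qed
  then show ?thesis using lead_props(1)[OF ord _ keys_power_subset[OF f(2)]] by blast
qed

text \<open>First discard the terms of \<open>f\<close> that lie in the ideal. If something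
  remained, with leading term \<open>b\<close>, then \<open>b^k\<close> would be divisible by a
  squarefree generator; that generator would divide \<open>b\<close> itself, and \<open>b\<close>
  would have been discarded.\<close>

lemma radical_squarefree_gen:
  assumes T: "T \<subseteq> pps n m" and sf: "\<And>t v. t \<in> T \<Longrightarrow> lookup t v \<le> 1"
  shows "radical_ideal n m (kspan (pp_gen n m T) :: 'k::field mpoly set)"
  unfolding radical_ideal_def
proof (intro conjI equalityI subsetI)
  let ?Q = "pp_gen n m T"
  let ?I = "kspan ?Q :: 'k mpoly set"
  have Q: "mon_ideal n m ?Q" by (rule pp_gen_mon_ideal[OF T])
  show I: "ideal ?I (poly_ring n m)" by (rule kspan_ideal[OF Q])
  show "f \<in> {f \<in> carrier (poly_ring n m). \<exists>k. f ^ k \<in> ?I}" if "f \<in> ?I" for f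
    using that idealD(1)[OF I that] by (auto simp: mem_carrier intro!: exI[of _ 1])
  fix f :: "'k mpoly" assume "f \<in> {f \<in> carrier (poly_ring n m). \<exists>k. f ^ k \<in> ?I}"
  then obtain k where f: "keys f \<subseteq> pps n m" "f ^ k \<in> ?I" by (auto simp: mem_carrier)
  obtain r where ord: "term_order n m r" using term_order_exists by blast
  define h where "h = (\<Sum>t\<in>keys f - ?Q. single t (lookup f t))"
  have h: "lookup h t = (if t \<in> ?Q then 0 else lookup f t)" for t
    by (auto simp: h_def lookup_sum lookup_single when_def in_keys_iff)
  have hk: "keys h \<subseteq> pps n m" using f(1) by (auto simp: in_keys_iff h split: if_splits)
  have d: "f - h \<in> ?I" by (auto simp: kspan_def in_keys_iff lookup_minus h split: if_splits)
  have "f ^ l - h ^ l \<in> ?I" for l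
  proof (induction l)
    case 0
    show ?case using idealD(2)[OF I] by simp
  next
    case (Suc l)
    have "f * (f ^ l - h ^ l) + h ^ l * (f - h) \<in> ?I"
      using Suc d f(1) keys_power_subset[OF hk] by (intro idealD(3,4)[OF I]) (auto simp: mem_carrier)
    then show ?case by (simp add: algebra_simps)
  qed
  then have hI: "h ^ k \<in> ?I" using ideal_diff[OF I f(2), of "f ^ k - h ^ k"] by simp
  have "h = 0"
  proof (rule ccontr)
    assume h0: "h \<noteq> 0"
    let ?b = "lead_pp r h"
    obtain u where u: "u \<in> keys (h ^ k)" "\<And>v. lookup u v = k * lookup ?b v"
      using power_lead_in_keys[OF ord h0 hk] by blast
    then have "u \<in> ?Q" using hI by (auto simp: kspan_def)
    then obtain t z where t: "t \<in> T" "u = t + z" by (auto simp: pp_gen_def)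
    have "lookup t v \<le> lookup ?b v" for v
    proof (cases "lookup ?b v = 0")
      case True
      then have "lookup u v = 0" by (simp add: u(2))
      then show ?thesis using t(2) by (simp add: lookup_add)
    next
      case False
      then show ?thesis using sf[OF t(1), of v] by linarith
    qed
    then obtain z' where z': "?b = t + z'" using pp_splitI by blast
    have b: "?b \<in> keys h" by (rule lead_props(1)[OF ord h0 hk])
    then have "z' \<in> pps n m" using hk z' add_in_pps_iff by (metis subsetD)
    then have "?b \<in> ?Q" using t(1) z' by (auto simp: pp_gen_def)
    then show False using b by (simp add: in_keys_iff h)
  qed
  then show "f \<in> ?I" using d by simp
qed


section \<open>Normal forms\<close>

lemma sum_monomial_diff:
  "(\<Sum>t\<in>keys q. const (lookup q t) * (monomial t - P t)) = q - linext P q" for q :: "'k::field mpoly"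
proof -
  have "(\<Sum>t\<in>keys q. const (lookup q t) * monomial t) = q"
    by (simp only: single_eq_const_monomial[symmetric] poly_sum_single[symmetric])
  then show ?thesis by (simp only: right_diff_distrib sum_subtractf linext_def)
qed

text \<open>Reduction never leaves the multidegree of \<open>s\<close>; the number of power products
  up to \<open>s\<close> in this degree is finite and drops with every step.\<close>

lemma normal_form_exists:
  fixes I :: "'k::field mpoly set"
  assumes ord: "term_order n m r" and I: "graded_ideal n m I" and s: "s \<in> pps n m"
  shows "\<exists>p. monomial s - p \<in> I \<and> keys p \<subseteq> {t \<in> pps n m. (t, s) \<in> r} - leads r I \<and>
    (s \<notin> leads r I \<longrightarrow> p = monomial s)"
  using s
proof (induction "card {t \<in> pps n m. mdeg t = mdeg s \<and> (t, s) \<in> r}" arbitrary: s rule: less_induct)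
  case less
  have id: "ideal I (poly_ring n m)" using I by (simp add: graded_ideal_def)
  show ?case
  proof (cases "s \<in> leads r I")
    case False
    then show ?thesis using idealD(2)[OF id] less.prems ord_refl[OF ord]
      by (intro exI[of _ "monomial s"]) (auto simp: monomial_def)
  next
    case True
    \<comment> \<open>A homogeneous element with leading term \<open>s\<close> is chosen, so that
      the remainder stays in the same degree.\<close>
    then have "s \<in> leads r (component I (mdeg s))" by (simp add: leads_component[OF ord I] degp_def)
    then obtain f where f: "f \<in> I" "f \<noteq> 0" "s = lead_pp r f" "\<And>t. t \<in> keys f \<Longrightarrow> mdeg t = mdeg s"
      by (auto simp: leads_def component_def)
    note fk = idealD(1)[OF id f(1)]
    note l = lead_props[OF ord f(2) fk, folded f(3)]
    define c where "c = 1 / lookup f s"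
    define q where "q = monomial s - const c * f"
    have qs: "lookup q s = 0" using l(1) by (simp add: q_def c_def lookup_minus monomial_def in_keys_iff)
    have q: "t \<in> pps n m \<and> mdeg t = mdeg s \<and> (t, s) \<in> r \<and> t \<noteq> s" if t: "t \<in> keys q" for t
    proof -
      have "t \<noteq> s" using t qs by (auto simp: in_keys_iff)
      then have "t \<in> keys f"
        using t by (auto simp: q_def in_keys_iff lookup_minus monomial_def lookup_single when_def)
      then show ?thesis using l(2) f(4) fk \<open>t \<noteq> s\<close> by auto
    qed
    have "\<forall>t\<in>keys q. \<exists>p. monomial t - p \<in> I \<and> keys p \<subseteq> {u \<in> pps n m. (u, t) \<in> r} - leads r I"
    proof
      fix t assume t: "t \<in> keys q"
      have "{u \<in> pps n m. mdeg u = mdeg t \<and> (u, t) \<in> r} \<subset> {u \<in> pps n m. mdeg u = mdeg s \<and> (u, s) \<in> r}"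
      proof (rule psubsetI)
        show "{u \<in> pps n m. mdeg u = mdeg t \<and> (u, t) \<in> r} \<subseteq> {u \<in> pps n m. mdeg u = mdeg s \<and> (u, s) \<in> r}"
          using q[OF t] ord_trans[OF ord] by auto
        have "s \<in> {u \<in> pps n m. mdeg u = mdeg s \<and> (u, s) \<in> r}" using less.prems ord_refl[OF ord] by simp
        moreover have "s \<notin> {u \<in> pps n m. mdeg u = mdeg t \<and> (u, t) \<in> r}"
          using q[OF t] ord_antisym[OF ord] by auto
        ultimately show "{u \<in> pps n m. mdeg u = mdeg t \<and> (u, t) \<in> r} \<noteq> {u \<in> pps n m. mdeg u = mdeg s \<and> (u, s) \<in> r}"
          by blast
      qed
      then have "card {u \<in> pps n m. mdeg u = mdeg t \<and> (u, t) \<in> r} < card {u \<in> pps n m. mdeg u = mdeg s \<and> (u, s) \<in> r}"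
        by (intro psubset_card_mono finite_subset[OF _ finite_degree[of n m "mdeg s"]]) auto
      then show "\<exists>p. monomial t - p \<in> I \<and> keys p \<subseteq> {u \<in> pps n m. (u, t) \<in> r} - leads r I"
        using less.hyps[of t] q[OF t] by blast
    qed
    from bchoice[OF this] obtain P where P: "\<And>t. t \<in> keys q \<Longrightarrow> monomial t - P t \<in> I"
      "\<And>t. t \<in> keys q \<Longrightarrow> keys (P t) \<subseteq> {u \<in> pps n m. (u, t) \<in> r} - leads r I"
      by blast
    have "const c * f + (\<Sum>t\<in>keys q. const (lookup q t) * (monomial t - P t)) \<in> I"
      using f(1) P(1) by (intro idealD(3)[OF id] ideal_sum[OF id] idealD(5)[OF id])
    moreover have "(\<Sum>t\<in>keys q. const (lookup q t) * (monomial t - P t)) = q - linext P q"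
      by (rule sum_monomial_diff)
    ultimately have "monomial s - linext P q \<in> I" by (simp add: q_def)
    moreover have "keys (linext P q) \<subseteq> {t \<in> pps n m. (t, s) \<in> r} - leads r I"
      unfolding linext_def
    proof (intro keys_sum_subset subset_trans[OF keys_const_mult_subset])
      fix t assume t: "t \<in> keys q"
      show "keys (P t) \<subseteq> {t \<in> pps n m. (t, s) \<in> r} - leads r I"
        using P(2)[OF t] q[OF t] ord_trans[OF ord] by blast
    qed
    ultimately show ?thesis using True by blast
  qed
qed

text \<open>The map is chosen on power products only. Its linear extension vanishes on
  \<open>I\<close>, because a nonzero value would be an element of \<open>I\<close> none of whose
  terms is a leading term of \<open>I\<close>.\<close>

lemma normal_form_map:
  fixes I :: "'k::field mpoly set"
  assumes ord: "term_order n m r" and I: "graded_ideal n m I"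
  shows "\<exists>nf. (\<forall>s\<in>pps n m. keys (nf s) \<subseteq> {t \<in> pps n m. (t, s) \<in> r}) \<and>
    (\<forall>s\<in>pps n m. s \<notin> leads r I \<longrightarrow> nf s = monomial s) \<and> (\<forall>h\<in>I. linext nf h = 0)"
proof -
  have id: "ideal I (poly_ring n m)" using I by (simp add: graded_ideal_def)
  have "\<forall>s\<in>pps n m. \<exists>p. monomial s - p \<in> I \<and> keys p \<subseteq> {t \<in> pps n m. (t, s) \<in> r} - leads r I \<and>
    (s \<notin> leads r I \<longrightarrow> p = monomial s)"
    using normal_form_exists[OF ord I] by blast
  from bchoice[OF this] obtain nf where nf: "\<And>s. s \<in> pps n m \<Longrightarrow> monomial s - nf s \<in> I"
    "\<And>s. s \<in> pps n m \<Longrightarrow> keys (nf s) \<subseteq> {t \<in> pps n m. (t, s) \<in> r} - leads r I"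
    "\<And>s. s \<in> pps n m \<Longrightarrow> s \<notin> leads r I \<Longrightarrow> nf s = monomial s"
    by blast
  have "linext nf h = 0" if h: "h \<in> I" for h
  proof (rule ccontr)
    assume nz: "linext nf h \<noteq> 0"
    note hk = idealD(1)[OF id h]
    have k: "keys (linext nf h) \<subseteq> pps n m - leads r I"
      unfolding linext_def
      using hk nf(2) by (intro keys_sum_subset subset_trans[OF keys_const_mult_subset]) blast
    have "(\<Sum>t\<in>keys h. const (lookup h t) * (monomial t - nf t)) \<in> I"
      using nf(1) hk by (intro ideal_sum[OF id] idealD(5)[OF id]) auto
    moreover have "(\<Sum>t\<in>keys h. const (lookup h t) * (monomial t - nf t)) = h - linext nf h"
      by (rule sum_monomial_diff)
    ultimately have "linext nf h \<in> I" using ideal_diff[OF id h, of "h - linext nf h"] by simp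
    then have "lead_pp r (linext nf h) \<in> leads r I" using nz by (auto simp: leads_def)
    moreover have "lead_pp r (linext nf h) \<in> keys (linext nf h)"
      using k by (intro lead_props(1)[OF ord nz]) auto
    ultimately show False using k by blast
  qed
  then show ?thesis using nf by (intro exI[of _ nf]) blast
qed


section \<open>Splitting the columns into blocks\<close>

definition restr :: "nat set \<Rightarrow> pp \<Rightarrow> pp" where
  "restr A w = Poly_Mapping.mapp (\<lambda>v x. if snd v \<in> A then x else 0) w"

lemma lookup_restr: "lookup (restr A w) v = (if snd v \<in> A then lookup w v else 0)"
  by (auto simp: restr_def lookup_mapp when_def in_keys_iff)

lemma keys_restr: "keys (restr A w) = {v \<in> keys w. snd v \<in> A}"
  by (auto simp: in_keys_iff lookup_restr split: if_splits)

lemma restr_in_pps: "w \<in> pps n m \<Longrightarrow> restr A w \<in> pps n m"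
  by (auto simp: in_pps_iff keys_restr)

lemma restr_add: "restr A (s + t) = restr A s + restr A t"
  by (intro poly_mapping_eqI) (simp add: lookup_restr lookup_add)

lemma restr_sum: "restr A (sum f X) = (\<Sum>x\<in>X. restr A (f x))"
  by (intro poly_mapping_eqI) (simp add: lookup_restr lookup_sum)

lemma restr_id: "snd ` keys w \<subseteq> A \<Longrightarrow> restr A w = w"
  by (intro poly_mapping_eqI) (force simp: lookup_restr in_keys_iff)

lemma restr_disjoint: "snd ` keys w \<inter> A = {} \<Longrightarrow> restr A w = 0"
  by (intro poly_mapping_eqI) (force simp: lookup_restr in_keys_iff)

lemma restr_split: "w = restr A w + restr (- A) w"
  by (intro poly_mapping_eqI) (simp add: lookup_restr lookup_add)

lemma restr_decomp:
  assumes "finite \<A>" "pairwise disjnt \<A>"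
  shows "w = (\<Sum>A\<in>\<A>. restr A w) + restr (- \<Union>\<A>) w"
  using assms
proof (induction \<A>)
  case empty
  show ?case by (simp add: restr_id)
next
  case (insert A \<A>)
  have "restr (- \<Union>\<A>) w = restr A w + restr (- \<Union>(insert A \<A>)) w"
    using insert by (intro poly_mapping_eqI)
      (auto simp: lookup_restr lookup_add pairwise_insert disjnt_def)
  then show ?case using insert by (simp add: pairwise_insert add.assoc add.left_commute)
qed

section \<open>Membership and counting by blocks\<close>

definition blocks :: "nat set set \<Rightarrow> nat set \<Rightarrow> nat set set" where
  "blocks F C = {A \<in> F. A \<subseteq> C \<and> (\<forall>B\<in>F. A \<subseteq> B \<longrightarrow> B \<subseteq> C \<longrightarrow> B = A)}"

lemma blocks_finite: "finite C \<Longrightarrow> finite (blocks F C)"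
  by (rule finite_subset[of _ "Pow C"]) (auto simp: blocks_def)

text \<open>Two blocks that meet have their union in \<open>F\<close> and inside \<open>C\<close>,
  so by maximality both are equal to it.\<close>

lemma blocks_disjoint:
  assumes "\<forall>A\<in>F. \<forall>B\<in>F. A \<inter> B \<noteq> {} \<longrightarrow> A \<union> B \<in> F"
  shows "pairwise disjnt (blocks F C)"
proof (rule pairwiseI)
  fix A B assume AB: "A \<in> blocks F C" "B \<in> blocks F C" "A \<noteq> B"
  show "disjnt A B"
  proof (rule ccontr)
    assume "\<not> disjnt A B"
    then have "A \<union> B \<in> F" using assms AB by (auto simp: disjnt_def blocks_def)
    then have "A \<union> B = A" "A \<union> B = B" using AB by (auto simp: blocks_def)
    then show False using AB by auto
  qed
qed

lemma blocks_cover: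
  assumes "finite C" "A \<in> F" "A \<subseteq> C"
  shows "\<exists>B\<in>blocks F C. A \<subseteq> B"
proof -
  let ?S = "{B \<in> F. A \<subseteq> B \<and> B \<subseteq> C}"
  have fin: "finite ?S" by (rule finite_subset[of _ "Pow C"]) (use assms in auto)
  have mem: "A \<in> ?S" using assms by auto
  obtain B where "B \<in> ?S" "\<forall>B'\<in>?S. B \<subseteq> B' \<longrightarrow> B = B'"
    using finite_has_maximal2[OF fin mem] by blast
  then show ?thesis by (intro bexI[of _ B]) (auto simp: blocks_def)
qed

definition family_gen :: "nat \<Rightarrow> (nat \<Rightarrow> nat) \<Rightarrow> nat set set \<Rightarrow> pp set \<Rightarrow> pp set" where
  "family_gen n m F L = pp_gen n m (\<Union>A\<in>F. degp L (sqdeg A))"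

text \<open>Everything is decided by column supports. A generator of degree \<open>sqdeg A\<close>
  dividing \<open>w\<close> lives in the block around \<open>A\<close>. Conversely, the part of
  \<open>w\<close> in a block has exactly this block as column support, so squarefree generation
  supplies a divisor in the right degree.\<close>

lemma mem_family_gen_iff:
  assumes L: "mon_ideal n m L" "multilinear_generated L" and F: "F \<subseteq> Pow {1..n}" and w: "w \<in> pps n m"
  shows "w \<in> family_gen n m F L \<longleftrightarrow> (\<exists>A\<in>blocks F (keys (mdeg w)). restr A w \<in> L)"
proof
  assume "w \<in> family_gen n m F L"
  then obtain A t z where A: "A \<in> F" and t: "t \<in> L" "mdeg t = sqdeg A" "w = t + z"
    by (auto simp: family_gen_def pp_gen_def degp_def)
  have finA: "finite A" using A F finite_subset by blast
  then have At: "snd ` keys t = A" using keys_sqdeg t(2) keys_mdeg by metis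
  then have "A \<subseteq> keys (mdeg w)" by (auto simp: t(3) keys_mdeg keys_add_pp)
  then obtain B where B: "B \<in> blocks F (keys (mdeg w))" "A \<subseteq> B" using blocks_cover[of "keys (mdeg w)" A F, OF finite_keys A] by blast
  have "restr B w = t + restr B z" using At B(2) by (simp add: t(3) restr_add restr_id)
  moreover have "restr B z \<in> pps n m" using w t(3) by (auto simp: add_in_pps_iff restr_in_pps)
  ultimately have "restr B w \<in> L" using t(1) mon_ideal_add[OF L(1)] by simp
  with B show "\<exists>A\<in>blocks F (keys (mdeg w)). restr A w \<in> L" by blast
next
  assume "\<exists>A\<in>blocks F (keys (mdeg w)). restr A w \<in> L"
  then obtain A where A: "A \<in> F" "A \<subseteq> keys (mdeg w)" "restr A w \<in> L" by (auto simp: blocks_def)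
  have "keys (mdeg (restr A w)) = A" using A(2) by (auto simp: keys_mdeg keys_restr)
  then obtain t z where t: "t \<in> L" "restr A w = t + z" "mdeg t = sqdeg A"
    using L(2) A(3) unfolding multilinear_generated_def by metis
  have "w = t + (z + restr (- A) w)" using restr_split[of w A] t(2) by (simp add: add.assoc)
  moreover from this have "z + restr (- A) w \<in> pps n m" using w add_in_pps_iff by metis
  ultimately show "w \<in> family_gen n m F L"
    using A(1) t unfolding family_gen_def pp_gen_def degp_def by blast
qed

text \<open>In each finite degree piece, members and nonmembers are matched separately. Nonmembers
  have to be included, because a power product in the generated ideal may have blocks outside
  \<open>M\<close>.\<close>

lemma ex_degree_matching:
  assumes M: "M \<subseteq> pps n m" and M': "M' \<subseteq> pps n m" and eq: "\<And>D. card (degp M D) = card (degp M' D)"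
  shows "\<exists>\<phi>. inj_on \<phi> (pps n m) \<and>
    (\<forall>w\<in>pps n m. \<phi> w \<in> pps n m \<and> mdeg (\<phi> w) = mdeg w \<and> (\<phi> w \<in> M' \<longleftrightarrow> w \<in> M))"
proof -
  have "\<exists>f. inj_on f (degp (pps n m) D) \<and>
      (\<forall>w\<in>degp (pps n m) D. f w \<in> degp (pps n m) D \<and> (f w \<in> M' \<longleftrightarrow> w \<in> M))" for D
  proof -
    let ?S = "degp (pps n m) D"
    have fin: "finite ?S" "finite (degp M D)" "finite (degp M' D)"
      using finite_degp M M' by auto
    have sub: "degp M D \<subseteq> ?S" "degp M' D \<subseteq> ?S" using M M' by (auto simp: degp_def)
    obtain f where f: "bij_betw f (degp M D) (degp M' D)"
      using finite_same_card_bij[OF fin(2,3) eq] by blast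
    have "card (?S - degp M D) = card (?S - degp M' D)"
      using fin sub eq by (simp add: card_Diff_subset)
    then obtain g where g: "bij_betw g (?S - degp M D) (?S - degp M' D)"
      using finite_same_card_bij[of "?S - degp M D" "?S - degp M' D"] fin by auto
    let ?h = "\<lambda>w. if w \<in> degp M D then f w else g w"
    have "inj_on ?h ?S"
    proof (rule inj_onI)
      fix x y assume xy: "x \<in> ?S" "y \<in> ?S" "?h x = ?h y"
      have fx: "f z \<in> degp M' D" if "z \<in> degp M D" for z using bij_betwE[OF f] that by blast
      have gx: "g z \<in> ?S - degp M' D" if "z \<in> ?S - degp M D" for z using bij_betwE[OF g] that by blast
      show "x = y"
        using xy fx[of x] fx[of y] gx[of x] gx[of y]
          inj_onD[OF bij_betw_imp_inj_on[OF f], of x y] inj_onD[OF bij_betw_imp_inj_on[OF g], of x y]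
        by (auto split: if_splits)
    qed
    moreover have "?h w \<in> ?S \<and> (?h w \<in> M' \<longleftrightarrow> w \<in> M)" if "w \<in> ?S" for w
    proof (cases "w \<in> degp M D")
      case True
      then have "f w \<in> degp M' D" using bij_betwE[OF f] by blast
      then show ?thesis using True sub by (auto simp: degp_def)
    next
      case False
      then have "g w \<in> ?S - degp M' D" using bij_betwE[OF g] that by blast
      then show ?thesis using False that by (auto simp: degp_def)
    qed
    ultimately show ?thesis by blast
  qed
  then obtain f where f: "\<And>D. inj_on (f D) (degp (pps n m) D)"
    "\<And>D w. w \<in> degp (pps n m) D \<Longrightarrow> f D w \<in> degp (pps n m) D \<and> (f D w \<in> M' \<longleftrightarrow> w \<in> M)"
    by metis
  let ?\<phi> = "\<lambda>w. f (mdeg w) w"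
  have p: "?\<phi> w \<in> pps n m \<and> mdeg (?\<phi> w) = mdeg w \<and> (?\<phi> w \<in> M' \<longleftrightarrow> w \<in> M)" if "w \<in> pps n m" for w
    using f(2)[of w "mdeg w"] that by (auto simp: degp_def)
  have "inj_on ?\<phi> (pps n m)"
  proof (rule inj_onI)
    fix x y assume xy: "x \<in> pps n m" "y \<in> pps n m" "?\<phi> x = ?\<phi> y"
    then have "mdeg x = mdeg y" using p by metis
    then show "x = y" using xy inj_onD[OF f(1)[of "mdeg x"], of x y] by (auto simp: degp_def)
  qed
  with p show ?thesis by blast
qed

text \<open>A degree-preserving matching of \<open>M\<close> with \<open>M'\<close> is applied to
  each block separately. It keeps column supports, so the blocks of the image can be read off again;
  this gives injectivity, and the blockwise membership test carries over. The hypotheses are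
  symmetric, hence an inequality is enough.\<close>

lemma card_family_gen_le:
  assumes M: "mon_ideal n m M" "multilinear_generated M" and M': "mon_ideal n m M'" "multilinear_generated M'"
    and eq: "\<And>D. card (degp M D) = card (degp M' D)"
    and F: "F \<subseteq> Pow {1..n}" "\<forall>A\<in>F. \<forall>B\<in>F. A \<inter> B \<noteq> {} \<longrightarrow> A \<union> B \<in> F"
  shows "card (degp (family_gen n m F M) D) \<le> card (degp (family_gen n m F M') D)"
proof -
  let ?B = "blocks F (keys D)"
  have fin: "finite ?B" by (rule blocks_finite) simp
  note disj = blocks_disjoint[OF F(2), of "keys D"]
  obtain \<phi> where \<phi>: "inj_on \<phi> (pps n m)" "\<And>w. w \<in> pps n m \<Longrightarrow> \<phi> w \<in> pps n m"
    "\<And>w. w \<in> pps n m \<Longrightarrow> mdeg (\<phi> w) = mdeg w" "\<And>w. w \<in> pps n m \<Longrightarrow> \<phi> w \<in> M' \<longleftrightarrow> w \<in> M"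
    using ex_degree_matching[OF mon_ideal_subset[OF M(1)] mon_ideal_subset[OF M'(1)] eq] by blast
  define \<Phi> where "\<Phi> w = (\<Sum>A\<in>?B. \<phi> (restr A w)) + restr (- \<Union>?B) w" for w
  have cols: "snd ` keys (\<phi> (restr A w)) \<subseteq> A" if "w \<in> pps n m" for A w
  proof -
    have "snd ` keys (\<phi> (restr A w)) = snd ` keys (restr A w)"
      using \<phi>(3)[OF restr_in_pps[OF that]] by (simp flip: keys_mdeg)
    also have "\<dots> \<subseteq> A" by (auto simp: keys_restr)
    finally show ?thesis .
  qed
  have rA: "restr A (\<Phi> w) = \<phi> (restr A w)" if A: "A \<in> ?B" and w: "w \<in> pps n m" for A w
  proof -
    have "restr A (\<phi> (restr A' w)) = (if A' = A then \<phi> (restr A w) else 0)" if A': "A' \<in> ?B" for A'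
    proof (cases "A' = A")
      case True
      then show ?thesis using cols[OF w, of A] by (simp add: restr_id)
    next
      case False
      then have "A' \<inter> A = {}" using disj A A' by (auto simp: pairwise_def disjnt_def)
      then show ?thesis using cols[OF w, of A'] False by (subst restr_disjoint) auto
    qed
    then have "(\<Sum>A'\<in>?B. restr A (\<phi> (restr A' w))) = \<phi> (restr A w)" using fin A by simp
    moreover have "restr A (restr (- \<Union>?B) w) = 0"
      using A by (intro poly_mapping_eqI) (auto simp: lookup_restr)
    ultimately show ?thesis by (simp add: \<Phi>_def restr_add restr_sum)
  qed
  have rR: "restr (- \<Union>?B) (\<Phi> w) = restr (- \<Union>?B) w" if w: "w \<in> pps n m" for w
  proof -
    have "restr (- \<Union>?B) (\<phi> (restr A w)) = 0" if "A \<in> ?B" for A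
      using cols[OF w, of A] that by (intro restr_disjoint) auto
    moreover have "restr (- \<Union>?B) (restr (- \<Union>?B) w) = restr (- \<Union>?B) w"
      by (intro poly_mapping_eqI) (simp add: lookup_restr)
    ultimately show ?thesis by (simp add: \<Phi>_def restr_add restr_sum)
  qed
  have \<Phi>p: "\<Phi> w \<in> pps n m" if w: "w \<in> pps n m" for w
  proof -
    have "(\<Sum>A\<in>X. \<phi> (restr A w)) \<in> pps n m" for X
      using \<phi>(2)[OF restr_in_pps[OF w]]
      by (induction X rule: infinite_finite_induct) (auto intro: plus_in_pps)
    then show ?thesis unfolding \<Phi>_def using restr_in_pps[OF w] by (intro plus_in_pps)
  qed
  have \<Phi>d: "mdeg (\<Phi> w) = mdeg w" if w: "w \<in> pps n m" for w
  proof -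
    have "mdeg (\<Phi> w) = mdeg ((\<Sum>A\<in>?B. restr A w) + restr (- \<Union>?B) w)"
      unfolding \<Phi>_def mdeg_add mdeg_sum using \<phi>(3)[OF restr_in_pps[OF w]] by simp
    then show ?thesis using restr_decomp[OF fin disj, of w] by simp
  qed
  show ?thesis
  proof (rule card_inj_on_le)
    show "inj_on \<Phi> (degp (family_gen n m F M) D)"
    proof (rule inj_onI)
      fix x y assume "x \<in> degp (family_gen n m F M) D" "y \<in> degp (family_gen n m F M) D" and xy: "\<Phi> x = \<Phi> y"
      moreover have "family_gen n m F M \<subseteq> pps n m"
        unfolding family_gen_def using mon_ideal_subset[OF M(1)]
        by (intro mon_ideal_subset[OF pp_gen_mon_ideal]) (auto simp: degp_def)
      ultimately have p: "x \<in> pps n m" "y \<in> pps n m" by (auto simp: degp_def)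
      have "restr A x = restr A y" if "A \<in> ?B" for A
        using rA[OF that p(1)] rA[OF that p(2)] xy inj_onD[OF \<phi>(1)] restr_in_pps p by metis
      moreover have "restr (- \<Union>?B) x = restr (- \<Union>?B) y" using rR p xy by metis
      ultimately show "x = y"
        using restr_decomp[OF fin disj, of x] restr_decomp[OF fin disj, of y] by simp
    qed
    have sub: "family_gen n m F L \<subseteq> pps n m" if "mon_ideal n m L" for L
      unfolding family_gen_def using mon_ideal_subset[OF that]
      by (intro mon_ideal_subset[OF pp_gen_mon_ideal]) (auto simp: degp_def)
    show "finite (degp (family_gen n m F M') D)" by (rule finite_degp[OF sub[OF M'(1)]])
    show "\<Phi> ` degp (family_gen n m F M) D \<subseteq> degp (family_gen n m F M') D"
    proof
      fix y assume "y \<in> \<Phi> ` degp (family_gen n m F M) D"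
      then obtain w where w: "w \<in> family_gen n m F M" "mdeg w = D" "y = \<Phi> w" by (auto simp: degp_def)
      have wp: "w \<in> pps n m" using w(1) sub[OF M(1)] by blast
      then obtain A where A: "A \<in> ?B" "restr A w \<in> M"
        using w mem_family_gen_iff[OF M F(1) wp] by auto
      then have "restr A (\<Phi> w) \<in> M'" using rA[OF A(1) wp] \<phi>(4)[OF restr_in_pps[OF wp]] by simp
      then have "\<Phi> w \<in> family_gen n m F M'"
        using mem_family_gen_iff[OF M' F(1) \<Phi>p[OF wp]] A(1) \<Phi>d[OF wp] w(2) by auto
      then show "y \<in> degp (family_gen n m F M') D" using w \<Phi>d[OF wp] by (simp add: degp_def)
    qed
  qed
qed


section \<open>Initial ideals of ideals generated by components\<close>

text \<open>Reduces linear statements about the generated ideal to the products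
  \<open>monomial z * f\<close>, which are homogeneous when the generators are.\<close>

lemma genideal_span:
  fixes X :: "'k::field mpoly set"
  assumes X: "X \<subseteq> carrier (poly_ring n m)"
  shows "Idl\<^bsub>poly_ring n m\<^esub> X = kvec.span {monomial z * f |z f. z \<in> pps n m \<and> f \<in> X}"
proof
  let ?G = "{monomial z * f |z f. z \<in> pps n m \<and> f \<in> X}"
  note J = genideal_poly_ideal[OF X]
  show "kvec.span ?G \<subseteq> Idl\<^bsub>poly_ring n m\<^esub> X"
    using genideal_superset[OF X] idealD(6)[OF J]
    by (intro kvec.span_minimal ideal_subspace[OF J]) auto
  show "Idl\<^bsub>poly_ring n m\<^esub> X \<subseteq> kvec.span ?G"
  proof (rule genideal_least)
    show "X \<subseteq> kvec.span ?G"
    proof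
      fix f assume "f \<in> X"
      then have "monomial 0 * f \<in> ?G" using zero_in_pps by blast
      then have "monomial 0 * f \<in> kvec.span ?G" by (rule kvec.span_base)
      then show "f \<in> kvec.span ?G" by (simp add: monomial_def)
    qed
    show "ideal (kvec.span ?G) (poly_ring n m)"
      unfolding ideal_iff
    proof (intro conjI ballI)
      show "kvec.span ?G \<subseteq> carrier (poly_ring n m)"
        using subset_trans[OF \<open>kvec.span ?G \<subseteq> Idl\<^bsub>poly_ring n m\<^esub> X\<close>] J unfolding ideal_iff by blast
      fix f s :: "'k mpoly" assume f: "f \<in> kvec.span ?G" and s: "s \<in> carrier (poly_ring n m)"
      have mono: "monomial u * f \<in> kvec.span ?G" if u: "u \<in> pps n m" for u
        using f
      proof (induction rule: kvec.span_induct_alt)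
        case base
        show ?case by (simp add: kvec.span_zero)
      next
        case (step c x y)
        then obtain z f' where x: "x = monomial z * f'" "z \<in> pps n m" "f' \<in> X" by blast
        have "monomial (u + z) * f' \<in> kvec.span ?G"
          using u x plus_in_pps by (intro kvec.span_base) blast
        then have "const c * (monomial u * x) + monomial u * y \<in> kvec.span ?G"
          using step by (intro kvec.span_add kvec.span_scale) (auto simp: x(1) monomial_add mult.assoc)
        then show ?case by (simp add: distrib_left mult.left_commute)
      qed
      have "(\<Sum>u\<in>keys s. const (lookup s u) * (monomial u * f)) \<in> kvec.span ?G"
        using mono s by (intro kvec.span_sum kvec.span_scale) (auto simp: mem_carrier)
      moreover have "(\<Sum>u\<in>keys s. const (lookup s u) * (monomial u * f)) = s * f"
        by (subst (3) poly_sum_single[of s])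
          (simp add: sum_distrib_right single_eq_const_monomial mult.assoc)
      ultimately show "s * f \<in> kvec.span ?G" by simp
    qed (auto intro: kvec.span_zero kvec.span_add)
  qed
qed

definition family_ideal :: "nat \<Rightarrow> (nat \<Rightarrow> nat) \<Rightarrow> nat set set \<Rightarrow> 'k::field mpoly set \<Rightarrow> 'k mpoly set" where
  "family_ideal n m F I = Idl\<^bsub>poly_ring n m\<^esub> (\<Union>A\<in>F. set_component I A)"

lemma set_component_eq: "set_component I A = component I (sqdeg A)"
  by (simp add: set_component_def sqdeg_def)

lemma hom_part_generator:
  assumes "\<And>t. t \<in> keys f \<Longrightarrow> mdeg t = E"
  shows "hom_part D (monomial z * f) = (if D = mdeg z + E then monomial z * f else 0)"
  using assms by (intro hom_part_homogeneous) (auto simp: keys_monomial_mult mdeg_add)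

context
  fixes n :: nat and m :: "nat \<Rightarrow> nat" and F :: "nat set set" and I :: "'k::field mpoly set"
  assumes I: "graded_ideal n m I" and F: "F \<subseteq> Pow {1..n}"
begin

lemma family_carrier: "(\<Union>A\<in>F. set_component I A) \<subseteq> carrier (poly_ring n m)"
proof -
  have "ideal I (poly_ring n m)" using I by (simp add: graded_ideal_def)
  then show ?thesis
    using idealD(1) by (auto simp: set_component_def component_def mem_carrier) blast
qed

lemma family_ideal_ideal: "ideal (family_ideal n m F I) (poly_ring n m)"
  unfolding family_ideal_def by (rule genideal_poly_ideal[OF family_carrier])

lemma family_ideal_induct [consumes 1, case_names subspace gen]:
  assumes f: "f \<in> family_ideal n m F I" and P: "kvec.subspace {f. P f}"
    and gen: "\<And>z A f. z \<in> pps n m \<Longrightarrow> A \<in> F \<Longrightarrow> f \<in> I \<Longrightarrow> (\<And>t. t \<in> keys f \<Longrightarrow> mdeg t = sqdeg A) \<Longrightarrow>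
      P (monomial z * f)"
  shows "P f"
proof -
  have "kvec.span {monomial z * f |z f. z \<in> pps n m \<and> f \<in> (\<Union>A\<in>F. set_component I A)} \<subseteq> {f. P f}"
    using gen by (intro kvec.span_minimal P) (auto simp: set_component_eq component_def)
  then show ?thesis using f by (auto simp: family_ideal_def genideal_span[OF family_carrier])
qed

lemma family_ideal_graded: "graded_ideal n m (family_ideal n m F I)"
  unfolding graded_ideal_def
proof (intro conjI ballI allI)
  show "ideal (family_ideal n m F I) (poly_ring n m)" by (rule family_ideal_ideal)
  fix f a assume "f \<in> family_ideal n m F I"
  then show "hom_part a f \<in> family_ideal n m F I"
  proof (induction rule: family_ideal_induct)
    show "kvec.subspace {f. hom_part a f \<in> family_ideal n m F I}"
      using idealD[OF family_ideal_ideal] by (auto simp: kvec.subspace_def hom_part_add hom_part_scale)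
    fix z A f assume z: "z \<in> pps n m" and A: "A \<in> F" and f: "f \<in> I" "\<And>t. t \<in> keys f \<Longrightarrow> mdeg t = sqdeg A"
    have "f \<in> family_ideal n m F I"
      using genideal_superset[OF family_carrier] A f
      by (auto simp: family_ideal_def set_component_eq component_def)
    then show "hom_part a (monomial z * f) \<in> family_ideal n m F I"
      using idealD[OF family_ideal_ideal] z by (simp add: hom_part_generator[OF f(2)])
  qed
qed

text \<open>For the harder inclusion let \<open>w\<close> be the leading term of a homogeneous
  \<open>f\<close> and outside the expected ideal. Then \<open>proj\<close> fixes \<open>w\<close>
  and sends every other term \<open>t\<close> of \<open>f\<close> to terms not exceeding
  \<open>t\<close>, hence different from \<open>w\<close>. The coefficient of \<open>w\<close>
  therefore survives in the image of \<open>f\<close>, although this image is 0.\<close>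

lemma leads_family_ideal:
  assumes ord: "term_order n m r" and mult: "multilinear_generated (leads r I)"
    and union: "\<forall>A\<in>F. \<forall>B\<in>F. A \<inter> B \<noteq> {} \<longrightarrow> A \<union> B \<in> F"
  shows "leads r (family_ideal n m F I) = family_gen n m F (leads r I)"
proof
  let ?L = "leads r I"
  have id: "ideal I (poly_ring n m)" using I by (simp add: graded_ideal_def)
  have L: "mon_ideal n m ?L" by (rule leads_mon_ideal[OF ord id])
  show "family_gen n m F ?L \<subseteq> leads r (family_ideal n m F I)"
    unfolding family_gen_def
  proof (intro pp_gen_least leads_mon_ideal[OF ord family_ideal_ideal] UN_least)
    fix A assume A: "A \<in> F"
    have "component I (sqdeg A) \<subseteq> family_ideal n m F I"
      using genideal_superset[OF family_carrier] A by (auto simp: family_ideal_def set_component_eq)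
    then show "degp ?L (sqdeg A) \<subseteq> leads r (family_ideal n m F I)"
      unfolding leads_component[OF ord I, symmetric] by (auto simp: leads_def)
  qed
  obtain nf where nf: "\<And>s. s \<in> pps n m \<Longrightarrow> keys (nf s) \<subseteq> {t \<in> pps n m. (t, s) \<in> r}"
    "\<And>s. s \<in> pps n m \<Longrightarrow> s \<notin> ?L \<Longrightarrow> nf s = monomial s" "\<And>h. h \<in> I \<Longrightarrow> linext nf h = 0"
    using normal_form_map[OF ord I] by blast
  show "leads r (family_ideal n m F I) \<subseteq> family_gen n m F ?L"
  proof (rule subsetI, rule ccontr)
    fix w assume "w \<in> leads r (family_ideal n m F I)" and wQ: "w \<notin> family_gen n m F ?L"
    then have "w \<in> leads r (component (family_ideal n m F I) (mdeg w))"
      by (simp add: leads_component[OF ord family_ideal_graded] degp_def)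
    then obtain f where f: "f \<in> family_ideal n m F I" "f \<noteq> 0" "w = lead_pp r f" "\<And>t. t \<in> keys f \<Longrightarrow> mdeg t = mdeg w"
      by (auto simp: leads_def component_def)
    note fk = idealD(1)[OF family_ideal_ideal f(1)]
    note l = lead_props[OF ord f(2) fk, folded f(3)]
    have wp: "w \<in> pps n m" using l(1) fk by blast
    let ?D = "mdeg w"
    let ?B = "blocks F (keys ?D)"
    have fin: "finite ?B" by (rule blocks_finite) simp
    note disj = blocks_disjoint[OF union, of "keys ?D"]
    \<comment> \<open>The blocks belong to the degree of \<open>w\<close>, so the next claim
      concerns only the homogeneous part in this degree.\<close>
    define proj where "proj t = (\<Prod>A\<in>?B. nf (restr A t)) * monomial (restr (- \<Union>?B) t)" for t
    have kill: "linext proj (hom_part ?D f) = 0"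
      using f(1)
    proof (induction rule: family_ideal_induct)
      show "kvec.subspace {f. linext proj (hom_part ?D f) = 0}"
        by (auto simp: kvec.subspace_def hom_part_add hom_part_scale linext_add linext_scale)
      fix z A g assume z: "z \<in> pps n m" and A: "A \<in> F" and g: "g \<in> I" "\<And>t. t \<in> keys g \<Longrightarrow> mdeg t = sqdeg A"
      show "linext proj (hom_part ?D (monomial z * g)) = 0"
      proof (cases "?D = mdeg z + sqdeg A")
        case False
        then show ?thesis by (simp add: hom_part_generator[OF g(2)])
      next
        case True
        have kA: "keys (sqdeg A) = A" using A F finite_subset by (intro keys_sqdeg) blast
        then have "A \<subseteq> keys ?D" by (auto simp: True keys_add_pp)
        then obtain A0 where A0: "A0 \<in> ?B" "A \<subseteq> A0"
          using blocks_cover[of "keys ?D" A F, OF finite_keys A] by blast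
        \<comment> \<open>Terms of \<open>g\<close> live in the columns of \<open>A\<close>, inside
          the single block \<open>A0\<close>; the factors of all other blocks depend on
          \<open>z\<close> alone and can be pulled out.\<close>
        define rest where "rest = (\<Prod>B\<in>?B - {A0}. nf (restr B z)) * monomial (restr (- \<Union>?B) z)"
        have "proj (z + t) = nf (restr A0 z + t) * rest" if t: "t \<in> keys g" for t
        proof -
          have kt: "snd ` keys t = A" using g(2)[OF t] kA keys_mdeg by metis
          have "restr B (z + t) = restr B z" if "B \<in> ?B - {A0}" for B
          proof -
            have "A0 \<inter> B = {}" using disj A0 that by (auto simp: pairwise_def disjnt_def)
            then show ?thesis using kt A0 by (simp add: restr_add restr_disjoint disjoint_iff subset_iff)
          qed
          moreover have "restr (- \<Union>?B) (z + t) = restr (- \<Union>?B) z"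
            using kt A0 by (subst restr_add, subst (2) restr_disjoint) auto
          moreover have "restr A0 (z + t) = restr A0 z + t" using kt A0 by (simp add: restr_add restr_id)
          ultimately show ?thesis
            unfolding proj_def rest_def prod.remove[OF fin A0(1)] by (simp add: mult.assoc)
        qed
        then have "linext proj (monomial z * g) = linext (\<lambda>t. nf (restr A0 z + t) * rest) g"
          unfolding linext_monomial_mult by (intro linext_cong)
        also have "\<dots> = linext nf (monomial (restr A0 z) * g) * rest"
          by (simp add: linext_mult_right linext_monomial_mult)
        also have "\<dots> = 0" using nf(3) idealD(6)[OF id g(1) restr_in_pps[OF z]] by simp
        finally show ?thesis using True by (simp add: hom_part_generator[OF g(2)])
      qed
    qed
    \<comment> \<open>Products respect the order, so replacing each block by its normal form
      produces no larger terms.\<close>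
    have bound: "keys (\<Prod>A\<in>X. nf (restr A t)) \<subseteq> {s \<in> pps n m. (s, \<Sum>A\<in>X. restr A t) \<in> r}"
      if t: "t \<in> pps n m" for t X
    proof (induction X rule: infinite_finite_induct)
      case (insert A X)
      have "s \<in> pps n m \<and> (s, \<Sum>A\<in>insert A X. restr A t) \<in> r"
        if s: "s \<in> keys (\<Prod>A\<in>insert A X. nf (restr A t))" for s
      proof -
        obtain a b where ab: "s = a + b" "a \<in> keys (nf (restr A t))" "b \<in> keys (\<Prod>A\<in>X. nf (restr A t))"
          using s insert.hyps keys_mult[of "nf (restr A t)" "\<Prod>A\<in>X. nf (restr A t)"] by auto
        have a: "a \<in> pps n m" "(a, restr A t) \<in> r" using nf(1)[OF restr_in_pps[OF t]] ab(2) by blast+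
        have b: "b \<in> pps n m" "(b, \<Sum>A\<in>X. restr A t) \<in> r" using insert.IH ab(3) by blast+
        have "(a + b, restr A t + b) \<in> r" by (rule ord_add[OF ord a(2) b(1)])
        moreover have "(restr A t + b, restr A t + (\<Sum>A\<in>X. restr A t)) \<in> r"
          using ord_add[OF ord b(2) restr_in_pps[OF t, of A]] by (simp only: add.commute[of _ "restr A t"])
        ultimately have "(a + b, restr A t + (\<Sum>A\<in>X. restr A t)) \<in> r"
          by (rule ord_trans[OF ord])
        then show ?thesis using ab(1) a b insert.hyps by (simp add: plus_in_pps)
      qed
      then show ?case by blast
    qed (auto intro: ord_refl[OF ord])
    have proj_bound: "(s, t) \<in> r" if t: "t \<in> pps n m" and s: "s \<in> keys (proj t)" for s t
    proof -
      obtain a where a: "a \<in> keys (\<Prod>A\<in>?B. nf (restr A t))" "s = a + restr (- \<Union>?B) t"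
        using s keys_mult[of "\<Prod>A\<in>?B. nf (restr A t)" "monomial (restr (- \<Union>?B) t)"]
        unfolding proj_def by (auto simp: monomial_def)
      then have "(a, \<Sum>A\<in>?B. restr A t) \<in> r" using bound[OF t] by blast
      from ord_add[OF ord this restr_in_pps[OF t, of "- \<Union>?B"]]
      show ?thesis using restr_decomp[OF fin disj, of t] a(2) by simp
    qed
    have proj_w: "proj w = monomial w"
    proof -
      have "nf (restr A w) = monomial (restr A w)" if "A \<in> ?B" for A
        using wQ that mem_family_gen_iff[OF L mult F wp] by (intro nf(2) restr_in_pps[OF wp]) blast
      moreover have "(\<Prod>A\<in>X. monomial (restr A w)) = (monomial (\<Sum>A\<in>X. restr A w) :: 'k mpoly)" for X
        by (induction X rule: infinite_finite_induct) (auto simp: monomial_add, auto simp: monomial_def)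
      ultimately have "proj w = monomial ((\<Sum>A\<in>?B. restr A w) + restr (- \<Union>?B) w)"
        by (simp add: proj_def monomial_add)
      then show ?thesis using restr_decomp[OF fin disj, of w] by simp
    qed
    have "hom_part ?D f = f" using f(4) by (subst hom_part_homogeneous[of f ?D]) auto
    then have "0 = lookup (linext proj f) w" using kill by simp
    also have "\<dots> = (\<Sum>t\<in>keys f. lookup f t * lookup (proj t) w)" by (simp add: linext_def lookup_sum)
    also have "\<dots> = (\<Sum>t\<in>keys f. if t = w then lookup f w else 0)"
    proof (intro sum.cong refl)
      fix t assume t: "t \<in> keys f"
      show "lookup f t * lookup (proj t) w = (if t = w then lookup f w else 0)"
      proof (cases "t = w")
        case True
        then show ?thesis by (simp add: proj_w monomial_def)
      next
        case False
        have "w \<notin> keys (proj t)"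
          using proj_bound[of t w] l(2)[OF t] fk t False ord_antisym[OF ord] by blast
        then show ?thesis using False by (simp add: in_keys_iff)
      qed
    qed
    also have "\<dots> = lookup f w" using l(1) by simp
    finally show False using l(1) by (simp add: in_keys_iff)
  qed
qed

end

section \<open>The ideal built from \<open>I\<close> compared with the one built from
  \<open>B\<close>\<close>

lemma cartwright_sturmfelsE:
  assumes "cartwright_sturmfels n m (I :: 'k::field mpoly set)"
  obtains M where "mon_ideal n m M" "squarefree_closed M" "strongly_stable M"
    "borel_fixed n m (kspan M :: 'k mpoly set)" "graded_ideal n m I"
    "hilbert_series (kspan M :: 'k mpoly set) = hilbert_series I"
proof -
  from assms obtain B :: "'k mpoly set" where B: "graded_ideal n m I" "monomial_ideal n m B"
    "radical_ideal n m B" "borel_fixed n m B" "hilbert_series B = hilbert_series I"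
    by (auto simp: cartwright_sturmfels_def)
  then obtain M where M: "mon_ideal n m M" "B = kspan M" by (auto simp: monomial_ideal_iff)
  then have sf: "squarefree_closed M" using B squarefree_closed_radical by blast
  then have "strongly_stable M" using M B strongly_stable_borel by blast
  with sf M B show ?thesis using that by blast
qed

lemma hilbert_series_eq_card:
  fixes I I' :: "'k::field mpoly set"
  assumes "term_order n m r" "graded_ideal n m I" "graded_ideal n m I'"
  shows "hilbert_series I = hilbert_series I' \<longleftrightarrow>
    (\<forall>D. card (degp (leads r I) D) = card (degp (leads r I') D))"
  using assms by (simp add: fun_eq_iff hilbert_series_leads)

theorem proposition4p2:
  fixes n :: nat and m :: "nat \<Rightarrow> nat"
    and F :: "nat set set"
    and I J :: "'k::field mpoly set"
  assumes "infinite (UNIV :: 'k set)"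
    and "F \<subseteq> Pow {1..n}"
    and "\<forall>A\<in>F. \<forall>B\<in>F. A \<inter> B \<noteq> {} \<longrightarrow> A \<union> B \<in> F"
    and "cartwright_sturmfels n m I"
    and "J = Idl\<^bsub>poly_ring n m\<^esub> (\<Union>A\<in>F. set_component I A)"
  shows "cartwright_sturmfels n m J \<and>
    (\<forall>r. term_order n m r \<longrightarrow>
      initial_space r J = Idl\<^bsub>poly_ring n m\<^esub> (\<Union>A\<in>F. initial_space r (set_component I A)))"
proof (intro conjI allI impI)
  note F = assms(2,3)
  obtain M where M: "mon_ideal n m M" "squarefree_closed M" "strongly_stable M"
    "borel_fixed n m (kspan M :: 'k mpoly set)"
    and I: "graded_ideal n m I" and hs: "hilbert_series (kspan M :: 'k mpoly set) = hilbert_series I"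
    by (rule cartwright_sturmfelsE[OF assms(4)])
  have id: "ideal I (poly_ring n m)" using I by (simp add: graded_ideal_def)
  let ?B = "kspan M :: 'k mpoly set"
  have B: "graded_ideal n m ?B" by (rule kspan_graded[OF M(1)])
  have J: "J = family_ideal n m F I" by (simp add: assms(5) family_ideal_def)
  have leadsB: "leads r ?B = M" if "term_order n m r" for r
    by (rule leads_kspan[OF that mon_ideal_subset[OF M(1)]])
  have cardL: "card (degp (leads r I) D) = card (degp M D)" if "term_order n m r" for r D
    using hs hilbert_series_eq_card[OF that B I] leadsB[OF that] by simp
  have L: "mon_ideal n m (leads r I)" if "term_order n m r" for r by (rule leads_mon_ideal[OF that id])
  have mg: "multilinear_generated (leads r I)" if "term_order n m r" for r
    by (rule multilinear_generatedI[OF L[OF that] M(1,3,2) cardL[OF that]])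
  have mgM: "multilinear_generated M" by (rule strongly_stable_multilinear[OF M(1,3,2)])
  have leadsJ: "leads r J = family_gen n m F (leads r I)" if "term_order n m r" for r
    unfolding J by (rule leads_family_ideal[OF I F(1) that mg[OF that] F(2)])
  {
    fix r assume ord: "term_order n m r"
    show "initial_space r J = Idl\<^bsub>poly_ring n m\<^esub> (\<Union>A\<in>F. initial_space r (set_component I A))"
      unfolding initial_space_leads[OF ord] leadsJ[OF ord] family_gen_def set_component_eq
        leads_component[OF ord I]
      using mon_ideal_subset[OF L[OF ord]] by (intro genideal_kspans[symmetric]) (auto simp: degp_def)
  }
  \<comment> \<open>Some term order is fixed in order to read off Hilbert functions from leading
    terms.\<close>
  obtain r where ord: "term_order n m r" using term_order_exists by blast
  let ?T = "\<Union>A\<in>F. degp M (sqdeg A)"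
  have T: "?T \<subseteq> pps n m" using mon_ideal_subset[OF M(1)] by (auto simp: degp_def)
  \<comment> \<open>The radical Borel-fixed witness for \<open>J\<close> arises from
    \<open>?B\<close> in the way \<open>J\<close> arises from \<open>I\<close>.\<close>
  let ?J' = "family_ideal n m F ?B"
  have "set_component ?B A = kspan (degp M (sqdeg A))" for A
    by (auto simp: set_component_eq component_def kspan_def degp_def)
  then have J': "?J' = kspan (pp_gen n m ?T)"
    unfolding family_ideal_def
    using mon_ideal_subset[OF M(1)] by (simp add: genideal_kspans degp_def subset_iff)
  have "monomial_ideal n m ?J'"
    unfolding J' monomial_ideal_iff using pp_gen_mon_ideal[OF T] by blast
  moreover have "radical_ideal n m ?J'"
    unfolding J'
  proof (rule radical_squarefree_gen[OF T])
    fix t v assume "t \<in> ?T"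
    then obtain A where A: "A \<in> F" "mdeg t = sqdeg A" by (auto simp: degp_def)
    \<comment> \<open>In a squarefree multidegree every column contributes at most one variable, so
      the generators are squarefree.\<close>
    have "lookup t v \<le> lookup (sqdeg A) (snd v)" using lookup_le_mdeg[of t v] A(2) by simp
    also have "\<dots> \<le> 1" using A(1) F(1) finite_subset[of A "{1..n}"] by (subst lookup_sqdeg) auto
    finally show "lookup t v \<le> 1" .
  qed
  moreover have "borel_fixed n m ?J'"
    unfolding family_ideal_def by (rule borel_fixed_genideal[OF B M(4) refl])
  moreover have "hilbert_series ?J' = hilbert_series J"
  proof -
    have "leads r ?J' = family_gen n m F M"
      using leads_family_ideal[OF B F(1) ord _ F(2)] leadsB[OF ord] mgM by simp
    \<comment> \<open>\<open>M\<close> and the leading terms of \<open>I\<close> share a Hilbert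
      function and are both generated in squarefree degrees, so the blockwise inequality holds in
      both directions.\<close>
    moreover have "card (degp (family_gen n m F M) D) = card (degp (family_gen n m F (leads r I)) D)" for D
      using card_family_gen_le[OF M(1) mgM L[OF ord] mg[OF ord] cardL[OF ord, symmetric] F]
        card_family_gen_le[OF L[OF ord] mg[OF ord] M(1) mgM cardL[OF ord] F]
      by (intro antisym)
    ultimately show ?thesis
      using hilbert_series_eq_card[OF ord family_ideal_graded[OF B F(1)], of J] leadsJ[OF ord]
        family_ideal_graded[OF I F(1)] by (simp add: J)
  qed
  ultimately show "cartwright_sturmfels n m J"
    unfolding cartwright_sturmfels_def J using family_ideal_graded[OF I F(1)] by blast
qed

end
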